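(* Let $\mathbf{k}$ be an algebraically closed field and $R$ a based ring with basis $I$ and universal grading group $U(R)$. Every categorical $n$-cocycle $f:I^n\to\mathbf{k}^\times$ is pulled back from $U(R)$, i.e. there is a group $n$-cocycle $\overline f:U(R)^n\to\mathbf{k}^\times$ such that $f(i_1,\dots,i_n)=\overline f(\deg i_1,\dots,\deg i_n)$ for all $i_1,\dots,i_n\in I$, in each of the following cases: (i) $n=2$ (categorical $2$-cocycles for a categorification of $R$); (ii) $n=3$ (categorical $3$-cocycles for a categorification of $R$); (iii) $n=4$ (categorical $4$-cocycles for $R$).
   Context: A based ring $R$ here is a ring free as a $\mathbb{Z}$-module with basis $I\ni 1$, with structure constants $N_{ij}^k\in\mathbb{Z}_{\ge 0}$ ($ij=\sum_k N_{ij}^k k$, finite sums) and an involution $i\mapsto i^*$ of $I$ inducing an anti-automorphism of $R$ such that $N_{ij}^{1}=1$ if $j=i^*$ and $0$ otherwise. For $a,b\in R$, $a\le b$ means that $b-a$ has nonnegative coefficients. For $x,y\in I$ set $x\sim y$ if $x,y\le u_1\cdots u_n$ for some $u_1,\dots,u_n\in I$; this is an equivalence relation, $U(R):=I/\sim$, $\deg x$ is the class of $x$, and $U(R)$ is a group with $\deg x\cdot\deg y=\deg z$ whenever $z\le xy$, $z\in I$. Group cocycles are taken with the trivial action on $\mathbf{k}^\times$. A categorification of $R$ over $\mathbf{k}$ is a semisimple tensor category $\mathcal{C}$ over $\mathbf{k}$ (semisimple $\mathbf{k}$-linear abelian rigid monoidal category with finite-dimensional Homs, bilinear $\otimes$ and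 $\mathrm{End}(\mathbf{1})=\mathbf{k}$) with an identification of its Grothendieck ring with $R$ as based rings: the simple objects are $X_i$, $i\in I$, with $X_i\otimes X_j\cong\bigoplus_k N_{ij}^kX_k$. Let $\alpha$ be its associativity isomorphism. A categorical $2$-cocycle for $\mathcal{C}$ is a function $f:I^2\to\mathbf{k}^\times$ such that the morphisms $f(i,j)\,\mathrm{id}_{X_i\otimes X_j}$, extended additively, define a tensor structure on the identity functor of $\mathcal{C}$. A categorical $3$-cocycle for $\mathcal{C}$ is a function $f:I^3\to\mathbf{k}^\times$ such that the morphisms $f(i,j,k)\,\alpha_{X_i,X_j,X_k}$, extended additively, define a new associativity constraint on $\mathcal{C}$ (i.e. satisfy the pentagon). A projective categorification of $R$ is a $\mathbf{k}$-linear semisimple category $\mathcal{C}$ with simple objects $X_i$, $i\in I$, a tensor product functor with Grothendieck ring $R$ and unit object $\mathbf{1}=X_1$ (with natural unit isomorphisms $\mathbf{1}\otimes X\cong X\cong X\otimes\mathbf{1}$), and a natural associativity isomorphism $\alpha_{X,Y,Z}:(X\otimes Y)\otimes Z\to X\otimes(Y\otimes Z)$ satisfying the pentagon up to a scalar on each product of four simple objects: $$(\mathrm{id}_{X_i}\otimes\alpha_{X_j,X_k,X_l})\,\alpha_{X_i,X_j\otimes X_k,X_l}\,(\alpha_{X_i,X_j,X_k}\otimes\mathrm{id}_{X_l})=\delta(i,j,k,l)\,\alpha_{X_i,X_j,X_k\otimes X_l}\,\alpha_{X_i\otimes X_j,X_k,X_l},$$ with $\delta(i,j,k,l)\in\mathbf{k}^\times$,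 such that $\mathcal{C}$ is rigid: every simple $X=X_i$ is equipped with maps $\mathrm{coev}_X:\mathbf{1}\to X\otimes X^*$ and $\mathrm{ev}_X:X^*\otimes X\to\mathbf{1}$, $X^*:=X_{i^*}$, such that the composition $X\to(X\otimes X^* )\otimes X\to X\otimes(X^*\otimes X)\to X$ is the identity. A function $\delta:I^4\to\mathbf{k}^\times$ arising in this way is called a categorical $4$-cocycle for $R$. *)

theory Defs
  imports "HOL-Algebra.Group" "HOL-Computational_Algebra.Polynomial"
begin

section \<open>Based rings\<close>

definition zscale :: "int \<Rightarrow> 'r::ring_1 \<Rightarrow> 'r" where
  "zscale n x = of_int n * x"

interpretation zmod: module zscale
  by unfold_locales (auto simp: zscale_def algebra_simps)

abbreviation coeff_in :: "'r::ring_1 set \<Rightarrow> 'r \<Rightarrow> 'r \<Rightarrow> int" where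
  "coeff_in I x k \<equiv> zmod.representation I x k"

text \<open>
  The basis \<open>I\<close> is a subset of the ring and \<open>N\<^sub>i\<^sub>j\<^sup>k\<close> is \<open>coeff_in I (i * j) k\<close>. The map \<open>dual\<close>
  is the additive extension to the whole ring of the involution of \<open>I\<close>.
\<close>

locale based_ring =
  fixes I :: "'r::ring_1 set" and dual :: "'r \<Rightarrow> 'r"
  assumes basis_indep: "zmod.independent I"
    and basis_span: "zmod.span I = UNIV"
    and one_in_basis: "1 \<in> I"
    and structure_nonneg: "\<lbrakk>i \<in> I; j \<in> I; k \<in> I\<rbrakk> \<Longrightarrow> 0 \<le> coeff_in I (i * j) k"
    and dual_in_basis: "i \<in> I \<Longrightarrow> dual i \<in> I"
    and dual_dual: "i \<in> I \<Longrightarrow> dual (dual i) = i"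
    and dual_add: "dual (x + y) = dual x + dual y"
    and dual_mult: "dual (x * y) = dual y * dual x"
    and coeff_one: "\<lbrakk>i \<in> I; j \<in> I\<rbrakk> \<Longrightarrow> coeff_in I (i * j) 1 = (if j = dual i then 1 else 0)"

definition based_le :: "'r::ring_1 set \<Rightarrow> 'r \<Rightarrow> 'r \<Rightarrow> bool" where
  "based_le I a b \<longleftrightarrow> (\<forall>k\<in>I. 0 \<le> coeff_in I (b - a) k)"

subsection \<open>The universal grading group\<close>

definition deg_rel :: "'r::ring_1 set \<Rightarrow> ('r \<times> 'r) set" where
  "deg_rel I = {(x, y). x \<in> I \<and> y \<in> I \<and>
     (\<exists>us. us \<noteq> [] \<and> set us \<subseteq> I \<and> based_le I x (prod_list us) \<and> based_le I y (prod_list us))}"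

definition deg :: "'r::ring_1 set \<Rightarrow> 'r \<Rightarrow> 'r set" where
  "deg I x = deg_rel I `` {x}"

definition grading_group :: "'r::ring_1 set \<Rightarrow> 'r set monoid" where
  "grading_group I = \<lparr>carrier = I // deg_rel I,
     monoid.mult = (\<lambda>A B. THE D. \<exists>x\<in>A. \<exists>y\<in>B. \<exists>z\<in>I. based_le I z (x * y) \<and> D = deg I z),
     monoid.one = deg I 1\<rparr>"

text \<open>The relation is an equivalence relation, and the description in \<open>grading_group\<close> does define a
  group; these are \<open>equiv_deg_rel\<close>, \<open>mult_deg\<close> and \<open>group_grading_group\<close> below.\<close>

context based_ring
begin

lemma coeff_add: "coeff_in I (x + y) k = coeff_in I x k + coeff_in I y k"
  using zmod.representation_add[OF basis_indep] basis_span by (metis UNIV_I)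

lemma coeff_diff: "coeff_in I (x - y) k = coeff_in I x k - coeff_in I y k"
  using zmod.representation_diff[OF basis_indep] basis_span by (metis UNIV_I)

lemma coeff_zscale: "coeff_in I (zscale n x) k = n * coeff_in I x k"
  using zmod.representation_scale[OF basis_indep] basis_span by (metis UNIV_I)

lemma coeff_basis: "i \<in> I \<Longrightarrow> coeff_in I i k = (if k = i then 1 else 0)"
  using zmod.representation_basis[OF basis_indep] by simp

lemma coeff_zero: "coeff_in I 0 k = 0"
  by (simp add: zmod.representation_zero)

lemma expand: "(\<Sum>b | coeff_in I x b \<noteq> 0. zscale (coeff_in I x b) b) = x"
  using zmod.sum_nonzero_representation_eq[OF basis_indep] basis_span by blast

definition pos :: "'r \<Rightarrow> bool" where "pos x \<longleftrightarrow> (\<forall>k\<in>I. 0 \<le> coeff_in I x k)"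

lemma le_pos: "based_le I a b \<longleftrightarrow> pos (b - a)"
  by (simp add: based_le_def pos_def)

lemma pos_add: "pos x \<Longrightarrow> pos y \<Longrightarrow> pos (x + y)"
  by (simp add: pos_def coeff_add)

lemma pos_sum: "(\<And>a. a \<in> A \<Longrightarrow> pos (f a)) \<Longrightarrow> pos (\<Sum>a\<in>A. f a)"
  by (induction A rule: infinite_finite_induct) (auto intro: pos_add simp: pos_def[of 0] coeff_zero)

lemma pos_zscale: "0 \<le> n \<Longrightarrow> pos x \<Longrightarrow> pos (zscale n x)"
  by (simp add: pos_def coeff_zscale)

lemma in_basis: "coeff_in I x b \<noteq> 0 \<Longrightarrow> b \<in> I"
  using zmod.representation_ne_zero by blast

lemma pos_mult: assumes "pos x" "pos y" shows "pos (x * y)"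
proof -
  have "x * y = (\<Sum>a | coeff_in I x a \<noteq> 0. \<Sum>b | coeff_in I y b \<noteq> 0.
      zscale (coeff_in I x a * coeff_in I y b) (a * b))"
    apply (subst expand[of x, symmetric], subst expand[of y, symmetric])
    apply (simp only: sum_product)
    apply (intro sum.cong refl)
    apply (simp add: zscale_def mult.assoc)
    by (metis mult_of_int_commute mult.assoc)
  moreover have "pos (zscale (coeff_in I x a * coeff_in I y b) (a * b))"
    if "coeff_in I x a \<noteq> 0" "coeff_in I y b \<noteq> 0" for a b
    using that in_basis assms structure_nonneg by (intro pos_zscale) (auto simp: pos_def)
  ultimately show ?thesis by (auto intro: pos_sum)
qed

lemma le_refl: "based_le I x x" by (simp add: le_pos pos_def coeff_zero)

lemma le_trans: "based_le I x y \<Longrightarrow> based_le I y z \<Longrightarrow> based_le I x z"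
  using pos_add[of "y - x" "z - y"] by (simp add: le_pos)

lemma pos_basis: "i \<in> I \<Longrightarrow> pos i" by (simp add: pos_def coeff_basis)

lemma le_mult: assumes "pos a" "pos b'" "based_le I a a'" "based_le I b b'"
  shows "based_le I (a * b) (a' * b')"
proof -
  have "a' * b' - a * b = a * (b' - b) + (a' - a) * b'" by (simp add: algebra_simps)
  then show ?thesis using assms by (auto simp: le_pos intro: pos_add pos_mult)
qed

lemma pos_prod: "set us \<subseteq> I \<Longrightarrow> pos (prod_list us)"
  by (induction us) (auto intro: pos_mult pos_basis one_in_basis)

lemma one_le_dual: "i \<in> I \<Longrightarrow> based_le I 1 (i * dual i)" "i \<in> I \<Longrightarrow> based_le I 1 (dual i * i)"
  using coeff_one[of i "dual i"] coeff_one[of "dual i" i] structure_nonneg dual_in_basis dual_dual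
  by (auto simp: based_le_def coeff_diff coeff_basis one_in_basis)

lemma le_iff: "z \<in> I \<Longrightarrow> pos a \<Longrightarrow> based_le I z a \<longleftrightarrow> coeff_in I a z \<noteq> 0"
  by (auto simp: based_le_def pos_def coeff_diff coeff_basis)

lemma relI: "x \<in> I \<Longrightarrow> y \<in> I \<Longrightarrow> us \<noteq> [] \<Longrightarrow> set us \<subseteq> I \<Longrightarrow> based_le I x (prod_list us)
   \<Longrightarrow> based_le I y (prod_list us) \<Longrightarrow> (x,y) \<in> deg_rel I"
  by (auto simp: deg_rel_def)

lemma equiv_deg_rel: "equiv I (deg_rel I)"
proof (rule equivI)
  show "deg_rel I \<subseteq> I \<times> I" by (auto simp: deg_rel_def)
  show "refl_on I (deg_rel I)"
    by (auto simp: refl_on_def intro!: relI[where us="[_]"] le_refl)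
  show "sym (deg_rel I)" by (auto simp: sym_def deg_rel_def)
  show "trans (deg_rel I)"
  proof (rule transI)
    fix x y z assume "(x,y) \<in> deg_rel I" "(y,z) \<in> deg_rel I"
    then obtain us vs where I: "x \<in> I" "y \<in> I" "z \<in> I" and u: "us \<noteq> []" "set us \<subseteq> I" "set vs \<subseteq> I"
      "based_le I x (prod_list us)" "based_le I y (prod_list us)"
      "based_le I y (prod_list vs)" "based_le I z (prod_list vs)"
      by (auto simp: deg_rel_def)
    note p = pos_basis[OF I(1)] pos_basis[OF I(2)] pos_basis[OF I(3)] pos_basis[OF dual_in_basis[OF I(2)]]
      pos_prod[OF u(2)] pos_prod[OF u(3)] pos_basis[OF one_in_basis]
    let ?w = "prod_list us * (dual y * prod_list vs)"
    have "based_le I (dual y * y) (dual y * prod_list vs)" "based_le I (dual y * z) (dual y * prod_list vs)"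
      using p u by (auto intro!: le_mult le_refl)
    then have "based_le I (x * (dual y * y)) ?w" "based_le I (y * (dual y * z)) ?w"
      using p u by (auto intro!: le_mult pos_mult)
    moreover have "based_le I (x * 1) (x * (dual y * y))" "based_le I (1 * z) ((y * dual y) * z)"
      using p one_le_dual I by (auto intro!: le_mult le_refl pos_mult simp del: mult_1_right mult_1_left)
    ultimately have "based_le I x ?w" "based_le I z ?w" using le_trans by (auto simp: mult.assoc)
    then show "(x,z) \<in> deg_rel I"
      using relI[of x z "us @ dual y # vs"] I u dual_in_basis by auto
  qed
qed

lemma deg_eq: "x \<in> I \<Longrightarrow> y \<in> I \<Longrightarrow> deg I x = deg I y \<longleftrightarrow> (x,y) \<in> deg_rel I"
  unfolding deg_def using eq_equiv_class_iff[OF equiv_deg_rel] by blast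

lemma ex_le: assumes "x \<in> I" "y \<in> I" shows "\<exists>z\<in>I. based_le I z (x * y)"
proof -
  have "\<exists>z. coeff_in I (x * y) z \<noteq> 0"
  proof (rule ccontr)
    assume "\<not> ?thesis"
    then have 0: "x * y = 0" using expand[of "x*y"] by simp
    have "based_le I (1 * y) ((dual x * x) * y)"
      using assms by (intro le_mult one_le_dual le_refl pos_basis one_in_basis)
    then have "based_le I y 0" using 0 by (simp add: mult.assoc)
    then show False using assms unfolding based_le_def coeff_diff by (force simp: coeff_basis coeff_zero)
  qed
  then show ?thesis using le_iff in_basis pos_mult pos_basis assms by metis
qed

lemma mult_deg: assumes "x \<in> I" "y \<in> I" "z \<in> I" "based_le I z (x * y)"
  shows "deg I x \<otimes>\<^bsub>grading_group I\<^esub> deg I y = deg I z"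
  unfolding grading_group_def monoid.simps
proof (rule the_equality)
  show "\<exists>x'\<in>deg I x. \<exists>y'\<in>deg I y. \<exists>z'\<in>I. based_le I z' (x' * y') \<and> deg I z = deg I z'"
    using assms equiv_class_self[OF equiv_deg_rel] unfolding deg_def by blast
next
  fix D assume "\<exists>x'\<in>deg I x. \<exists>y'\<in>deg I y. \<exists>z'\<in>I. based_le I z' (x' * y') \<and> D = deg I z'"
  then obtain x' y' z' where "(x,x') \<in> deg_rel I" "(y,y') \<in> deg_rel I" and z': "z' \<in> I" "based_le I z' (x' * y')" "D = deg I z'"
    by (auto simp: deg_def)
  then obtain us vs where I: "x' \<in> I" "y' \<in> I" and u: "us \<noteq> []" "set us \<subseteq> I" "set vs \<subseteq> I"
      "based_le I x (prod_list us)" "based_le I x' (prod_list us)"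
      "based_le I y (prod_list vs)" "based_le I y' (prod_list vs)"
    by (auto simp: deg_rel_def)
  have "based_le I z (prod_list (us @ vs))" "based_le I z' (prod_list (us @ vs))"
    using u I assms
    by (auto intro!: le_trans[OF assms(4)] le_trans[OF z'(2)] le_mult intro: pos_prod pos_basis)
  then show "D = deg I z" using relI[of z' z "us @ vs"] z' assms u deg_eq by auto
qed

lemma carrier_iff: "A \<in> carrier (grading_group I) \<longleftrightarrow> (\<exists>x\<in>I. A = deg I x)"
  by (auto simp: grading_group_def quotient_def deg_def)

lemma group_grading_group: "group (grading_group I)"
proof (rule groupI)
  have one: "\<one>\<^bsub>grading_group I\<^esub> = deg I 1" by (simp add: grading_group_def)
  show "\<one>\<^bsub>grading_group I\<^esub> \<in> carrier (grading_group I)" using one carrier_iff one_in_basis by auto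
  show "A \<otimes>\<^bsub>grading_group I\<^esub> B \<in> carrier (grading_group I)"
    if AB: "A \<in> carrier (grading_group I)" "B \<in> carrier (grading_group I)" for A B
  proof -
    obtain x y where xy: "x \<in> I" "y \<in> I" "A = deg I x" "B = deg I y"
      using AB carrier_iff by auto
    obtain z where z: "z \<in> I" "based_le I z (x * y)" using ex_le xy by blast
    show ?thesis using mult_deg[OF xy(1,2) z] z(1) xy carrier_iff by auto
  qed
  show "\<one>\<^bsub>grading_group I\<^esub> \<otimes>\<^bsub>grading_group I\<^esub> A = A" if A: "A \<in> carrier (grading_group I)" for A
  proof -
    obtain x where x: "x \<in> I" "A = deg I x" using A carrier_iff by auto
    show ?thesis using mult_deg[OF one_in_basis x(1) x(1)] le_refl[of x] x one by simp
  qed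
  show "\<exists>B\<in>carrier (grading_group I). B \<otimes>\<^bsub>grading_group I\<^esub> A = \<one>\<^bsub>grading_group I\<^esub>"
    if A: "A \<in> carrier (grading_group I)" for A
  proof -
    obtain x where x: "x \<in> I" "A = deg I x" using A carrier_iff by auto
    have "deg I (dual x) \<otimes>\<^bsub>grading_group I\<^esub> A = \<one>\<^bsub>grading_group I\<^esub>"
      using mult_deg[OF dual_in_basis[OF x(1)] x(1) one_in_basis one_le_dual(2)[OF x(1)]] x(2) one
      by simp
    then show ?thesis using carrier_iff dual_in_basis[OF x(1)] by blast
  qed
  show "A \<otimes>\<^bsub>grading_group I\<^esub> B \<otimes>\<^bsub>grading_group I\<^esub> D = A \<otimes>\<^bsub>grading_group I\<^esub> (B \<otimes>\<^bsub>grading_group I\<^esub> D)"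
    if ABD: "A \<in> carrier (grading_group I)" "B \<in> carrier (grading_group I)" "D \<in> carrier (grading_group I)" for A B D
  proof -
    obtain a b d where abd: "a \<in> I" "b \<in> I" "d \<in> I" and e: "A = deg I a" "B = deg I b" "D = deg I d" using ABD carrier_iff by auto
    obtain p where p: "p \<in> I" "based_le I p (a * b)" using ex_le abd by blast
    obtain q where q: "q \<in> I" "based_le I q (b * d)" using ex_le abd by blast
    obtain r where r: "r \<in> I" "based_le I r (p * d)" using ex_le abd p by blast
    obtain s where s: "s \<in> I" "based_le I s (a * q)" using ex_le abd q by blast
    have "based_le I (p * d) (a * b * d)" "based_le I (a * q) (a * (b * d))"
      using p q abd by (auto intro!: le_mult le_refl intro: pos_basis pos_mult)
    then have "based_le I r (prod_list [a,b,d])" "based_le I s (prod_list [a,b,d])"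
      using le_trans[OF r(2)] le_trans[OF s(2)] by (simp_all add: mult.assoc)
    then have "deg I r = deg I s" using relI[of r s "[a,b,d]"] deg_eq abd r s by auto
    then show ?thesis unfolding e
      using mult_deg[OF abd(1,2) p] mult_deg[OF abd(2,3) q] mult_deg[OF p(1) abd(3) r]
        mult_deg[OF abd(1) q(1) s] by simp
  qed
qed

end

section \<open>Group cocycles with trivial coefficients\<close>

text \<open>
  Cochains are functions of argument lists; \<open>group_coboundary n G F\<close> is the inhomogeneous
  coboundary of an \<open>n\<close>-cochain, written multiplicatively, evaluated at a list of length \<open>n + 1\<close>.
  Values on lists of another length or with entries outside the group are irrelevant.
\<close>

definition group_coboundary ::
    "nat \<Rightarrow> ('g, 'b) monoid_scheme \<Rightarrow> ('g list \<Rightarrow> 'k::field) \<Rightarrow> 'g list \<Rightarrow> 'k" where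
  "group_coboundary n G F gs =
     F (tl gs) *
     (\<Prod>j<n. F (take j gs @ (gs ! j \<otimes>\<^bsub>G\<^esub> gs ! Suc j) # drop (j + 2) gs) powi ((-1) ^ Suc j)) *
     F (butlast gs) powi ((-1) ^ Suc n)"

definition group_cocycle ::
    "nat \<Rightarrow> ('g, 'b) monoid_scheme \<Rightarrow> ('g list \<Rightarrow> 'k::field) \<Rightarrow> bool" where
  "group_cocycle n G F \<longleftrightarrow>
     (\<forall>gs. length gs = n \<and> set gs \<subseteq> carrier G \<longrightarrow> F gs \<noteq> 0) \<and>
     (\<forall>gs. length gs = Suc n \<and> set gs \<subseteq> carrier G \<longrightarrow> group_coboundary n G F gs = 1)"

lemma group_cocycle_2: "group_cocycle 2 G F \<longleftrightarrow>
   (\<forall>a\<in>carrier G. \<forall>b\<in>carrier G. F [a, b] \<noteq> 0) \<and>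
   (\<forall>a\<in>carrier G. \<forall>b\<in>carrier G. \<forall>c\<in>carrier G.
      F [b, c] * F [a, b \<otimes>\<^bsub>G\<^esub> c] / (F [a \<otimes>\<^bsub>G\<^esub> b, c] * F [a, b]) = 1)"
proof -
  have l2: "(\<forall>gs. length gs = 2 \<and> set gs \<subseteq> S \<longrightarrow> P gs) \<longleftrightarrow> (\<forall>a\<in>S. \<forall>b\<in>S. P [a,b])" for P and S :: "'a set"
    by (auto simp: numeral_2_eq_2 length_Suc_conv)
  have l3: "(\<forall>gs. length gs = Suc 2 \<and> set gs \<subseteq> S \<longrightarrow> P gs) \<longleftrightarrow> (\<forall>a\<in>S. \<forall>b\<in>S. \<forall>c\<in>S. P [a,b,c])" for P and S :: "'a set"
    by (auto simp: numeral_2_eq_2 length_Suc_conv)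
  show ?thesis unfolding group_cocycle_def l2 l3 group_coboundary_def
    by (simp add: numeral_2_eq_2 field_simps power_int_minus)
qed

lemma group_coboundary_4: "group_coboundary 4 G F [a,b,c,d,e] =
  F [b,c,d,e] * F [a, b \<otimes>\<^bsub>G\<^esub> c, d, e] * F [a,b,c,d \<otimes>\<^bsub>G\<^esub> e]
   / (F [a \<otimes>\<^bsub>G\<^esub> b, c, d, e] * F [a,b,c \<otimes>\<^bsub>G\<^esub> d, e] * F [a,b,c,d])"
  unfolding group_coboundary_def
  by (simp add: eval_nat_numeral field_simps power_int_minus)

lemma group_coboundary_3: "group_coboundary 3 G F [a,b,c,d] =
  F [b,c,d] * F [a, b \<otimes>\<^bsub>G\<^esub> c, d] * F [a,b,c]
   / (F [a \<otimes>\<^bsub>G\<^esub> b, c, d] * F [a,b,c \<otimes>\<^bsub>G\<^esub> d])"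
  unfolding group_coboundary_def
  by (simp add: eval_nat_numeral field_simps power_int_minus)

section \<open>Linear categories with a tensor product\<close>

text \<open>
  The type \<open>'o\<close> is the type of objects. All Hom spaces are subspaces of one vector space \<open>'m\<close>,
  so that composition, and the tensor product of morphisms, need no object indices. This is no
  loss of generality: any linear category has this form with \<open>'m\<close> the direct sum of all its
  Hom spaces. Nothing is assumed about operations outside the relevant Hom spaces.
\<close>

record ('k, 'o, 'm) tensor_data =
  smult :: "'k \<Rightarrow> 'm \<Rightarrow> 'm"
  Mor :: "'o \<Rightarrow> 'o \<Rightarrow> 'm set"
  idm :: "'o \<Rightarrow> 'm"
  cmp :: "'m \<Rightarrow> 'm \<Rightarrow> 'm" (infixr \<open>\<bullet>\<index>\<close> 65)
  tobj :: "'o \<Rightarrow> 'o \<Rightarrow> 'o" (infixl \<open>\<odot>\<index>\<close> 75)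
  tmor :: "'m \<Rightarrow> 'm \<Rightarrow> 'm" (infixl \<open>\<boxtimes>\<index>\<close> 75)
  tunit :: "'o"
  assoc :: "'o \<Rightarrow> 'o \<Rightarrow> 'o \<Rightarrow> 'm"
  lunit :: "'o \<Rightarrow> 'm"
  runit :: "'o \<Rightarrow> 'm"

locale linear_category =
  fixes C :: "('k::field, 'o, 'm::ab_group_add) tensor_data" (structure)
  assumes vector_space_smult: "vector_space (smult C)"
    and Mor_subspace: "module.subspace (smult C) (Mor C A B)"
    and idm_Mor: "idm C A \<in> Mor C A A"
    and cmp_Mor: "\<lbrakk>f \<in> Mor C A B; g \<in> Mor C B D\<rbrakk> \<Longrightarrow> g \<bullet> f \<in> Mor C A D"
    and idm_left: "f \<in> Mor C A B \<Longrightarrow> idm C B \<bullet> f = f"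
    and idm_right: "f \<in> Mor C A B \<Longrightarrow> f \<bullet> idm C A = f"
    and cmp_assoc: "\<lbrakk>f \<in> Mor C A B; g \<in> Mor C B D; h \<in> Mor C D E\<rbrakk> \<Longrightarrow> (h \<bullet> g) \<bullet> f = h \<bullet> (g \<bullet> f)"
    and cmp_add_right: "\<lbrakk>f \<in> Mor C A B; f' \<in> Mor C A B; g \<in> Mor C B D\<rbrakk>
          \<Longrightarrow> g \<bullet> (f + f') = (g \<bullet> f) + (g \<bullet> f')"
    and cmp_add_left: "\<lbrakk>f \<in> Mor C A B; g \<in> Mor C B D; g' \<in> Mor C B D\<rbrakk>
          \<Longrightarrow> (g + g') \<bullet> f = (g \<bullet> f) + (g' \<bullet> f)"
    and cmp_smult_right: "\<lbrakk>f \<in> Mor C A B; g \<in> Mor C B D\<rbrakk> \<Longrightarrow> g \<bullet> smult C c f = smult C c (g \<bullet> f)"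
    and cmp_smult_left: "\<lbrakk>f \<in> Mor C A B; g \<in> Mor C B D\<rbrakk> \<Longrightarrow> smult C c g \<bullet> f = smult C c (g \<bullet> f)"

context
  fixes C :: "('k::field, 'o, 'm::ab_group_add) tensor_data" (structure)
begin

definition is_iso :: "'o \<Rightarrow> 'o \<Rightarrow> 'm \<Rightarrow> bool" where
  "is_iso A B f \<longleftrightarrow> f \<in> Mor C A B \<and> (\<exists>g\<in>Mor C B A. g \<bullet> f = idm C A \<and> f \<bullet> g = idm C B)"

definition isomorphic :: "'o \<Rightarrow> 'o \<Rightarrow> bool" where
  "isomorphic A B \<longleftrightarrow> (\<exists>f. is_iso A B f)"

definition is_zero_object :: "'o \<Rightarrow> bool" where
  "is_zero_object Z \<longleftrightarrow> (\<forall>A. Mor C Z A = {0} \<and> Mor C A Z = {0})"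

text \<open>\<open>S\<close> is a direct sum (biproduct) of the objects in the list; for the empty list this says
  that \<open>S\<close> is a zero object.\<close>

definition is_direct_sum :: "'o \<Rightarrow> 'o list \<Rightarrow> bool" where
  "is_direct_sum S Bs \<longleftrightarrow> (\<exists>\<iota> \<pi>.
     (\<forall>p<length Bs. \<iota> p \<in> Mor C (Bs ! p) S \<and> \<pi> p \<in> Mor C S (Bs ! p)) \<and>
     (\<forall>p<length Bs. \<forall>q<length Bs. \<pi> p \<bullet> \<iota> q = (if p = q then idm C (Bs ! p) else 0)) \<and>
     (\<Sum>p<length Bs. \<iota> p \<bullet> \<pi> p) = idm C S)"

definition is_mono :: "'o \<Rightarrow> 'o \<Rightarrow> 'm \<Rightarrow> bool" where
  "is_mono A B f \<longleftrightarrow> f \<in> Mor C A B \<and>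
     (\<forall>T. \<forall>g\<in>Mor C T A. \<forall>h\<in>Mor C T A. f \<bullet> g = f \<bullet> h \<longrightarrow> g = h)"

definition is_epi :: "'o \<Rightarrow> 'o \<Rightarrow> 'm \<Rightarrow> bool" where
  "is_epi A B f \<longleftrightarrow> f \<in> Mor C A B \<and>
     (\<forall>T. \<forall>g\<in>Mor C B T. \<forall>h\<in>Mor C B T. g \<bullet> f = h \<bullet> f \<longrightarrow> g = h)"

definition is_kernel :: "'o \<Rightarrow> 'o \<Rightarrow> 'o \<Rightarrow> 'm \<Rightarrow> 'm \<Rightarrow> bool" where
  "is_kernel K A B \<kappa> f \<longleftrightarrow> \<kappa> \<in> Mor C K A \<and> f \<in> Mor C A B \<and> f \<bullet> \<kappa> = 0 \<and>
     (\<forall>T. \<forall>g\<in>Mor C T A. f \<bullet> g = 0 \<longrightarrow> (\<exists>!h. h \<in> Mor C T K \<and> \<kappa> \<bullet> h = g))"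

definition is_cokernel :: "'o \<Rightarrow> 'o \<Rightarrow> 'o \<Rightarrow> 'm \<Rightarrow> 'm \<Rightarrow> bool" where
  "is_cokernel A B Q f \<kappa> \<longleftrightarrow> f \<in> Mor C A B \<and> \<kappa> \<in> Mor C B Q \<and> \<kappa> \<bullet> f = 0 \<and>
     (\<forall>T. \<forall>g\<in>Mor C B T. g \<bullet> f = 0 \<longrightarrow> (\<exists>!h. h \<in> Mor C Q T \<and> h \<bullet> \<kappa> = g))"

definition is_simple :: "'o \<Rightarrow> bool" where
  "is_simple A \<longleftrightarrow> \<not> is_zero_object A \<and>
     (\<forall>S m. is_mono S A m \<longrightarrow> is_zero_object S \<or> is_iso S A m)"

end

locale abelian_category = linear_category +
  assumes direct_sums: "\<exists>S. is_direct_sum C S Bs"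
    and kernels: "f \<in> Mor C A B \<Longrightarrow> \<exists>K \<kappa>. is_kernel C K A B \<kappa> f"
    and cokernels: "f \<in> Mor C A B \<Longrightarrow> \<exists>Q \<kappa>. is_cokernel C A B Q f \<kappa>"
    and mono_normal: "is_mono C A B f \<Longrightarrow> \<exists>D g. is_kernel C A B D f g"
    and epi_normal: "is_epi C A B f \<Longrightarrow> \<exists>D g. is_cokernel C D A B g f"

locale semisimple_category = abelian_category +
  assumes semisimple: "\<exists>Bs. (\<forall>B\<in>set Bs. is_simple C B) \<and> is_direct_sum C A Bs"

text \<open>A bilinear tensor product functor with natural associativity and unit isomorphisms, not
  yet subject to any coherence condition.\<close>

locale tensor_product_category = linear_category +
  assumes tmor_Mor: "\<lbrakk>f \<in> Mor C A B; g \<in> Mor C D E\<rbrakk> \<Longrightarrow> f \<boxtimes> g \<in> Mor C (A \<odot> D) (B \<odot> E)"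
    and tmor_idm: "idm C A \<boxtimes> idm C B = idm C (A \<odot> B)"
    and tmor_cmp: "\<lbrakk>f \<in> Mor C A B; f' \<in> Mor C B B'; g \<in> Mor C D E; g' \<in> Mor C E E'\<rbrakk>
          \<Longrightarrow> (f' \<bullet> f) \<boxtimes> (g' \<bullet> g) = (f' \<boxtimes> g') \<bullet> (f \<boxtimes> g)"
    and tmor_add_left: "\<lbrakk>f \<in> Mor C A B; f' \<in> Mor C A B; g \<in> Mor C D E\<rbrakk>
          \<Longrightarrow> (f + f') \<boxtimes> g = (f \<boxtimes> g) + (f' \<boxtimes> g)"
    and tmor_add_right: "\<lbrakk>f \<in> Mor C A B; g \<in> Mor C D E; g' \<in> Mor C D E\<rbrakk>
          \<Longrightarrow> f \<boxtimes> (g + g') = (f \<boxtimes> g) + (f \<boxtimes> g')"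
    and tmor_smult_left: "\<lbrakk>f \<in> Mor C A B; g \<in> Mor C D E\<rbrakk> \<Longrightarrow> smult C c f \<boxtimes> g = smult C c (f \<boxtimes> g)"
    and tmor_smult_right: "\<lbrakk>f \<in> Mor C A B; g \<in> Mor C D E\<rbrakk> \<Longrightarrow> f \<boxtimes> smult C c g = smult C c (f \<boxtimes> g)"
    and assoc_iso: "is_iso C ((A \<odot> B) \<odot> D) (A \<odot> (B \<odot> D)) (assoc C A B D)"
    and assoc_natural: "\<lbrakk>f \<in> Mor C A A'; g \<in> Mor C B B'; h \<in> Mor C D D'\<rbrakk>
          \<Longrightarrow> assoc C A' B' D' \<bullet> ((f \<boxtimes> g) \<boxtimes> h) = (f \<boxtimes> (g \<boxtimes> h)) \<bullet> assoc C A B D"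
    and lunit_iso: "is_iso C (tunit C \<odot> A) A (lunit C A)"
    and lunit_natural: "f \<in> Mor C A B \<Longrightarrow> lunit C B \<bullet> (idm C (tunit C) \<boxtimes> f) = f \<bullet> lunit C A"
    and runit_iso: "is_iso C (A \<odot> tunit C) A (runit C A)"
    and runit_natural: "f \<in> Mor C A B \<Longrightarrow> runit C B \<bullet> (f \<boxtimes> idm C (tunit C)) = f \<bullet> runit C A"

text \<open>\<open>pentagon_at C a d A B D E\<close> is the pentagon for \<open>a\<close> in place of the associativity
  isomorphism, with the scalar \<open>d\<close> inserted; \<open>d = 1\<close> is the usual pentagon.\<close>

definition pentagon_at :: "('k::field, 'o, 'm::ab_group_add) tensor_data \<Rightarrow>
    ('o \<Rightarrow> 'o \<Rightarrow> 'o \<Rightarrow> 'm) \<Rightarrow> 'k \<Rightarrow> 'o \<Rightarrow> 'o \<Rightarrow> 'o \<Rightarrow> 'o \<Rightarrow> bool" where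
  "pentagon_at C a d A B D E \<longleftrightarrow>
     (idm C A \<boxtimes>\<^bsub>C\<^esub> a B D E) \<bullet>\<^bsub>C\<^esub> a A (B \<odot>\<^bsub>C\<^esub> D) E \<bullet>\<^bsub>C\<^esub> (a A B D \<boxtimes>\<^bsub>C\<^esub> idm C E)
       = smult C d (a A B (D \<odot>\<^bsub>C\<^esub> E) \<bullet>\<^bsub>C\<^esub> a (A \<odot>\<^bsub>C\<^esub> B) D E)"

text \<open>The composition \<open>A \<rightarrow> (A \<otimes> D) \<otimes> A \<rightarrow> A \<otimes> (D \<otimes> A) \<rightarrow> A\<close> equals the identity; composing with
  the left unit isomorphism of \<open>A\<close> avoids writing its inverse.\<close>

definition zigzag :: "('k::field, 'o, 'm::ab_group_add) tensor_data \<Rightarrow> 'o \<Rightarrow> 'o \<Rightarrow> 'm \<Rightarrow> 'm \<Rightarrow> bool" where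
  "zigzag C A D ev coev \<longleftrightarrow>
     ev \<in> Mor C (D \<odot>\<^bsub>C\<^esub> A) (tunit C) \<and> coev \<in> Mor C (tunit C) (A \<odot>\<^bsub>C\<^esub> D) \<and>
     runit C A \<bullet>\<^bsub>C\<^esub> (idm C A \<boxtimes>\<^bsub>C\<^esub> ev) \<bullet>\<^bsub>C\<^esub> assoc C A D A \<bullet>\<^bsub>C\<^esub> (coev \<boxtimes>\<^bsub>C\<^esub> idm C A) = lunit C A"

text \<open>\<open>D\<close> is a left dual of \<open>A\<close> (equivalently, \<open>A\<close> is a right dual of \<open>D\<close>). The last clause is
  the second zigzag, \<open>D \<rightarrow> D \<otimes> (A \<otimes> D) \<rightarrow> (D \<otimes> A) \<otimes> D \<rightarrow> D\<close>, with \<open>b\<close> the inverse associator.\<close>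

definition is_left_dual :: "('k::field, 'o, 'm::ab_group_add) tensor_data \<Rightarrow> 'o \<Rightarrow> 'o \<Rightarrow> bool" where
  "is_left_dual C A D \<longleftrightarrow> (\<exists>ev coev. zigzag C A D ev coev \<and>
     (\<exists>b\<in>Mor C (D \<odot>\<^bsub>C\<^esub> (A \<odot>\<^bsub>C\<^esub> D)) ((D \<odot>\<^bsub>C\<^esub> A) \<odot>\<^bsub>C\<^esub> D).
        b \<bullet>\<^bsub>C\<^esub> assoc C D A D = idm C ((D \<odot>\<^bsub>C\<^esub> A) \<odot>\<^bsub>C\<^esub> D) \<and>
        assoc C D A D \<bullet>\<^bsub>C\<^esub> b = idm C (D \<odot>\<^bsub>C\<^esub> (A \<odot>\<^bsub>C\<^esub> D)) \<and>
        lunit C D \<bullet>\<^bsub>C\<^esub> (ev \<boxtimes>\<^bsub>C\<^esub> idm C D) \<bullet>\<^bsub>C\<^esub> b \<bullet>\<^bsub>C\<^esub> (idm C D \<boxtimes>\<^bsub>C\<^esub> coev) = runit C D))"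

locale semisimple_tensor_category = semisimple_category + tensor_product_category +
  assumes Mor_finite_dim: "\<exists>S. finite S \<and> Mor C A B = module.span (smult C) S"
    and pentagon: "pentagon_at C (assoc C) 1 A B D E"
    and triangle: "(idm C A \<boxtimes> lunit C B) \<bullet> assoc C A (tunit C) B = runit C A \<boxtimes> idm C B"
    and left_duals: "\<exists>D. is_left_dual C A D"
    and right_duals: "\<exists>D. is_left_dual C D A"
    and End_unit: "Mor C (tunit C) (tunit C) = range (\<lambda>c. smult C c (idm C (tunit C)))"
    and unit_nonzero: "idm C (tunit C) \<noteq> 0"

section \<open>Categorifications and categorical cocycles\<close>

text \<open>The classes of the objects \<open>X i\<close>, \<open>i \<in> I\<close>, form the basis of classes of simple objects of
  the Grothendieck ring and multiply as the basis \<open>I\<close> does. As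
  \<open>j = dual i\<close> is characterised by \<open>N\<^sub>i\<^sub>j\<^sup>1 = 1\<close>, compatibility with duality need not be stated.\<close>

definition has_grothendieck_ring :: "'r::ring_1 set \<Rightarrow>
    ('k::field, 'o, 'm::ab_group_add) tensor_data \<Rightarrow> ('r \<Rightarrow> 'o) \<Rightarrow> bool" where
  "has_grothendieck_ring I C X \<longleftrightarrow>
     (\<forall>i\<in>I. is_simple C (X i)) \<and>
     (\<forall>i\<in>I. \<forall>j\<in>I. isomorphic C (X i) (X j) \<longrightarrow> i = j) \<and>
     (\<forall>A. is_simple C A \<longrightarrow> (\<exists>i\<in>I. isomorphic C A (X i))) \<and>
     isomorphic C (tunit C) (X 1) \<and>
     (\<forall>i\<in>I. \<forall>j\<in>I. \<exists>ks. set ks \<subseteq> I \<and> (\<forall>k\<in>I. int (count_list ks k) = coeff_in I (i * j) k) \<and>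
        is_direct_sum C (X i \<odot>\<^bsub>C\<^esub> X j) (map X ks))"

definition categorification :: "'r::ring_1 set \<Rightarrow>
    ('k::field, 'o, 'm::ab_group_add) tensor_data \<Rightarrow> ('r \<Rightarrow> 'o) \<Rightarrow> bool" where
  "categorification I C X \<longleftrightarrow> semisimple_tensor_category C \<and> has_grothendieck_ring I C X"

text \<open>The additive extension of a family of morphisms given on the \<open>X i\<close> is the (unique) natural
  transformation \<open>J\<close>, resp. \<open>a\<close>, with the prescribed components. A tensor structure is, as
  usual, a natural isomorphism compatible with associativity; no normalisation at the unit
  object is required.\<close>

definition categorical_2_cocycle :: "'r::ring_1 set \<Rightarrow>
    ('k::field, 'o, 'm::ab_group_add) tensor_data \<Rightarrow> ('r \<Rightarrow> 'o) \<Rightarrow> ('r \<Rightarrow> 'r \<Rightarrow> 'k) \<Rightarrow> bool" where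
  "categorical_2_cocycle I C X f \<longleftrightarrow>
     (\<forall>i\<in>I. \<forall>j\<in>I. f i j \<noteq> 0) \<and>
     (\<exists>J. (\<forall>i\<in>I. \<forall>j\<in>I. J (X i) (X j) = smult C (f i j) (idm C (X i \<odot>\<^bsub>C\<^esub> X j))) \<and>
        (\<forall>A B. is_iso C (A \<odot>\<^bsub>C\<^esub> B) (A \<odot>\<^bsub>C\<^esub> B) (J A B)) \<and>
        (\<forall>A A' B B'. \<forall>g\<in>Mor C A A'. \<forall>h\<in>Mor C B B'.
           J A' B' \<bullet>\<^bsub>C\<^esub> (g \<boxtimes>\<^bsub>C\<^esub> h) = (g \<boxtimes>\<^bsub>C\<^esub> h) \<bullet>\<^bsub>C\<^esub> J A B) \<and>
        (\<forall>A B D. assoc C A B D \<bullet>\<^bsub>C\<^esub> J (A \<odot>\<^bsub>C\<^esub> B) D \<bullet>\<^bsub>C\<^esub> (J A B \<boxtimes>\<^bsub>C\<^esub> idm C D)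
           = J A (B \<odot>\<^bsub>C\<^esub> D) \<bullet>\<^bsub>C\<^esub> (idm C A \<boxtimes>\<^bsub>C\<^esub> J B D) \<bullet>\<^bsub>C\<^esub> assoc C A B D))"

definition categorical_3_cocycle :: "'r::ring_1 set \<Rightarrow>
    ('k::field, 'o, 'm::ab_group_add) tensor_data \<Rightarrow> ('r \<Rightarrow> 'o) \<Rightarrow> ('r \<Rightarrow> 'r \<Rightarrow> 'r \<Rightarrow> 'k) \<Rightarrow> bool" where
  "categorical_3_cocycle I C X f \<longleftrightarrow>
     (\<forall>i\<in>I. \<forall>j\<in>I. \<forall>k\<in>I. f i j k \<noteq> 0) \<and>
     (\<exists>a. (\<forall>i\<in>I. \<forall>j\<in>I. \<forall>k\<in>I. a (X i) (X j) (X k) = smult C (f i j k) (assoc C (X i) (X j) (X k))) \<and>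
        (\<forall>A B D. is_iso C ((A \<odot>\<^bsub>C\<^esub> B) \<odot>\<^bsub>C\<^esub> D) (A \<odot>\<^bsub>C\<^esub> (B \<odot>\<^bsub>C\<^esub> D)) (a A B D)) \<and>
        (\<forall>A A' B B' D D'. \<forall>g\<in>Mor C A A'. \<forall>h\<in>Mor C B B'. \<forall>e\<in>Mor C D D'.
           a A' B' D' \<bullet>\<^bsub>C\<^esub> ((g \<boxtimes>\<^bsub>C\<^esub> h) \<boxtimes>\<^bsub>C\<^esub> e) = (g \<boxtimes>\<^bsub>C\<^esub> (h \<boxtimes>\<^bsub>C\<^esub> e)) \<bullet>\<^bsub>C\<^esub> a A B D) \<and>
        (\<forall>A B D E. pentagon_at C a 1 A B D E))"

text \<open>Here the unit object is \<open>X 1\<close> itself, the pentagon holds up to \<open>\<delta>\<close>, only on simple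
  objects, and no triangle identity is imposed.\<close>

definition projective_categorification :: "'r::ring_1 set \<Rightarrow> ('r \<Rightarrow> 'r) \<Rightarrow>
    ('k::field, 'o, 'm::ab_group_add) tensor_data \<Rightarrow> ('r \<Rightarrow> 'o) \<Rightarrow>
    ('r \<Rightarrow> 'r \<Rightarrow> 'r \<Rightarrow> 'r \<Rightarrow> 'k) \<Rightarrow> bool" where
  "projective_categorification I dual C X \<delta> \<longleftrightarrow>
     semisimple_category C \<and> tensor_product_category C \<and>
     has_grothendieck_ring I C X \<and> tunit C = X 1 \<and>
     (\<forall>i\<in>I. \<forall>j\<in>I. \<forall>k\<in>I. \<forall>l\<in>I. \<delta> i j k l \<noteq> 0 \<and>
        pentagon_at C (assoc C) (\<delta> i j k l) (X i) (X j) (X k) (X l)) \<and>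
     (\<forall>i\<in>I. \<exists>ev coev. zigzag C (X i) (X (dual i)) ev coev)"

text \<open>Quantification over all categories is quantification over the types \<open>'o\<close> of objects and
  \<open>'m\<close> of morphisms (not possible inside a formula) and over the structures on them.\<close>

definition categorical_4_cocycle :: "'o itself \<Rightarrow> 'm::ab_group_add itself \<Rightarrow>
    'r::ring_1 set \<Rightarrow> ('r \<Rightarrow> 'r) \<Rightarrow> ('r \<Rightarrow> 'r \<Rightarrow> 'r \<Rightarrow> 'r \<Rightarrow> 'k::field) \<Rightarrow> bool" where
  "categorical_4_cocycle _ _ I dual \<delta> \<longleftrightarrow>
     (\<exists>(C :: ('k, 'o, 'm) tensor_data) X. projective_categorification I dual C X \<delta>)"

end

(*
A 4-cocycle (similarly for 2- and 3-cocycles) is compared with the associativity constraint on the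
fivefold product i(j(k(lm))): the pentagons involving X_i X_j as one factor hold up to the operator
P on X_i X_j acting on the summand X_z by the scalar \<delta>(z,k,l,m), and likewise for the
operators Q on X_j X_k, R on X_k X_l and S on X_l X_m. The associahedron gives an identity
Q S = const P R on the fivefold product. As Q, R, S do not involve i, some 1 \<otimes> T agrees with
P \<otimes> 1. Tensoring with a dual object and restricting to the unit object (a summand of
X_k X_{k*}) turns this into P \<otimes> 1 = 1 \<otimes> T with T an endomorphism of X_j, so P is a scalar by Schur's
lemma: T minus an eigenvalue of P is not invertible, hence zero. Cancelling X_i and repeating, Q, R
and S are scalars too. So \<delta> satisfies the cocycle identity for all choices of summands of the
products of neighbouring arguments, and such a function depends on degrees only, by induction on
the position of the argument and on the length of a word u_1 ... u_n witnessing equality of degrees.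
*)
theory Submission
  imports Defs
begin

section \<open>Arrows with source and target\<close>

text \<open>The obstacle is that \<open>P\<close> and \<open>Q\<close> are diagonal for different
  bracketings of a triple product. A summand \<open>z\<close> of \<open>i * j\<close> and a summand
  \<open>w\<close> of \<open>j * k\<close> need not share an eigenvector, so the operator identity
  cannot be read off entry by entry for independent \<open>z\<close> and \<open>w\<close>. Once each
  operator is known to be a scalar, its eigenvalue no longer depends on the summand and the choices
  decouple. The eigenvalue that Schur's lemma requires is at hand: \<open>P\<close> is built
  diagonal, with eigenvalue \<open>p z\<close> on every copy of \<open>X z\<close>. The ambient
  pentagon is known only on simple objects and only up to a scalar. The scalar is harmless when an
  operator is carried along both sides of one pentagon, because it then occurs on both sides of the
  resulting equation. The restriction to simple objects is why a long product is cut down to a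
  simple retract before a dual object is appended.\<close>

datatype ('o, 'm) arrow = Arrow (src: 'o) (mor: 'm) (tgt: 'o)

lemma arrow_eq_iff: "f = g \<longleftrightarrow> src f = src g \<and> mor f = mor g \<and> tgt f = tgt g"
  by (cases f; cases g) auto

context linear_category
begin

sublocale hom: vector_space "smult C"
  by (rule vector_space_smult)

text \<open>All Hom spaces share one type, so a bare morphism does not determine its endpoints.
  Carrying them in the arrow turns typing conditions into equations between \<open>src\<close> and
  \<open>tgt\<close>, which the simplifier settles by computation.\<close>

definition arr :: "('o, 'm) arrow \<Rightarrow> bool" where
  "arr f \<longleftrightarrow> mor f \<in> Mor C (src f) (tgt f)"

definition comp :: "('o, 'm) arrow \<Rightarrow> ('o, 'm) arrow \<Rightarrow> ('o, 'm) arrow" (infixr \<open>\<cdot>\<close> 65) where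
  "g \<cdot> f = Arrow (src f) (mor g \<bullet> mor f) (tgt g)"

definition Id :: "'o \<Rightarrow> ('o, 'm) arrow" where
  "Id A = Arrow A (idm C A) A"

definition scal :: "'k \<Rightarrow> ('o, 'm) arrow \<Rightarrow> ('o, 'm) arrow" where
  "scal c f = Arrow (src f) (smult C c (mor f)) (tgt f)"

lemma src_tgt_simps [simp]:
  "src (g \<cdot> f) = src f" "tgt (g \<cdot> f) = tgt g" "src (Id A) = A" "tgt (Id A) = A"
  "src (scal c f) = src f" "tgt (scal c f) = tgt f"
  by (simp_all add: comp_def Id_def scal_def)

lemma mor_simps [simp]:
  "mor (g \<cdot> f) = mor g \<bullet> mor f" "mor (Id A) = idm C A" "mor (scal c f) = smult C c (mor f)"
  by (simp_all add: comp_def Id_def scal_def)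

lemma arr_comp [simp]: "arr f \<Longrightarrow> arr g \<Longrightarrow> tgt f = src g \<Longrightarrow> arr (g \<cdot> f)"
  by (auto simp: arr_def intro: cmp_Mor)

lemma arr_Id [simp]: "arr (Id A)"
  by (simp add: arr_def idm_Mor)

lemma arr_scal [simp]: "arr f \<Longrightarrow> arr (scal c f)"
  by (simp add: arr_def hom.subspace_scale[OF Mor_subspace])

lemma comp_assoc [simp]:
  "arr f \<Longrightarrow> arr g \<Longrightarrow> arr h \<Longrightarrow> tgt f = src g \<Longrightarrow> tgt g = src h \<Longrightarrow> (h \<cdot> g) \<cdot> f = h \<cdot> (g \<cdot> f)"
  by (auto simp: arr_def arrow_eq_iff intro: cmp_assoc)

lemma comp_Id [simp]:
  "arr f \<Longrightarrow> tgt f = A \<Longrightarrow> Id A \<cdot> f = f" "arr f \<Longrightarrow> src f = A \<Longrightarrow> f \<cdot> Id A = f"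
  by (auto simp: arr_def arrow_eq_iff intro: idm_left idm_right)

lemma comp_scal [simp]:
  "arr f \<Longrightarrow> arr g \<Longrightarrow> tgt f = src g \<Longrightarrow> scal c g \<cdot> f = scal c (g \<cdot> f)"
  "arr f \<Longrightarrow> arr g \<Longrightarrow> tgt f = src g \<Longrightarrow> g \<cdot> scal c f = scal c (g \<cdot> f)"
  by (auto simp: arr_def arrow_eq_iff intro: cmp_smult_left cmp_smult_right)

lemma scal_scal [simp]: "scal c (scal d f) = scal (c * d) f"
  and scal_1 [simp]: "scal 1 f = f"
  by (auto simp: arrow_eq_iff)

lemma scal_eq_iff: "c \<noteq> 0 \<Longrightarrow> scal c f = scal d g \<longleftrightarrow> f = scal (d / c) g"
  by (metis scal_scal scal_1 nonzero_eq_divide_eq divide_self_if times_divide_eq_left mult.commute)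

lemma Mor_0: "0 \<in> Mor C A B"
  using hom.subspace_0[OF Mor_subspace] .

lemma Mor_diff: "f \<in> Mor C A B \<Longrightarrow> g \<in> Mor C A B \<Longrightarrow> f - g \<in> Mor C A B"
  using hom.subspace_diff[OF Mor_subspace] .

lemma Mor_smult: "f \<in> Mor C A B \<Longrightarrow> smult C c f \<in> Mor C A B"
  using hom.subspace_scale[OF Mor_subspace] .

lemma Mor_sum: "(\<And>p. p \<in> S \<Longrightarrow> f p \<in> Mor C A B) \<Longrightarrow> (\<Sum>p\<in>S. f p) \<in> Mor C A B"
  using hom.subspace_sum[OF Mor_subspace] .

lemma cmp_zero: "f \<in> Mor C A B \<Longrightarrow> f \<bullet> 0 = 0" "f \<in> Mor C A B \<Longrightarrow> 0 \<bullet> f = 0"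
  using cmp_smult_right[of 0 A A f B 0] cmp_smult_left[of f A B 0 B 0] Mor_0 by auto

lemma cmp_diff:
  "f \<in> Mor C A B \<Longrightarrow> f' \<in> Mor C A B \<Longrightarrow> g \<in> Mor C B D \<Longrightarrow> g \<bullet> (f - f') = (g \<bullet> f) - (g \<bullet> f')"
  "f \<in> Mor C A B \<Longrightarrow> g \<in> Mor C B D \<Longrightarrow> g' \<in> Mor C B D \<Longrightarrow> (g - g') \<bullet> f = (g \<bullet> f) - (g' \<bullet> f)"
  using cmp_add_right[of "f - f'" A B f' g D] cmp_add_left[of f A B "g - g'" D g']
  by (auto simp: Mor_diff)

lemma cmp_sum:
  assumes "finite S" "\<And>p. p \<in> S \<Longrightarrow> f p \<in> Mor C A B"
  shows "g \<in> Mor C B D \<Longrightarrow> g \<bullet> (\<Sum>p\<in>S. f p) = (\<Sum>p\<in>S. g \<bullet> f p)"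
    and "h \<in> Mor C D A \<Longrightarrow> (\<Sum>p\<in>S. f p) \<bullet> h = (\<Sum>p\<in>S. f p \<bullet> h)"
proof -
  show "g \<bullet> (\<Sum>p\<in>S. f p) = (\<Sum>p\<in>S. g \<bullet> f p)" if g: "g \<in> Mor C B D"
    using assms
  proof (induction rule: finite_induct)
    case (insert x F)
    then show ?case
      using g cmp_add_right[of "f x" A B "\<Sum>p\<in>F. f p" g D] Mor_sum[of F f A B] by simp
  qed (simp add: cmp_zero[OF g])
  show "(\<Sum>p\<in>S. f p) \<bullet> h = (\<Sum>p\<in>S. f p \<bullet> h)" if h: "h \<in> Mor C D A"
    using assms
  proof (induction rule: finite_induct)
    case (insert x F)
    then show ?case
      using h cmp_add_left[of h D A "f x" B "\<Sum>p\<in>F. f p"] Mor_sum[of F f A B] by simp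
  qed (simp add: cmp_zero[OF h])
qed

text \<open>Such a family is jointly epic, and stays so after tensoring with objects.\<close>

definition covers :: "nat \<Rightarrow> (nat \<Rightarrow> ('o, 'm) arrow) \<Rightarrow> 'o \<Rightarrow> bool" where
  "covers n g S \<longleftrightarrow> (\<exists>r. (\<forall>p<n. arr (g p) \<and> tgt (g p) = S \<and> arr (r p) \<and> src (r p) = S \<and> tgt (r p) = src (g p))
     \<and> (\<Sum>p<n. mor (g p \<cdot> r p)) = idm C S)"

text \<open>Inserting the resolution of the identity writes \<open>u\<close> as the sum of the
  \<open>(u \<cdot> g p) \<cdot> r p\<close>, so the composites \<open>u \<cdot> g p\<close>
  determine it.\<close>

lemma covers_ext:
  assumes cov: "covers n g S" and u: "arr u" "src u = S" and v: "arr v" "src v = S" "tgt v = tgt u"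
    and eq: "\<And>p. p < n \<Longrightarrow> u \<cdot> g p = v \<cdot> g p"
  shows "u = v"
proof -
  obtain r where r: "\<And>p. p < n \<Longrightarrow> arr (g p) \<and> tgt (g p) = S \<and> arr (r p) \<and> src (r p) = S \<and> tgt (r p) = src (g p)"
    and sum: "(\<Sum>p<n. mor (g p \<cdot> r p)) = idm C S"
    using cov by (auto simp: covers_def)
  have expand: "mor w = (\<Sum>p<n. mor ((w \<cdot> g p) \<cdot> r p))" if w: "arr w" "src w = S" for w
  proof -
    have "mor w = mor w \<bullet> (\<Sum>p<n. mor (g p \<cdot> r p))"
      unfolding sum using idm_right[of "mor w" S "tgt w"] w by (simp add: arr_def)
    also have "\<dots> = (\<Sum>p<n. mor w \<bullet> mor (g p \<cdot> r p))"
    proof (rule cmp_sum)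
      show "mor (g p \<cdot> r p) \<in> Mor C S S" if "p \<in> {..<n}" for p
        using r[of p] that by (auto simp: arr_def intro: cmp_Mor)
    qed (use w in \<open>auto simp: arr_def\<close>)
    also have "\<dots> = (\<Sum>p<n. mor ((w \<cdot> g p) \<cdot> r p))"
      using r w by (intro sum.cong refl) (metis comp_assoc lessThan_iff mor_simps(1))
    finally show ?thesis .
  qed
  have "mor u = mor v" unfolding expand[OF u] expand[OF v(1,2)]
    by (intro sum.cong refl) (simp only: eq lessThan_iff)
  then show ?thesis using u v by (simp add: arrow_eq_iff)
qed

definition iso :: "('o, 'm) arrow \<Rightarrow> bool" where
  "iso f \<longleftrightarrow> arr f \<and> (\<exists>g. arr g \<and> src g = tgt f \<and> tgt g = src f \<and> g \<cdot> f = Id (src f) \<and> f \<cdot> g = Id (tgt f))"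

lemma iso_arr: "iso f \<Longrightarrow> arr f"
  by (simp add: iso_def)

lemma iso_iff: "iso f \<longleftrightarrow> is_iso C (src f) (tgt f) (mor f)"
proof
  assume "iso f"
  then obtain g where "arr f" "arr g" "src g = tgt f" "tgt g = src f" "g \<cdot> f = Id (src f)" "f \<cdot> g = Id (tgt f)"
    by (auto simp: iso_def)
  then show "is_iso C (src f) (tgt f) (mor f)"
    by (auto simp: is_iso_def arr_def comp_def Id_def intro!: bexI[of _ "mor g"])
next
  assume "is_iso C (src f) (tgt f) (mor f)"
  then obtain g where "mor f \<in> Mor C (src f) (tgt f)" "g \<in> Mor C (tgt f) (src f)"
     "g \<bullet> mor f = idm C (src f)" "mor f \<bullet> g = idm C (tgt f)"
    by (auto simp: is_iso_def)
  then show "iso f" unfolding iso_def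
    by (auto intro!: exI[of _ "Arrow (tgt f) g (src f)"] simp: arr_def comp_def Id_def)
qed

lemma iso_epi:
  assumes "iso f" "arr u" "arr v" "src u = tgt f" "src v = tgt f" "u \<cdot> f = v \<cdot> f"
  shows "u = v"
proof -
  obtain g where g: "arr g" "src g = tgt f" "tgt g = src f" "f \<cdot> g = Id (tgt f)"
    using assms(1) by (auto simp: iso_def)
  have "w = (w \<cdot> f) \<cdot> g" if "arr w" "src w = tgt f" for w
    using g that iso_arr[OF assms(1)] by simp
  then show ?thesis using assms by metis
qed

lemma iso_mono:
  assumes "iso f" "arr u" "arr v" "tgt u = src f" "tgt v = src f" "f \<cdot> u = f \<cdot> v"
  shows "u = v"
proof -
  obtain g where g: "arr g" "src g = tgt f" "tgt g = src f" "g \<cdot> f = Id (src f)"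
    using assms(1) by (auto simp: iso_def)
  have "w = g \<cdot> (f \<cdot> w)" if "arr w" "tgt w = src f" for w
    using g that iso_arr[OF assms(1)] comp_assoc[of w f g] by simp
  then show ?thesis using assms by metis
qed

definition retract :: "'o \<Rightarrow> 'o \<Rightarrow> bool" where
  "retract A B \<longleftrightarrow> (\<exists>s r. arr s \<and> arr r \<and> src s = A \<and> tgt s = B \<and> src r = B \<and> tgt r = A \<and> r \<cdot> s = Id A)"

lemma retract_refl: "retract A A"
  unfolding retract_def by (rule exI[of _ "Id A"], rule exI[of _ "Id A"]) simp

lemma retract_trans:
  assumes "retract A B" "retract B D"
  shows "retract A D"
proof -
  obtain s r where 1: "arr s" "arr r" "src s = A" "tgt s = B" "src r = B" "tgt r = A" "r \<cdot> s = Id A"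
    using assms(1) by (auto simp: retract_def)
  obtain s' r' where 2: "arr s'" "arr r'" "src s' = B" "tgt s' = D" "src r' = D" "tgt r' = B" "r' \<cdot> s' = Id B"
    using assms(2) by (auto simp: retract_def)
  have "(r \<cdot> r') \<cdot> (s' \<cdot> s) = r \<cdot> (r' \<cdot> s') \<cdot> s" using 1 2(1-6) by simp
  then have "(r \<cdot> r') \<cdot> (s' \<cdot> s) = Id A" using 1 2(7) by simp
  then show ?thesis unfolding retract_def
    using 1 2 by (intro exI[of _ "s' \<cdot> s"] exI[of _ "r \<cdot> r'"]) simp
qed

lemma isomorphic_retract: "isomorphic C A B \<Longrightarrow> retract A B"
  unfolding isomorphic_def is_iso_def retract_def
proof (elim exE conjE bexE)
  fix f g assume "f \<in> Mor C A B" "g \<in> Mor C B A" "g \<bullet> f = idm C A"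
  then show "\<exists>s r. arr s \<and> arr r \<and> src s = A \<and> tgt s = B \<and> src r = B \<and> tgt r = A \<and> r \<cdot> s = Id A"
    by (intro exI[of _ "Arrow A f B"] exI[of _ "Arrow B g A"]) (simp add: arr_def comp_def Id_def)
qed

end

section \<open>Tensor products of arrows, associators, pentagon sides and unit isomorphisms\<close>

context tensor_product_category
begin

definition tens :: "('b, 'c) arrow \<Rightarrow> ('b, 'c) arrow \<Rightarrow> ('b, 'c) arrow" (infixl \<open>\<star>\<close> 75) where
  "f \<star> g = Arrow (src f \<odot> src g) (mor f \<boxtimes> mor g) (tgt f \<odot> tgt g)"

definition ass :: "'b \<Rightarrow> 'b \<Rightarrow> 'b \<Rightarrow> ('b, 'c) arrow" where
  "ass A B D = Arrow ((A \<odot> B) \<odot> D) (assoc C A B D) (A \<odot> (B \<odot> D))"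

lemma src_tgt_tens [simp]:
  "src (f \<star> g) = src f \<odot> src g" "tgt (f \<star> g) = tgt f \<odot> tgt g"
  "src (ass A B D) = (A \<odot> B) \<odot> D" "tgt (ass A B D) = A \<odot> (B \<odot> D)"
  by (simp_all add: tens_def ass_def)

lemma mor_tens [simp]: "mor (f \<star> g) = mor f \<boxtimes> mor g" "mor (ass A B D) = assoc C A B D"
  by (simp_all add: tens_def ass_def)

lemma arr_tens [simp]: "arr f \<Longrightarrow> arr g \<Longrightarrow> arr (f \<star> g)"
  by (auto simp: arr_def intro: tmor_Mor)

lemma iso_ass: "iso (ass A B D)"
  by (simp add: iso_iff assoc_iso)

lemma arr_ass [simp]: "arr (ass A B D)"
  by (rule iso_arr[OF iso_ass])

lemma tens_comp:
  "arr f \<Longrightarrow> arr g \<Longrightarrow> arr f' \<Longrightarrow> arr g' \<Longrightarrow> tgt f = src f' \<Longrightarrow> tgt g = src g'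
    \<Longrightarrow> (f' \<cdot> f) \<star> (g' \<cdot> g) = (f' \<star> g') \<cdot> (f \<star> g)"
  by (auto simp: arr_def arrow_eq_iff intro: tmor_cmp)

lemma tens_Id [simp]: "Id A \<star> Id B = Id (A \<odot> B)"
  by (simp add: arrow_eq_iff tmor_idm)

lemma whisker_comp:
  "arr f \<Longrightarrow> arr g \<Longrightarrow> tgt f = src g \<Longrightarrow> Id A \<star> (g \<cdot> f) = (Id A \<star> g) \<cdot> (Id A \<star> f)"
  "arr f \<Longrightarrow> arr g \<Longrightarrow> tgt f = src g \<Longrightarrow> (g \<cdot> f) \<star> Id A = (g \<star> Id A) \<cdot> (f \<star> Id A)"
  using tens_comp[of "Id A" f "Id A" g] tens_comp[of f "Id A" g "Id A"] by simp_all

lemma whisker_exchange: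
  assumes "arr f" "arr g" "src f = A" "tgt f = B" "src g = D" "tgt g = E"
  shows "(f \<star> Id E) \<cdot> (Id A \<star> g) = (Id B \<star> g) \<cdot> (f \<star> Id D)"
  using tens_comp[of "Id A" g f "Id E"] tens_comp[of f "Id D" "Id B" g] assms by simp

lemma tens_scal [simp]:
  "arr f \<Longrightarrow> arr g \<Longrightarrow> scal c f \<star> g = scal c (f \<star> g)"
  "arr f \<Longrightarrow> arr g \<Longrightarrow> f \<star> scal c g = scal c (f \<star> g)"
  by (auto simp: arr_def arrow_eq_iff intro: tmor_smult_left tmor_smult_right)

lemma ass_natural:
  "arr f \<Longrightarrow> arr g \<Longrightarrow> arr h \<Longrightarrow> src f = A \<Longrightarrow> tgt f = A' \<Longrightarrow> src g = B \<Longrightarrow> tgt g = B'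
    \<Longrightarrow> src h = D \<Longrightarrow> tgt h = D' \<Longrightarrow> ass A' B' D' \<cdot> ((f \<star> g) \<star> h) = (f \<star> (g \<star> h)) \<cdot> ass A B D"
  by (auto simp: arr_def arrow_eq_iff intro: assoc_natural)

lemma tmor_sum:
  assumes "finite S" "\<And>p. p \<in> S \<Longrightarrow> f p \<in> Mor C A B"
  shows "g \<in> Mor C D E \<Longrightarrow> g \<boxtimes> (\<Sum>p\<in>S. f p) = (\<Sum>p\<in>S. g \<boxtimes> f p)"
    and "g \<in> Mor C D E \<Longrightarrow> (\<Sum>p\<in>S. f p) \<boxtimes> g = (\<Sum>p\<in>S. f p \<boxtimes> g)"
proof -
  show "g \<boxtimes> (\<Sum>p\<in>S. f p) = (\<Sum>p\<in>S. g \<boxtimes> f p)" if g: "g \<in> Mor C D E"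
    using assms
  proof (induction rule: finite_induct)
    case (insert x F)
    then show ?case
      using g tmor_add_right[of g D E "f x" A B "\<Sum>p\<in>F. f p"] Mor_sum[of F f A B] by simp
  qed (use tmor_smult_right[of g D E 0 A B 0] g Mor_0 in simp)
  show "(\<Sum>p\<in>S. f p) \<boxtimes> g = (\<Sum>p\<in>S. f p \<boxtimes> g)" if g: "g \<in> Mor C D E"
    using assms
  proof (induction rule: finite_induct)
    case (insert x F)
    then show ?case
      using g tmor_add_left[of "f x" A B "\<Sum>p\<in>F. f p" g D E] Mor_sum[of F f A B] by simp
  qed (use tmor_smult_left[of 0 A B g D E 0] g Mor_0 in simp)
qed

text \<open>Bilinearity carries the resolution of the identity of \<open>S\<close> through the
  tensor product with an identity.\<close>

lemma covers_tens:
  assumes "covers n g S"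
  shows "covers n (\<lambda>p. g p \<star> Id A) (S \<odot> A)" and "covers n (\<lambda>p. Id A \<star> g p) (A \<odot> S)"
proof -
  obtain r where r: "\<And>p. p < n \<Longrightarrow> arr (g p) \<and> tgt (g p) = S \<and> arr (r p) \<and> src (r p) = S \<and> tgt (r p) = src (g p)"
    and sum: "(\<Sum>p<n. mor (g p \<cdot> r p)) = idm C S"
    using assms by (auto simp: covers_def)
  have M: "mor (g p \<cdot> r p) \<in> Mor C S S" if "p \<in> {..<n}" for p
    using r[of p] that by (auto simp: arr_def intro: cmp_Mor)
  have "(\<Sum>p<n. mor ((g p \<star> Id A) \<cdot> (r p \<star> Id A))) = (\<Sum>p<n. mor ((g p \<cdot> r p) \<star> Id A))"
    using r by (intro sum.cong refl) (simp add: whisker_comp(2)[symmetric] del: mor_simps mor_tens)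
  also have "\<dots> = idm C S \<boxtimes> idm C A"
    unfolding sum[symmetric] using tmor_sum(2)[OF finite_lessThan M idm_Mor, of n "\<lambda>p. p"] by simp
  finally show "covers n (\<lambda>p. g p \<star> Id A) (S \<odot> A)"
    unfolding covers_def using r by (intro exI[of _ "\<lambda>p. r p \<star> Id A"]) (auto simp: tmor_idm)
  have "(\<Sum>p<n. mor ((Id A \<star> g p) \<cdot> (Id A \<star> r p))) = (\<Sum>p<n. mor (Id A \<star> (g p \<cdot> r p)))"
    using r by (intro sum.cong refl) (simp add: whisker_comp(1)[symmetric] del: mor_simps mor_tens)
  also have "\<dots> = idm C A \<boxtimes> idm C S"
    unfolding sum[symmetric] using tmor_sum(1)[OF finite_lessThan M idm_Mor, of n "\<lambda>p. p"] by simp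
  finally show "covers n (\<lambda>p. Id A \<star> g p) (A \<odot> S)"
    unfolding covers_def using r by (intro exI[of _ "\<lambda>p. Id A \<star> r p"]) (auto simp: tmor_idm)
qed

lemma retract_tens:
  assumes "retract A B"
  shows "retract (D \<odot> A) (D \<odot> B)"
proof -
  obtain s r where 1: "arr s" "arr r" "src s = A" "tgt s = B" "src r = B" "tgt r = A" "r \<cdot> s = Id A"
    using assms(1) by (auto simp: retract_def)
  have "(Id D \<star> r) \<cdot> (Id D \<star> s) = Id (D \<odot> A)"
    using 1 whisker_comp(1)[of s r D] by simp
  then show ?thesis unfolding retract_def
    using 1 by (intro exI[of _ "Id D \<star> s"] exI[of _ "Id D \<star> r"]) simp
qed

definition assi where
  "assi A B D = (SOME g. arr g \<and> src g = A \<odot> (B \<odot> D) \<and> tgt g = (A \<odot> B) \<odot> D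
     \<and> g \<cdot> ass A B D = Id ((A \<odot> B) \<odot> D) \<and> ass A B D \<cdot> g = Id (A \<odot> (B \<odot> D)))"

lemma assi [simp]:
  "arr (assi A B D)" "src (assi A B D) = A \<odot> (B \<odot> D)" "tgt (assi A B D) = (A \<odot> B) \<odot> D"
  "assi A B D \<cdot> ass A B D = Id ((A \<odot> B) \<odot> D)" "ass A B D \<cdot> assi A B D = Id (A \<odot> (B \<odot> D))"
proof -
  have "\<exists>g. arr g \<and> src g = A \<odot> (B \<odot> D) \<and> tgt g = (A \<odot> B) \<odot> D
     \<and> g \<cdot> ass A B D = Id ((A \<odot> B) \<odot> D) \<and> ass A B D \<cdot> g = Id (A \<odot> (B \<odot> D))"
    using iso_ass[of A B D] unfolding iso_def by simp
  from someI_ex[OF this, folded assi_def]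
  show "arr (assi A B D)" "src (assi A B D) = A \<odot> (B \<odot> D)" "tgt (assi A B D) = (A \<odot> B) \<odot> D"
    "assi A B D \<cdot> ass A B D = Id ((A \<odot> B) \<odot> D)" "ass A B D \<cdot> assi A B D = Id (A \<odot> (B \<odot> D))"
    by auto
qed

abbreviation endo where
  "endo f A \<equiv> arr f \<and> src f = A \<and> tgt f = A"

text \<open>An endomorphism of \<open>A \<odot> B\<close>, acting on the first two factors of the right-nested product.\<close>

definition act where
  "act A B P Y = ass A B Y \<cdot> (P \<star> Id Y) \<cdot> assi A B Y"

lemma endo_act [simp]: "endo P (A \<odot> B) \<Longrightarrow> endo (act A B P Y) (A \<odot> (B \<odot> Y))"
  by (simp add: act_def)

lemma act_ass: "endo P (A \<odot> B) \<Longrightarrow> act A B P Y \<cdot> ass A B Y = ass A B Y \<cdot> (P \<star> Id Y)"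
  by (simp add: act_def)

text \<open>The associator is epi, so at most one operator intertwines it with
  \<open>P \<star> Id Y\<close>. Identities for \<open>act\<close> can thus be checked without
  handling the inverse associator.\<close>

lemma act_eqI:
  assumes "endo P (A \<odot> B)" "endo T (A \<odot> (B \<odot> Y))" "T \<cdot> ass A B Y = ass A B Y \<cdot> (P \<star> Id Y)"
  shows "act A B P Y = T"
  by (rule iso_epi[OF iso_ass[of A B Y]]) (use assms in \<open>simp_all add: act_ass\<close>)

lemma act_Id [simp]: "act A B (Id (A \<odot> B)) Y = Id (A \<odot> (B \<odot> Y))"
  by (rule act_eqI) simp_all

lemma act_scal: "endo P (A \<odot> B) \<Longrightarrow> act A B (scal c P) Y = scal c (act A B P Y)"
  by (rule act_eqI) (simp_all add: act_ass)

lemma act_comp: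
  assumes P: "endo P (A \<odot> B)" and Q: "endo Q (A \<odot> B)"
  shows "act A B (Q \<cdot> P) Y = act A B Q Y \<cdot> act A B P Y"
proof (rule act_eqI)
  have "(act A B Q Y \<cdot> act A B P Y) \<cdot> ass A B Y = act A B Q Y \<cdot> ass A B Y \<cdot> (P \<star> Id Y)"
    using assms by (simp add: act_ass)
  also have "\<dots> = (act A B Q Y \<cdot> ass A B Y) \<cdot> (P \<star> Id Y)"
    using assms by simp
  also have "\<dots> = ass A B Y \<cdot> ((Q \<cdot> P) \<star> Id Y)"
    using assms by (simp add: act_ass whisker_comp)
  finally show "(act A B Q Y \<cdot> act A B P Y) \<cdot> ass A B Y = ass A B Y \<cdot> ((Q \<cdot> P) \<star> Id Y)" .
qed (use assms in simp_all)

text \<open>\<open>P\<close> and \<open>g\<close> act on disjoint factors, so they commute by the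
  exchange law; naturality of the associator carries this to the right-nested product.\<close>

lemma act_natural:
  assumes P: "endo P (A \<odot> B)" and g: "arr g" "src g = Y" "tgt g = Z"
  shows "act A B P Z \<cdot> (Id A \<star> (Id B \<star> g)) = (Id A \<star> (Id B \<star> g)) \<cdot> act A B P Y"
proof (rule iso_epi[OF iso_ass[of A B Y]])
  have n: "ass A B Z \<cdot> (Id (A \<odot> B) \<star> g) = (Id A \<star> (Id B \<star> g)) \<cdot> ass A B Y"
    using ass_natural[of "Id A" "Id B" g A A B B Y Z] g by simp
  have "(act A B P Z \<cdot> (Id A \<star> (Id B \<star> g))) \<cdot> ass A B Y = (act A B P Z \<cdot> ass A B Z) \<cdot> (Id (A \<odot> B) \<star> g)"
    using P g by (simp add: n)
  also have "\<dots> = ass A B Z \<cdot> (P \<star> Id Z) \<cdot> (Id (A \<odot> B) \<star> g)"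
    using P g by (simp add: act_ass)
  also have "\<dots> = (ass A B Z \<cdot> (Id (A \<odot> B) \<star> g)) \<cdot> (P \<star> Id Y)"
    using P g by (simp add: whisker_exchange[of P g "A \<odot> B" "A \<odot> B" Y Z])
  also have "\<dots> = (Id A \<star> (Id B \<star> g)) \<cdot> (act A B P Y \<cdot> ass A B Y)"
    unfolding n using P g by (simp add: act_ass)
  finally show "(act A B P Z \<cdot> (Id A \<star> (Id B \<star> g))) \<cdot> ass A B Y = ((Id A \<star> (Id B \<star> g)) \<cdot> act A B P Y) \<cdot> ass A B Y"
    using P g by simp
qed (use assms in simp_all)

text \<open>The three-edge side of the pentagon; \<open>legR\<close> is the two-edge side. Both are
  paths from the left-nested to the right-nested product, so a pentagon that holds up to a scalar or
  an operator is one equation between two parallel arrows.\<close>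

definition legL where
  "legL A B D E = (Id A \<star> ass B D E) \<cdot> ass A (B \<odot> D) E \<cdot> (ass A B D \<star> Id E)"

definition legR where
  "legR A B D E = ass A B (D \<odot> E) \<cdot> ass (A \<odot> B) D E"

lemma legs [simp]:
  "arr (legL A B D E)" "src (legL A B D E) = ((A \<odot> B) \<odot> D) \<odot> E" "tgt (legL A B D E) = A \<odot> (B \<odot> (D \<odot> E))"
  "arr (legR A B D E)" "src (legR A B D E) = ((A \<odot> B) \<odot> D) \<odot> E" "tgt (legR A B D E) = A \<odot> (B \<odot> (D \<odot> E))"
  by (simp_all add: legL_def legR_def)

lemma pentagon_iff: "pentagon_at C (assoc C) d A B D E \<longleftrightarrow> legL A B D E = scal d (legR A B D E)"
  by (simp add: pentagon_at_def legL_def legR_def arrow_eq_iff)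

definition unr where "unr A = Arrow (A \<odot> tunit C) (runit C A) A"
definition unl where "unl A = Arrow (tunit C \<odot> A) (lunit C A) A"

lemma units [simp]:
  "src (unr A) = A \<odot> tunit C" "tgt (unr A) = A" "mor (unr A) = runit C A"
  "src (unl A) = tunit C \<odot> A" "tgt (unl A) = A" "mor (unl A) = lunit C A"
  by (simp_all add: unr_def unl_def)

lemma iso_units: "iso (unr A)" "iso (unl A)"
  by (simp_all add: iso_iff runit_iso lunit_iso)

lemma arr_units [simp]: "arr (unr A)" "arr (unl A)"
  by (simp_all add: iso_arr iso_units)

lemma units_natural:
  "arr f \<Longrightarrow> src f = A \<Longrightarrow> tgt f = B \<Longrightarrow> unr B \<cdot> (f \<star> Id (tunit C)) = f \<cdot> unr A"
  "arr f \<Longrightarrow> src f = A \<Longrightarrow> tgt f = B \<Longrightarrow> unl B \<cdot> (Id (tunit C) \<star> f) = f \<cdot> unl A"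
  by (auto simp: arrow_eq_iff arr_def intro: runit_natural lunit_natural)

text \<open>Naturality of the unit isomorphisms conjugates the tensored arrow back to the arrow
  itself.\<close>

lemma unit_faithful:
  assumes "arr u" "arr v" "src u = src v" "tgt u = tgt v"
  shows "u \<star> Id (tunit C) = v \<star> Id (tunit C) \<Longrightarrow> u = v"
    and "Id (tunit C) \<star> u = Id (tunit C) \<star> v \<Longrightarrow> u = v"
proof -
  show "u = v" if eq: "u \<star> Id (tunit C) = v \<star> Id (tunit C)"
  proof (rule iso_epi[OF iso_units(1)])
    show "u \<cdot> unr (src u) = v \<cdot> unr (src u)"
      using units_natural(1)[OF assms(1) refl refl] units_natural(1)[OF assms(2) refl refl] eq
      unfolding assms(3,4) by metis
  qed (simp_all add: assms)
  show "u = v" if eq: "Id (tunit C) \<star> u = Id (tunit C) \<star> v"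
  proof (rule iso_epi[OF iso_units(2)])
    show "u \<cdot> unl (src u) = v \<cdot> unl (src u)"
      using units_natural(2)[OF assms(1) refl refl] units_natural(2)[OF assms(2) refl refl] eq
      unfolding assms(3,4) by metis
  qed (simp_all add: assms)
qed

end

text \<open>Schur's lemma: the kernel of \<open>q\<close> is a subobject of a simple object. If it
  is everything then \<open>q = 0\<close>; if it is zero then \<open>q\<close> is mono, and
  simplicity applied to \<open>q\<close> itself makes it an isomorphism.\<close>

lemma (in semisimple_category) simple_endo_iso:
  assumes A: "is_simple C A" and q: "q \<in> Mor C A A" "q \<noteq> 0"
  shows "is_iso C A A q"
proof -
  obtain K \<kappa> where "is_kernel C K A A \<kappa> q" using kernels q by blast
  then have \<kappa>: "\<kappa> \<in> Mor C K A" "q \<bullet> \<kappa> = 0"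
    and univ: "\<And>T g. g \<in> Mor C T A \<Longrightarrow> q \<bullet> g = 0 \<Longrightarrow> \<exists>!h. h \<in> Mor C T K \<and> \<kappa> \<bullet> h = g"
    by (auto simp: is_kernel_def)
  have "is_mono C K A \<kappa>" unfolding is_mono_def
  proof (intro conjI allI ballI impI)
    fix T g h assume gh: "g \<in> Mor C T K" "h \<in> Mor C T K" "\<kappa> \<bullet> g = \<kappa> \<bullet> h"
    have "\<kappa> \<bullet> g \<in> Mor C T A" "q \<bullet> (\<kappa> \<bullet> g) = 0"
      using gh \<kappa> q cmp_assoc[of g T K \<kappa> A q A] cmp_zero(2) by (auto intro: cmp_Mor)
    from univ[OF this] gh show "g = h" by metis
  qed (rule \<kappa>)
  then consider "is_zero_object C K" | "is_iso C K A \<kappa>" using A by (auto simp: is_simple_def)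
  then show ?thesis
  proof cases
    case 1
    have "is_mono C A A q" unfolding is_mono_def
    proof (intro conjI allI ballI impI)
      fix T g h assume gh: "g \<in> Mor C T A" "h \<in> Mor C T A" "q \<bullet> g = q \<bullet> h"
      then have "g - h \<in> Mor C T A" "q \<bullet> (g - h) = 0" using q by (simp_all add: cmp_diff Mor_diff)
      from univ[OF this] obtain w where "w \<in> Mor C T K" "\<kappa> \<bullet> w = g - h" by blast
      then show "g = h" using 1 cmp_zero(1)[OF \<kappa>(1)] by (auto simp: is_zero_object_def)
    qed (rule q)
    then show ?thesis using A by (auto simp: is_simple_def)
  next
    case 2
    then obtain h where "h \<in> Mor C A K" "\<kappa> \<bullet> h = idm C A" by (auto simp: is_iso_def)
    then have "q = 0" using \<kappa> q cmp_assoc[of h A K \<kappa> A q A] idm_right[of q] cmp_zero(2) by metis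
    then show ?thesis using q by simp
  qed
qed

text \<open>A vanishing identity kills every morphism into or out of \<open>A\<close>, which would
  make \<open>A\<close> a zero object.\<close>

lemma (in linear_category) simple_idm: "is_simple C A \<Longrightarrow> idm C A \<noteq> 0"
proof
  assume "is_simple C A" "idm C A = 0"
  have "f = 0" if "f \<in> Mor C A B" for f B
    using idm_right[OF that] cmp_zero(1)[OF that] \<open>idm C A = 0\<close> by simp
  moreover have "f = 0" if "f \<in> Mor C B A" for f B
    using idm_left[OF that] cmp_zero(2)[OF that] \<open>idm C A = 0\<close> by simp
  ultimately have "Mor C A B = {0}" "Mor C B A = {0}" for B
    using Mor_0 by auto
  then show False using \<open>is_simple C A\<close> by (auto simp: is_simple_def is_zero_object_def)
qed

text \<open>The common setting of the three cases. The pentagon scalar is 1 for a categorification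
  and the value of the cocycle for a projective one; leaving it existential lets the rigidity and
  cancellation lemmas serve both.\<close>

locale projective_fusion =
  based_ring I dual + semisimple_category C + tensor_product_category C
  for I :: "'r::ring_1 set" and dual :: "'r \<Rightarrow> 'r"
    and C :: "('k::field, 'o, 'm::ab_group_add) tensor_data" (structure) +
  fixes X :: "'r \<Rightarrow> 'o"
  assumes grothendieck: "has_grothendieck_ring I C X"
    and projective_pentagon: "\<lbrakk>i \<in> I; j \<in> I; k \<in> I; l \<in> I\<rbrakk>
      \<Longrightarrow> \<exists>d. d \<noteq> 0 \<and> pentagon_at C (assoc C) d (X i) (X j) (X k) (X l)"
begin

section \<open>Decomposition of products of two simple objects, and operators diagonal on it\<close>

lemma simple: "i \<in> I \<Longrightarrow> is_simple C (X i)"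
  using grothendieck by (simp add: has_grothendieck_ring_def)

text \<open>\<open>zs\<close> lists the summands with multiplicity. The last clause stands in for
  the orthogonality of inclusions and projections: any function \<open>p\<close> of the labels is
  realised by an operator that has the same eigenvalue on all copies of one simple object.\<close>

definition decomposition where
  "decomposition i j zs g \<longleftrightarrow> set zs = {z \<in> I. based_le I z (i * j)} \<and>
     covers (length zs) g (X i \<odot> X j) \<and>
     (\<forall>q<length zs. arr (g q) \<and> src (g q) = X (zs ! q) \<and> tgt (g q) = X i \<odot> X j \<and>
        (\<exists>h. arr h \<and> src h = X i \<odot> X j \<and> tgt h = X (zs ! q) \<and> h \<cdot> g q = Id (X (zs ! q)))) \<and>
     (\<forall>p. \<exists>P. endo P (X i \<odot> X j) \<and> (\<forall>q<length zs. P \<cdot> g q = scal (p (zs ! q)) (g q)))"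

lemma ex_decomposition:
  assumes ij: "i \<in> I" "j \<in> I"
  shows "\<exists>zs g. decomposition i j zs g"
proof -
  obtain zs where zs: "set zs \<subseteq> I" "\<And>k. k \<in> I \<Longrightarrow> int (count_list zs k) = coeff_in I (i * j) k"
    and sum: "is_direct_sum C (X i \<odot> X j) (map X zs)"
    using has_grothendieck_ring_def[THEN iffD1, OF grothendieck] ij by (elim conjE) metis
  have "z \<in> set zs \<longleftrightarrow> based_le I z (i * j)" if z: "z \<in> I" for z
    using zs(2)[OF z] le_iff[OF z pos_mult[OF pos_basis pos_basis, OF ij]] count_list_0_iff[of zs z]
    by (metis of_nat_0_eq_iff)
  then have set: "set zs = {z \<in> I. based_le I z (i * j)}" using zs(1) by blast
  obtain \<iota> \<pi> where io': "\<forall>p<length zs. \<iota> p \<in> Mor C (map X zs ! p) (X i \<odot> X j) \<and> \<pi> p \<in> Mor C (X i \<odot> X j) (map X zs ! p)"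
    and orth': "\<forall>p<length zs. \<forall>q<length zs. \<pi> p \<bullet> \<iota> q = (if p = q then idm C (map X zs ! p) else 0)"
    and one: "(\<Sum>p<length zs. \<iota> p \<bullet> \<pi> p) = idm C (X i \<odot> X j)"
    using sum[unfolded is_direct_sum_def length_map] by (elim exE conjE)
  have io: "\<iota> p \<in> Mor C (X (zs ! p)) (X i \<odot> X j) \<and> \<pi> p \<in> Mor C (X i \<odot> X j) (X (zs ! p))"
    if "p < length zs" for p using io' that by simp
  have orth: "\<pi> p \<bullet> \<iota> q = (if p = q then idm C (X (zs ! p)) else 0)"
    if "p < length zs" "q < length zs" for p q
    using orth'[rule_format, OF that] that by (simp only: nth_map)
  define g h where "g = (\<lambda>p. Arrow (X (zs ! p)) (\<iota> p) (X i \<odot> X j))" and "h = (\<lambda>p. Arrow (X i \<odot> X j) (\<pi> p) (X (zs ! p)))"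
  have gh [simp]: "src (g p) = X (zs ! p)" "tgt (g p) = X i \<odot> X j" "mor (g p) = \<iota> p"
    "src (h p) = X i \<odot> X j" "tgt (h p) = X (zs ! p)" "mor (h p) = \<pi> p" for p
    by (simp_all add: g_def h_def)
  have arr [simp]: "p < length zs \<Longrightarrow> arr (g p)" "p < length zs \<Longrightarrow> arr (h p)" for p
    using io by (simp_all add: arr_def)
  have cov: "covers (length zs) g (X i \<odot> X j)"
    unfolding covers_def by (rule exI[of _ h]) (simp add: one)
  have "\<exists>P. endo P (X i \<odot> X j) \<and> (\<forall>q<length zs. P \<cdot> g q = scal (p (zs ! q)) (g q))" for p
  proof -
    \<comment> \<open>The diagonal operator weights each projector by \<open>p\<close>; by
      orthogonality, composing with the inclusion number \<open>q\<close> leaves only the term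
      \<open>r = q\<close>.\<close>
    let ?m = "\<Sum>r<length zs. smult C (p (zs ! r)) (\<iota> r \<bullet> \<pi> r)"
    have M: "smult C (p (zs ! r)) (\<iota> r \<bullet> \<pi> r) \<in> Mor C (X i \<odot> X j) (X i \<odot> X j)" if "r \<in> {..<length zs}" for r
      using io[of r] that by (auto intro: Mor_smult cmp_Mor)
    have "?m \<bullet> \<iota> q = smult C (p (zs ! q)) (\<iota> q)" if q: "q < length zs" for q
    proof -
      have "?m \<bullet> \<iota> q = (\<Sum>r<length zs. smult C (p (zs ! r)) (\<iota> r \<bullet> \<pi> r) \<bullet> \<iota> q)"
        using io[OF q] by (intro cmp_sum(2)[OF finite_lessThan M]) auto
      also have "\<dots> = (\<Sum>r<length zs. if r = q then smult C (p (zs ! q)) (\<iota> q) else 0)"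
      proof (intro sum.cong refl)
        fix r assume r: "r \<in> {..<length zs}"
        have "smult C (p (zs ! r)) (\<iota> r \<bullet> \<pi> r) \<bullet> \<iota> q = smult C (p (zs ! r)) ((\<iota> r \<bullet> \<pi> r) \<bullet> \<iota> q)"
          using io[OF q] io[of r] r by (intro cmp_smult_left) (auto intro: cmp_Mor)
        also have "(\<iota> r \<bullet> \<pi> r) \<bullet> \<iota> q = \<iota> r \<bullet> (\<pi> r \<bullet> \<iota> q)"
          using io[OF q] io[of r] r by (intro cmp_assoc) auto
        also have "smult C (p (zs ! r)) (\<iota> r \<bullet> (\<pi> r \<bullet> \<iota> q)) = (if r = q then smult C (p (zs ! q)) (\<iota> q) else 0)"
          using orth[of r q] io[of r] r q idm_right cmp_zero(1) by auto
        finally show "smult C (p (zs ! r)) (\<iota> r \<bullet> \<pi> r) \<bullet> \<iota> q = (if r = q then smult C (p (zs ! q)) (\<iota> q) else 0)" .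
      qed
      finally show ?thesis using q by simp
    qed
    moreover have "?m \<in> Mor C (X i \<odot> X j) (X i \<odot> X j)"
      using M by (rule Mor_sum)
    ultimately show ?thesis
      by (intro exI[of _ "Arrow (X i \<odot> X j) ?m (X i \<odot> X j)"]) (simp add: arr_def arrow_eq_iff)
  qed
  moreover have "h q \<cdot> g q = Id (X (zs ! q))" if "q < length zs" for q
    using that orth by (simp add: arrow_eq_iff)
  ultimately show ?thesis
    unfolding decomposition_def using set cov
    by (intro exI[of _ zs] exI[of _ g]) (auto intro!: exI[of _ "h _"])
qed

definition summands where "summands i j = (SOME zs. \<exists>g. decomposition i j zs g)"
definition incl where "incl i j = (SOME g. decomposition i j (summands i j) g)"
text \<open>One decomposition per pair is fixed by \<open>summands\<close> and \<open>incl\<close>,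
  so operators for different \<open>p\<close> share their eigenspaces. This is what makes
  \<open>diag_inverse\<close> hold.\<close>

definition diag where
  "diag i j p = (SOME P. endo P (X i \<odot> X j) \<and>
     (\<forall>q<length (summands i j). P \<cdot> incl i j q = scal (p (summands i j ! q)) (incl i j q)))"

lemma decomposition_incl:
  assumes "i \<in> I" "j \<in> I"
  shows "decomposition i j (summands i j) (incl i j)"
proof -
  have "\<exists>g. decomposition i j (summands i j) g"
    unfolding summands_def by (rule someI_ex) (rule ex_decomposition[OF assms])
  then show ?thesis unfolding incl_def by (rule someI_ex)
qed

lemma summands:
  assumes "i \<in> I" "j \<in> I"
  shows "set (summands i j) = {z \<in> I. based_le I z (i * j)}"
    and "q < length (summands i j) \<Longrightarrow> summands i j ! q \<in> I"
  using decomposition_incl[OF assms] nth_mem by (auto simp: decomposition_def)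

lemma incl:
  assumes "i \<in> I" "j \<in> I"
  shows "covers (length (summands i j)) (incl i j) (X i \<odot> X j)"
    and "q < length (summands i j) \<Longrightarrow> arr (incl i j q)"
    and "q < length (summands i j) \<Longrightarrow> src (incl i j q) = X (summands i j ! q)"
    and "q < length (summands i j) \<Longrightarrow> tgt (incl i j q) = X i \<odot> X j"
    and "q < length (summands i j) \<Longrightarrow> \<exists>h. arr h \<and> src h = X i \<odot> X j \<and> tgt h = X (summands i j ! q) \<and>
      h \<cdot> incl i j q = Id (X (summands i j ! q))"
  using decomposition_incl[OF assms] by (auto simp: decomposition_def)

lemma diag:
  assumes "i \<in> I" "j \<in> I"
  shows endo_diag: "endo (diag i j p) (X i \<odot> X j)"
    and diag_incl: "q < length (summands i j) \<Longrightarrow> diag i j p \<cdot> incl i j q = scal (p (summands i j ! q)) (incl i j q)"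
proof -
  have "endo (diag i j p) (X i \<odot> X j) \<and>
     (\<forall>q<length (summands i j). diag i j p \<cdot> incl i j q = scal (p (summands i j ! q)) (incl i j q))"
    unfolding diag_def by (rule someI_ex) (use decomposition_incl[OF assms] in \<open>simp add: decomposition_def\<close>)
  then show "endo (diag i j p) (X i \<odot> X j)"
    and "q < length (summands i j) \<Longrightarrow> diag i j p \<cdot> incl i j q = scal (p (summands i j ! q)) (incl i j q)"
    by auto
qed

lemma summand_retract:
  assumes "i \<in> I" "j \<in> I" "z \<in> I" "based_le I z (i * j)"
  shows "retract (X z) (X i \<odot> X j)"
proof -
  obtain q where q: "q < length (summands i j)" "z = summands i j ! q"
    using assms summands(1)[OF assms(1,2)] by (metis (no_types, lifting) in_set_conv_nth mem_Collect_eq)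
  then show ?thesis using incl(2-5)[OF assms(1,2) q(1)] unfolding retract_def by auto
qed

lemma diag_inverse:
  assumes ij: "i \<in> I" "j \<in> I" and p: "\<And>z. z \<in> I \<Longrightarrow> p z \<noteq> 0"
  shows "diag i j p \<cdot> diag i j (\<lambda>z. 1 / p z) = Id (X i \<odot> X j)"
proof (rule covers_ext[OF incl(1)[OF ij]])
  fix q assume q: "q < length (summands i j)"
  show "(diag i j p \<cdot> diag i j (\<lambda>z. 1 / p z)) \<cdot> incl i j q = Id (X i \<odot> X j) \<cdot> incl i j q"
    using p[of "summands i j ! q"] q summands[OF ij] incl[OF ij] diag[OF ij] by simp
qed (use endo_diag[OF ij] in simp_all)

lemma diag_inverse':
  assumes ij: "i \<in> I" "j \<in> I" and p: "\<And>z. z \<in> I \<Longrightarrow> p z \<noteq> 0"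
  shows "diag i j (\<lambda>z. 1 / p z) \<cdot> diag i j p = Id (X i \<odot> X j)"
  using diag_inverse[OF ij, of "\<lambda>z. 1 / p z"] p by simp

text \<open>\<open>1\<close> is a summand of \<open>i * dual i\<close> and of
  \<open>dual i * i\<close>. The unit object is assumed here only to be isomorphic to
  \<open>X 1\<close>, hence the additional passage through \<open>X 1\<close>.\<close>

lemma unit_retract:
  assumes "i \<in> I"
  shows "retract (tunit C) (X i \<odot> X (dual i))" and "retract (tunit C) (X (dual i) \<odot> X i)"
proof -
  have "retract (tunit C) (X 1)"
    using grothendieck by (auto simp: has_grothendieck_ring_def intro: isomorphic_retract)
  then show "retract (tunit C) (X i \<odot> X (dual i))" "retract (tunit C) (X (dual i) \<odot> X i)"
    using summand_retract one_le_dual[OF assms] assms dual_in_basis one_in_basis retract_trans by blast+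
qed

text \<open>Tensor once more with \<open>X (dual i)\<close>, reassociate, and compress to the unit
  object, a retract of \<open>X (dual i) \<odot> X i\<close>. Tensoring with the unit object is
  faithful.\<close>

lemma tens_faithful:
  assumes i: "i \<in> I" and u: "arr u" "arr v" "src u = src v" "tgt u = tgt v"
    and eq: "Id (X i) \<star> u = Id (X i) \<star> v"
  shows "u = v"
proof -
  let ?D = "X (dual i)"
  have nat: "(Id ?D \<star> (Id (X i) \<star> w)) \<cdot> ass ?D (X i) (src w) = ass ?D (X i) (tgt w) \<cdot> (Id (?D \<odot> X i) \<star> w)"
    if "arr w" for w
    using ass_natural[of "Id ?D" "Id (X i)" w] that by simp
  have "ass ?D (X i) (tgt u) \<cdot> (Id (?D \<odot> X i) \<star> u) = ass ?D (X i) (tgt u) \<cdot> (Id (?D \<odot> X i) \<star> v)"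
    using nat[of u] nat[of v] eq u by simp
  then have eq': "Id (?D \<odot> X i) \<star> u = Id (?D \<odot> X i) \<star> v"
    by (rule iso_mono[OF iso_ass, rotated -1]) (use u in simp_all)
  obtain s r where sr: "arr s" "arr r" "src s = tunit C" "tgt s = ?D \<odot> X i" "src r = ?D \<odot> X i"
      "tgt r = tunit C" "r \<cdot> s = Id (tunit C)"
    using unit_retract(2)[OF i] by (auto simp: retract_def)
  have comp: "Id (tunit C) \<star> w = (r \<star> Id (tgt w)) \<cdot> (Id (?D \<odot> X i) \<star> w) \<cdot> (s \<star> Id (src w))"
    if "arr w" for w
    using sr that tens_comp[of s "Id (src w)" r w]
      tens_comp[of s "Id (src w)" "Id (?D \<odot> X i)" w] tens_comp[of s w r "Id (tgt w)"] by simp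
  show ?thesis by (rule unit_faithful(2)) (use comp[of u] comp[of v] eq' u in simp_all)
qed

end

section \<open>Operators on two neighbouring factors\<close>

context tensor_product_category
begin

text \<open>\<open>T\<close> is \<open>S\<close> compressed by the section and retraction between
  \<open>Z\<close> and \<open>Y\<close>. Since \<open>act\<close> is natural in its last argument,
  the same compression turns \<open>act\<close> over \<open>Y\<close> into \<open>act\<close> over
  \<open>Z\<close>.\<close>

lemma act_restrict:
  assumes P: "endo P (A \<odot> B)" and S: "endo S (B \<odot> Y)" and eq: "act A B P Y = Id A \<star> S" and ZY: "retract Z Y"
  shows "\<exists>T. endo T (B \<odot> Z) \<and> act A B P Z = Id A \<star> T"
proof -
  obtain s r where sr: "arr s" "arr r" "src s = Z" "tgt s = Y" "src r = Y" "tgt r = Z" "r \<cdot> s = Id Z"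
    using ZY by (auto simp: retract_def)
  have "(Id A \<star> (Id B \<star> r)) \<cdot> (Id A \<star> (Id B \<star> s)) = Id (A \<odot> (B \<odot> Z))"
    using sr by (simp flip: whisker_comp)
  then have "act A B P Z = (act A B P Z \<cdot> (Id A \<star> (Id B \<star> r))) \<cdot> (Id A \<star> (Id B \<star> s))"
    using P sr by simp
  also have "\<dots> = (Id A \<star> (Id B \<star> r)) \<cdot> act A B P Y \<cdot> (Id A \<star> (Id B \<star> s))"
    using P sr act_natural[OF P sr(2,5,6)] by simp
  also have "\<dots> = Id A \<star> ((Id B \<star> r) \<cdot> S \<cdot> (Id B \<star> s))"
    unfolding eq using S sr by (simp add: whisker_comp)
  finally show ?thesis
    using S sr by (intro exI[of _ "(Id B \<star> r) \<cdot> S \<cdot> (Id B \<star> s)"]) simp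
qed

end

context projective_fusion
begin

lemma legL_eq:
  assumes "i \<in> I" "j \<in> I" "k \<in> I" "l \<in> I"
  shows "\<exists>d. d \<noteq> 0 \<and> legL (X i) (X j) (X k) (X l) = scal d (legR (X i) (X j) (X k) (X l))"
  using projective_pentagon[OF assms] by (simp add: pentagon_iff)

text \<open>The operators are carried along the longer side of the pentagon, which is then replaced
  by the shorter one. The scalar appears on both sides of the equation and cancels, so a pentagon up
  to a scalar is enough; it is available because all four factors are simple.\<close>

lemma act_extend:
  assumes I: "i \<in> I" "j \<in> I" "k \<in> I" "l \<in> I" and P: "endo P (X i \<odot> X j)" and S: "endo S (X j \<odot> X k)"
    and eq: "act (X i) (X j) P (X k) = Id (X i) \<star> S"
  shows "act (X i) (X j) P (X k \<odot> X l) = Id (X i) \<star> act (X j) (X k) S (X l)"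
proof (rule act_eqI[OF P])
  let ?i = "X i" and ?j = "X j" and ?k = "X k" and ?l = "X l"
  let ?S = "act ?j ?k S ?l"
  have "(Id ?i \<star> ?S) \<cdot> legL ?i ?j ?k ?l
      = (Id ?i \<star> (?S \<cdot> ass ?j ?k ?l)) \<cdot> ass ?i (?j \<odot> ?k) ?l \<cdot> (ass ?i ?j ?k \<star> Id ?l)"
    using S by (simp add: legL_def whisker_comp)
  also have "\<dots> = (Id ?i \<star> ass ?j ?k ?l) \<cdot> ((Id ?i \<star> (S \<star> Id ?l)) \<cdot> ass ?i (?j \<odot> ?k) ?l) \<cdot> (ass ?i ?j ?k \<star> Id ?l)"
    using S by (simp add: act_ass whisker_comp)
  also have "(Id ?i \<star> (S \<star> Id ?l)) \<cdot> ass ?i (?j \<odot> ?k) ?l = ass ?i (?j \<odot> ?k) ?l \<cdot> ((Id ?i \<star> S) \<star> Id ?l)"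
    using S by (intro ass_natural[symmetric]) simp_all
  also have "(Id ?i \<star> ass ?j ?k ?l) \<cdot> (ass ?i (?j \<odot> ?k) ?l \<cdot> ((Id ?i \<star> S) \<star> Id ?l)) \<cdot> (ass ?i ?j ?k \<star> Id ?l)
      = (Id ?i \<star> ass ?j ?k ?l) \<cdot> ass ?i (?j \<odot> ?k) ?l \<cdot> ((act ?i ?j P ?k \<cdot> ass ?i ?j ?k) \<star> Id ?l)"
    unfolding eq using S by (simp add: whisker_comp)
  also have "\<dots> = legL ?i ?j ?k ?l \<cdot> ((P \<star> Id ?k) \<star> Id ?l)"
    unfolding act_ass[OF P] using P by (simp add: legL_def whisker_comp)
  finally have L: "(Id ?i \<star> ?S) \<cdot> legL ?i ?j ?k ?l = legL ?i ?j ?k ?l \<cdot> ((P \<star> Id ?k) \<star> Id ?l)" .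
  obtain d where "d \<noteq> 0" "legL ?i ?j ?k ?l = scal d (legR ?i ?j ?k ?l)"
    using legL_eq[OF I] by blast
  then have R: "(Id ?i \<star> ?S) \<cdot> legR ?i ?j ?k ?l = legR ?i ?j ?k ?l \<cdot> ((P \<star> Id ?k) \<star> Id ?l)"
    using L S P by (simp add: scal_eq_iff)
  show "(Id ?i \<star> ?S) \<cdot> ass ?i ?j (?k \<odot> ?l) = ass ?i ?j (?k \<odot> ?l) \<cdot> (P \<star> Id (?k \<odot> ?l))"
  proof (rule iso_epi[OF iso_ass])
    have "ass (?i \<odot> ?j) ?k ?l \<cdot> ((P \<star> Id ?k) \<star> Id ?l) = (P \<star> Id (?k \<odot> ?l)) \<cdot> ass (?i \<odot> ?j) ?k ?l"
      using ass_natural[of P "Id ?k" "Id ?l"] P by simp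
    then show "((Id ?i \<star> ?S) \<cdot> ass ?i ?j (?k \<odot> ?l)) \<cdot> ass (?i \<odot> ?j) ?k ?l
        = (ass ?i ?j (?k \<odot> ?l) \<cdot> (P \<star> Id (?k \<odot> ?l))) \<cdot> ass (?i \<odot> ?j) ?k ?l"
      using R S P by (simp add: legR_def)
  qed (use S P in simp_all)
qed (use S in simp)

text \<open>\<open>X j \<odot> tunit C\<close> is isomorphic to the simple object
  \<open>X j\<close>, so \<open>T\<close> minus \<open>c\<close> times the identity is zero or
  invertible. The eigenvector \<open>g\<close> of \<open>P\<close> yields a nonzero arrow that this
  difference, tensored with \<open>A\<close>, kills, which excludes invertibility.\<close>

lemma act_unit_scalar:
  assumes I: "j \<in> I" "z \<in> I" and P: "endo P (A \<odot> X j)" and T: "endo T (X j \<odot> tunit C)"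
    and eq: "act A (X j) P (tunit C) = Id A \<star> T"
    and g: "arr g" "src g = X z" "tgt g = A \<odot> X j" "mor g \<noteq> 0" "P \<cdot> g = scal c g"
  shows "P = scal c (Id (A \<odot> X j))"
proof -
  let ?j1 = "X j \<odot> tunit C"
  define N where "N = Arrow ?j1 (mor T - smult C c (idm C ?j1)) ?j1"
  have N: "endo N ?j1"
    using T unfolding N_def arr_def by (auto intro!: Mor_diff Mor_smult idm_Mor)
  then have N': "mor N \<in> Mor C ?j1 ?j1" unfolding arr_def by metis
  have N0: "mor N = 0"
  proof (rule ccontr)
    assume N0: "mor N \<noteq> 0"
    obtain u where u: "arr u" "src u = X j" "tgt u = ?j1" "u \<cdot> unr (X j) = Id ?j1" "unr (X j) \<cdot> u = Id (X j)"
      using iso_units(1)[of "X j"] by (auto simp: iso_def)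
    \<comment> \<open>Schur's lemma is available for \<open>X j\<close>, so \<open>N\<close> is
      transported there along the right unit isomorphism.\<close>
    let ?q = "unr (X j) \<cdot> N \<cdot> u"
    have "(u \<cdot> unr (X j)) \<cdot> N \<cdot> (u \<cdot> unr (X j)) = u \<cdot> ?q \<cdot> unr (X j)"
      using u(1-3) N by simp
    then have Nq: "N = u \<cdot> ?q \<cdot> unr (X j)" using u N by simp
    have q: "endo ?q (X j)" using u N by simp
    have "mor ?q \<noteq> 0"
    proof
      assume "mor ?q = 0"
      then have "mor (u \<cdot> ?q \<cdot> unr (X j)) = mor u \<bullet> (0 \<bullet> mor (unr (X j)))" by simp
      moreover have "0 \<bullet> mor (unr (X j)) = 0" "mor u \<bullet> 0 = 0"
        using cmp_zero(2)[of "mor (unr (X j))"] cmp_zero(1)[of "mor u"] u(1) arr_units(1)[of "X j"] unfolding arr_def by blast+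
      ultimately show False using Nq N0 by simp
    qed
    moreover have "mor ?q \<in> Mor C (X j) (X j)" using q unfolding arr_def by metis
    ultimately have "iso ?q"
      unfolding iso_iff using simple_endo_iso[OF simple[OF I(1)], of "mor ?q"] q by metis
    then obtain v where v: "arr v" "src v = X j" "tgt v = X j" "v \<cdot> ?q = Id (X j)"
      using q unfolding iso_def by auto
    \<comment> \<open>The inverse of \<open>?q\<close>, transported back, becomes a left inverse of
      \<open>N\<close>.\<close>
    let ?M = "u \<cdot> v \<cdot> unr (X j)"
    have retr: "unr (X j) \<cdot> u \<cdot> f = f" if "arr f" "tgt f = X j" for f
      using comp_assoc[of f u "unr (X j)"] u that by simp
    have "?M \<cdot> N = ?M \<cdot> (u \<cdot> ?q \<cdot> unr (X j))" using Nq by (rule arg_cong)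
    also have "\<dots> = u \<cdot> v \<cdot> ?q \<cdot> unr (X j)" using u(1-3) v(1-3) N by (simp add: retr)
    also have "\<dots> = u \<cdot> (v \<cdot> ?q) \<cdot> unr (X j)" using u v(1-3) N by simp
    also have "\<dots> = Id ?j1" using u v(4) by simp
    finally have MN: "?M \<cdot> N = Id ?j1" .
    \<comment> \<open>The eigenvector \<open>g\<close> moved to the right-nested product, where
      \<open>Id A \<star> T\<close> multiplies it by \<open>c\<close>.\<close>
    let ?w = "ass A (X j) (tunit C) \<cdot> (g \<star> Id (tunit C))"
    have w: "arr ?w" "src ?w = X z \<odot> tunit C" "tgt ?w = A \<odot> ?j1" using g by simp_all
    have "(Id A \<star> T) \<cdot> ?w = act A (X j) P (tunit C) \<cdot> ?w" by (simp add: eq)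
    also have "\<dots> = (act A (X j) P (tunit C) \<cdot> ass A (X j) (tunit C)) \<cdot> (g \<star> Id (tunit C))"
      using P g by simp
    also have "\<dots> = ass A (X j) (tunit C) \<cdot> ((P \<cdot> g) \<star> Id (tunit C))"
      unfolding act_ass[OF P] using P g(1-4) by (simp add: whisker_comp)
    also have "\<dots> = scal c ?w" using g by simp
    finally have Tw: "mor (Id A \<star> T) \<bullet> mor ?w = smult C c (mor ?w)"
      by (metis mor_simps(1,3))
    have "idm C A \<boxtimes> mor T = (idm C A \<boxtimes> mor N) + (idm C A \<boxtimes> smult C c (idm C ?j1))"
      using tmor_add_right[of "idm C A" A A "mor N" ?j1 ?j1 "smult C c (idm C ?j1)"] N
      by (simp add: N_def arr_def idm_Mor Mor_smult)
    then have "mor (Id A \<star> T) = mor (Id A \<star> N) + mor (scal c (Id (A \<odot> ?j1)))"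
      using tmor_smult_right[of "idm C A" A A "idm C ?j1" ?j1 ?j1 c] by (simp add: idm_Mor tmor_idm)
    then have "mor (Id A \<star> T) \<bullet> mor ?w = (mor (Id A \<star> N) \<bullet> mor ?w) + (mor (scal c (Id (A \<odot> ?j1))) \<bullet> mor ?w)"
      using cmp_add_left[of "mor ?w" "X z \<odot> tunit C" "A \<odot> ?j1" "mor (Id A \<star> N)" "A \<odot> ?j1" "mor (scal c (Id (A \<odot> ?j1)))"]
        w N N' arr_Id[of A] arr_tens[of "Id A" N] arr_scal[OF arr_Id, of c "A \<odot> ?j1"] by (simp add: arr_def del: mor_simps mor_tens)
    moreover have "mor (scal c (Id (A \<odot> ?j1))) \<bullet> mor ?w = smult C c (mor ?w)"
      using comp_scal(1)[of ?w "Id (A \<odot> ?j1)" c] comp_Id(1)[OF w(1,3)] w by (metis arr_Id mor_simps(1,3) src_tgt_simps(3))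
    ultimately have 0: "mor ((Id A \<star> N) \<cdot> ?w) = 0" using Tw by simp
    have "?w = (Id A \<star> (?M \<cdot> N)) \<cdot> ?w" unfolding MN using w by simp
    also have "\<dots> = (Id A \<star> ?M) \<cdot> ((Id A \<star> N) \<cdot> ?w)" using w N u v g by (simp add: whisker_comp)
    finally have "mor ?w = mor (Id A \<star> ?M) \<bullet> 0" using 0 by (metis mor_simps(1))
    moreover have "arr (Id A \<star> ?M)" using u v by simp
    ultimately have w0: "mor ?w = 0" using cmp_zero(1) unfolding arr_def by metis
    \<comment> \<open>Arrows with fixed endpoints have no separate zero symbol; vanishing is
      expressed as equality with the multiple by 0.\<close>
    have "g \<star> Id (tunit C) = scal 0 g \<star> Id (tunit C)"
    proof (rule iso_mono[OF iso_ass[of A "X j" "tunit C"]])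
      show "?w = ass A (X j) (tunit C) \<cdot> (scal 0 g \<star> Id (tunit C))"
        using w0 g by (simp add: arrow_eq_iff)
    qed (use g in simp_all)
    then have "g = scal 0 g" by (rule unit_faithful(1)[rotated -1]) (use g in simp_all)
    then show False using g(4) by (metis hom.scale_zero_left mor_simps(3))
  qed
  then have "T = scal c (Id ?j1)" using T by (simp add: N_def arrow_eq_iff)
  then have "act A (X j) P (tunit C) = act A (X j) (scal c (Id (A \<odot> X j))) (tunit C)"
    by (simp add: eq act_scal)
  then have "act A (X j) P (tunit C) \<cdot> ass A (X j) (tunit C)
      = act A (X j) (scal c (Id (A \<odot> X j))) (tunit C) \<cdot> ass A (X j) (tunit C)"
    by simp
  then have "ass A (X j) (tunit C) \<cdot> (P \<star> Id (tunit C)) = ass A (X j) (tunit C) \<cdot> (scal c (Id (A \<odot> X j)) \<star> Id (tunit C))"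
    using act_ass[OF P] act_ass[of "scal c (Id (A \<odot> X j))" A "X j" "tunit C"] by simp
  then have "P \<star> Id (tunit C) = scal c (Id (A \<odot> X j)) \<star> Id (tunit C)"
    by (rule iso_mono[OF iso_ass, rotated -1]) (use P in simp_all)
  then show ?thesis by (rule unit_faithful(1)[rotated -1]) (use P in simp_all)
qed

text \<open>The condition on the third factor under which \<open>diag_rigid\<close> applies. By
  \<open>thick_tens\<close> it holds for right-nested products of the \<open>X i\<close> of any
  length.\<close>

definition thick where
  "thick Y \<longleftrightarrow> (\<exists>k\<in>I. retract (X k) Y)"

lemma thick_simple [simp]: "k \<in> I \<Longrightarrow> thick (X k)"
  using retract_refl by (auto simp: thick_def)

lemma thick_tens [simp]:
  assumes "i \<in> I" "thick Y"
  shows "thick (X i \<odot> Y)"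
proof -
  obtain k where k: "k \<in> I" "retract (X k) Y" using assms by (auto simp: thick_def)
  obtain z where z: "z \<in> I" "based_le I z (i * k)" using ex_le assms k by blast
  then have "retract (X z) (X i \<odot> Y)"
    using retract_trans[OF summand_retract retract_tens] assms k by blast
  then show ?thesis using z by (auto simp: thick_def)
qed

lemma incl_nonzero:
  assumes "i \<in> I" "j \<in> I" "q < length (summands i j)"
  shows "mor (incl i j q) \<noteq> 0"
proof
  assume 0: "mor (incl i j q) = 0"
  obtain h where h: "arr h" "h \<cdot> incl i j q = Id (X (summands i j ! q))"
    using incl(5)[OF assms] by blast
  then have "idm C (X (summands i j ! q)) = mor h \<bullet> 0" by (metis 0 mor_simps(1,2))
  then show False
    using cmp_zero(1) h(1) simple_idm[OF simple[OF summands(2)[OF assms]]] unfolding arr_def by metis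
qed

text \<open>\<open>Y\<close> is replaced by a simple retract \<open>X k\<close>, where the pentagon
  may be used to append \<open>X (dual k)\<close>; the product of the two is then restricted to the
  unit object. The eigenvector for \<open>act_unit_scalar\<close> is the inclusion of any summand of
  \<open>X i \<odot> X j\<close>.\<close>

lemma diag_rigid:
  assumes ij: "i \<in> I" "j \<in> I" and Y: "thick Y" and S: "endo S (X j \<odot> Y)"
    and eq: "act (X i) (X j) (diag i j p) Y = Id (X i) \<star> S"
  shows "\<exists>c. diag i j p = scal c (Id (X i \<odot> X j))"
proof -
  obtain k where k: "k \<in> I" "retract (X k) Y" using Y by (auto simp: thick_def)
  obtain S' where S': "endo S' (X j \<odot> X k)" "act (X i) (X j) (diag i j p) (X k) = Id (X i) \<star> S'"
    using act_restrict[OF endo_diag[OF ij] S eq k(2)] by blast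
  have "endo (act (X j) (X k) S' (X (dual k))) (X j \<odot> (X k \<odot> X (dual k)))"
    using S' by simp
  from act_restrict[OF endo_diag[OF ij] this act_extend[OF ij k(1) dual_in_basis[OF k(1)] endo_diag[OF ij] S']
    unit_retract(1)[OF k(1)]]
  obtain T where T: "endo T (X j \<odot> tunit C)" "act (X i) (X j) (diag i j p) (tunit C) = Id (X i) \<star> T"
    by blast
  obtain z where "z \<in> I" "based_le I z (i * j)" using ex_le[OF ij] by blast
  then obtain q where q: "q < length (summands i j)"
    using summands(1)[OF ij] by (metis (no_types, lifting) in_set_conv_nth mem_Collect_eq)
  show ?thesis
    using act_unit_scalar[OF ij(2) summands(2)[OF ij q] endo_diag[OF ij] T incl(2-4)[OF ij q] incl_nonzero[OF ij q] diag_incl[OF ij q]]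
    by blast
qed

lemma diag_scalar:
  assumes ij: "i \<in> I" "j \<in> I" and eq: "diag i j p = scal c (Id (X i \<odot> X j))"
    and z: "z \<in> I" "based_le I z (i * j)"
  shows "p z = c"
proof -
  obtain q where q: "q < length (summands i j)" "z = summands i j ! q"
    using z summands(1)[OF ij] by (metis (no_types, lifting) in_set_conv_nth mem_Collect_eq)
  have "scal (p z) (incl i j q) = scal c (incl i j q)"
    using diag_incl[OF ij q(1), of p] eq incl[OF ij] q by simp
  then have "smult C (p z) (mor (incl i j q)) = smult C c (mor (incl i j q))" by (metis mor_simps(3))
  then show ?thesis using incl_nonzero[OF ij q(1)] by simp
qed

end

section \<open>Pentagons and associahedra up to operators\<close>

lemma (in linear_category) iso_comp:
  assumes "iso f" "iso g" "tgt f = src g"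
  shows "iso (g \<cdot> f)"
proof -
  obtain f' where f': "arr f'" "src f' = tgt f" "tgt f' = src f" "f' \<cdot> f = Id (src f)" "f \<cdot> f' = Id (tgt f)"
    using assms(1) by (auto simp: iso_def)
  obtain g' where g': "arr g'" "src g' = tgt g" "tgt g' = src g" "g' \<cdot> g = Id (src g)" "g \<cdot> g' = Id (tgt g)"
    using assms(2) by (auto simp: iso_def)
  note fg = iso_arr[OF assms(1)] iso_arr[OF assms(2)] assms(3)
  have "(f' \<cdot> g') \<cdot> (g \<cdot> f) = f' \<cdot> (g' \<cdot> g) \<cdot> f" "(g \<cdot> f) \<cdot> (f' \<cdot> g') = g \<cdot> (f \<cdot> f') \<cdot> g'"
    using f'(1-3) g'(1-3) fg by simp_all
  then have "(f' \<cdot> g') \<cdot> (g \<cdot> f) = Id (src f)" "(g \<cdot> f) \<cdot> (f' \<cdot> g') = Id (tgt g)"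
    using f' g' fg by simp_all
  then show ?thesis unfolding iso_def
    using f'(1-3) g'(1-3) fg by (auto intro!: exI[of _ "f' \<cdot> g'"] simp del: comp_assoc)
qed

text \<open>Gathers scalars on summands into one operator. Naturality moves the inclusion
  \<open>g q\<close> past \<open>u\<close> and \<open>v\<close> to an inclusion \<open>h q\<close>
  into the target, where the two differ by \<open>c q\<close>; \<open>D\<close> has exactly these
  eigenvalues, and the \<open>g q\<close> are jointly epic.\<close>

lemma (in linear_category) covers_twist:
  assumes cov: "covers n g S" and u: "arr u" "src u = S" and v: "arr v" "src v = S" "tgt v = tgt u"
    and D: "arr D" "src D = tgt u" "tgt D = tgt u"
    and h: "\<And>q. q < n \<Longrightarrow> arr (h q) \<and> tgt (h q) = tgt u"
    and v': "\<And>q. q < n \<Longrightarrow> arr (v' q) \<and> tgt (v' q) = src (h q)"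
    and ug: "\<And>q. q < n \<Longrightarrow> u \<cdot> g q = h q \<cdot> scal (c q) (v' q)"
    and vg: "\<And>q. q < n \<Longrightarrow> v \<cdot> g q = h q \<cdot> v' q"
    and Dh: "\<And>q. q < n \<Longrightarrow> D \<cdot> h q = scal (c q) (h q)"
  shows "u = D \<cdot> v"
proof (rule covers_ext[OF cov])
  fix q assume q: "q < n"
  have g: "arr (g q)" "tgt (g q) = S" using cov q by (auto simp: covers_def)
  have "(D \<cdot> v) \<cdot> g q = D \<cdot> h q \<cdot> v' q"
    using g v D vg[OF q] by simp
  also have "\<dots> = (D \<cdot> h q) \<cdot> v' q"
    using D h[OF q] v'[OF q] by simp
  also have "\<dots> = u \<cdot> g q"
    unfolding Dh[OF q] ug[OF q] using h[OF q] v'[OF q] by simp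
  finally show "u \<cdot> g q = (D \<cdot> v) \<cdot> g q" ..
qed (use u v D in simp_all)

context tensor_product_category
begin

lemma leg_natural:
  assumes "arr f" "arr g" "arr h" "arr e" "src f = A" "tgt f = A'" "src g = B" "tgt g = B'"
    "src h = D" "tgt h = D'" "src e = E" "tgt e = E'"
  shows "legL A' B' D' E' \<cdot> (((f \<star> g) \<star> h) \<star> e) = (f \<star> (g \<star> (h \<star> e))) \<cdot> legL A B D E"
    and "legR A' B' D' E' \<cdot> (((f \<star> g) \<star> h) \<star> e) = (f \<star> (g \<star> (h \<star> e))) \<cdot> legR A B D E"
proof -
  have exch: "(Id A' \<star> ass B' D' E') \<cdot> (f \<star> ((g \<star> h) \<star> e)) = (f \<star> (g \<star> (h \<star> e))) \<cdot> (Id A \<star> ass B D E)"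
  proof -
    have "(Id A' \<star> ass B' D' E') \<cdot> (f \<star> ((g \<star> h) \<star> e)) = (Id A' \<cdot> f) \<star> (ass B' D' E' \<cdot> ((g \<star> h) \<star> e))"
      using assms by (intro tens_comp[symmetric]) simp_all
    also have "\<dots> = (f \<cdot> Id A) \<star> ((g \<star> (h \<star> e)) \<cdot> ass B D E)"
      using assms by (simp add: ass_natural[of g h e B B' D D' E E'])
    also have "\<dots> = (f \<star> (g \<star> (h \<star> e))) \<cdot> (Id A \<star> ass B D E)"
      using assms by (intro tens_comp) simp_all
    finally show ?thesis .
  qed
  have exch': "(ass A' B' D' \<star> Id E') \<cdot> (((f \<star> g) \<star> h) \<star> e) = ((f \<star> (g \<star> h)) \<star> e) \<cdot> (ass A B D \<star> Id E)"
  proof -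
    have "(ass A' B' D' \<star> Id E') \<cdot> (((f \<star> g) \<star> h) \<star> e) = (ass A' B' D' \<cdot> ((f \<star> g) \<star> h)) \<star> (Id E' \<cdot> e)"
      using assms by (intro tens_comp[symmetric]) simp_all
    also have "\<dots> = ((f \<star> (g \<star> h)) \<cdot> ass A B D) \<star> (e \<cdot> Id E)"
      using assms by (simp add: ass_natural[of f g h A A' B B' D D'])
    also have "\<dots> = ((f \<star> (g \<star> h)) \<star> e) \<cdot> (ass A B D \<star> Id E)"
      using assms by (intro tens_comp) simp_all
    finally show ?thesis .
  qed
  have "legL A' B' D' E' \<cdot> (((f \<star> g) \<star> h) \<star> e)
      = (Id A' \<star> ass B' D' E') \<cdot> ass A' (B' \<odot> D') E' \<cdot> ((ass A' B' D' \<star> Id E') \<cdot> (((f \<star> g) \<star> h) \<star> e))"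
    using assms by (simp add: legL_def)
  also have "\<dots> = (Id A' \<star> ass B' D' E') \<cdot> (ass A' (B' \<odot> D') E' \<cdot> ((f \<star> (g \<star> h)) \<star> e)) \<cdot> (ass A B D \<star> Id E)"
    unfolding exch' using assms by simp
  also have "ass A' (B' \<odot> D') E' \<cdot> ((f \<star> (g \<star> h)) \<star> e) = (f \<star> ((g \<star> h) \<star> e)) \<cdot> ass A (B \<odot> D) E"
    using assms by (intro ass_natural) simp_all
  also have "(Id A' \<star> ass B' D' E') \<cdot> ((f \<star> ((g \<star> h) \<star> e)) \<cdot> ass A (B \<odot> D) E) \<cdot> (ass A B D \<star> Id E)
      = ((Id A' \<star> ass B' D' E') \<cdot> (f \<star> ((g \<star> h) \<star> e))) \<cdot> ass A (B \<odot> D) E \<cdot> (ass A B D \<star> Id E)"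
    using assms by simp
  also have "\<dots> = (f \<star> (g \<star> (h \<star> e))) \<cdot> legL A B D E"
    unfolding exch using assms by (simp add: legL_def)
  finally show "legL A' B' D' E' \<cdot> (((f \<star> g) \<star> h) \<star> e) = (f \<star> (g \<star> (h \<star> e))) \<cdot> legL A B D E" .
  have "legR A' B' D' E' \<cdot> (((f \<star> g) \<star> h) \<star> e)
      = ass A' B' (D' \<odot> E') \<cdot> (ass (A' \<odot> B') D' E' \<cdot> (((f \<star> g) \<star> h) \<star> e))"
    using assms by (simp add: legR_def)
  also have "ass (A' \<odot> B') D' E' \<cdot> (((f \<star> g) \<star> h) \<star> e) = ((f \<star> g) \<star> (h \<star> e)) \<cdot> ass (A \<odot> B) D E"
    using assms by (intro ass_natural) simp_all
  also have "ass A' B' (D' \<odot> E') \<cdot> (((f \<star> g) \<star> (h \<star> e)) \<cdot> ass (A \<odot> B) D E)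
      = (ass A' B' (D' \<odot> E') \<cdot> ((f \<star> g) \<star> (h \<star> e))) \<cdot> ass (A \<odot> B) D E"
    using assms by simp
  also have "ass A' B' (D' \<odot> E') \<cdot> ((f \<star> g) \<star> (h \<star> e)) = (f \<star> (g \<star> (h \<star> e))) \<cdot> ass A B (D \<odot> E)"
    using assms by (intro ass_natural) simp_all
  finally show "legR A' B' D' E' \<cdot> (((f \<star> g) \<star> h) \<star> e) = (f \<star> (g \<star> (h \<star> e))) \<cdot> legR A B D E"
    using assms by (simp add: legR_def)
qed

text \<open>\<open>twisted\<close> is the pentagon of a second associator: \<open>d\<close> and
  \<open>d'\<close> are its values on triples without a composite entry, and a composite entry
  contributes an operator. Moving all operators to the right-nested end leaves the original
  pentagon, which cancels.\<close>

lemma twisted_pentagon: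
  assumes P: "endo P (A \<odot> B)" and Q: "endo Q (B \<odot> D)" and R: "endo R (D \<odot> E)"
    and pentagon: "legL A B D E = legR A B D E"
    and twisted: "(Id A \<star> scal d' (ass B D E)) \<cdot> ((Id A \<star> (Q \<star> Id E)) \<cdot> ass A (B \<odot> D) E) \<cdot> (scal d (ass A B D) \<star> Id E)
      = ((Id A \<star> (Id B \<star> R)) \<cdot> ass A B (D \<odot> E)) \<cdot> ((P \<star> Id (D \<odot> E)) \<cdot> ass (A \<odot> B) D E)"
  shows "scal (d' * d) (Id A \<star> act B D Q E) = (Id A \<star> (Id B \<star> R)) \<cdot> act A B P (D \<odot> E)"
proof (rule iso_epi[OF iso_ass[of A B "D \<odot> E"]], simp_all add: P Q R del: comp_assoc comp_scal)
  have "(scal (d' * d) (Id A \<star> act B D Q E)) \<cdot> legL A B D E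
     = scal (d' * d) ((Id A \<star> (act B D Q E \<cdot> ass B D E)) \<cdot> ass A (B \<odot> D) E \<cdot> (ass A B D \<star> Id E))"
    using Q by (simp add: legL_def whisker_comp)
  also have "\<dots> = (Id A \<star> scal d' (ass B D E)) \<cdot> ((Id A \<star> (Q \<star> Id E)) \<cdot> ass A (B \<odot> D) E) \<cdot> (scal d (ass A B D) \<star> Id E)"
    unfolding act_ass[OF Q] using Q by (simp add: whisker_comp mult.commute)
  also have "\<dots> = (Id A \<star> (Id B \<star> R)) \<cdot> (ass A B (D \<odot> E) \<cdot> (P \<star> Id (D \<odot> E))) \<cdot> ass (A \<odot> B) D E"
    unfolding twisted using P R by simp
  also have "\<dots> = ((Id A \<star> (Id B \<star> R)) \<cdot> act A B P (D \<odot> E)) \<cdot> legR A B D E"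
    unfolding act_ass[OF P, symmetric] using P R by (simp add: legR_def)
  finally have eq: "(scal (d' * d) (Id A \<star> act B D Q E)) \<cdot> legR A B D E = ((Id A \<star> (Id B \<star> R)) \<cdot> act A B P (D \<odot> E)) \<cdot> legR A B D E"
    unfolding pentagon .
  show "scal (d' * d) (Id A \<star> act B D Q E) \<cdot> ass A B (D \<odot> E) = ((Id A \<star> (Id B \<star> R)) \<cdot> act A B P (D \<odot> E)) \<cdot> ass A B (D \<odot> E)"
    by (rule iso_epi[OF iso_ass[of "A \<odot> B" D E]]) (use eq P Q R in \<open>simp_all add: legR_def\<close>)
qed

text \<open>The three-dimensional associahedron, whose six pentagonal faces commute up to the given
  endomorphisms.\<close>

lemma twisted_associahedron:
  assumes P: "endo P (A \<odot> B)" and Q: "endo Q (B \<odot> D)" and R: "endo R (D \<odot> E)" and S: "endo S (E \<odot> F)"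
    and fP: "legL (A \<odot> B) D E F = (P \<star> Id (D \<odot> (E \<odot> F))) \<cdot> legR (A \<odot> B) D E F"
    and fQ: "legL A (B \<odot> D) E F = (Id A \<star> (Q \<star> Id (E \<odot> F))) \<cdot> legR A (B \<odot> D) E F"
    and fR: "legL A B (D \<odot> E) F = (Id A \<star> (Id B \<star> (R \<star> Id F))) \<cdot> legR A B (D \<odot> E) F"
    and fS: "legL A B D (E \<odot> F) = (Id A \<star> (Id B \<star> (Id D \<star> S))) \<cdot> legR A B D (E \<odot> F)"
    and fd: "legL A B D E = scal d (legR A B D E)"
    and fd': "legL B D E F = scal d' (legR B D E F)"
  shows "scal d' (Id A \<star> (act B D Q (E \<odot> F) \<cdot> (Id B \<star> (Id D \<star> S))))
    = scal d ((Id A \<star> (Id B \<star> act D E R F)) \<cdot> act A B P (D \<odot> (E \<odot> F)))"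
proof -
  \<comment> \<open>Two paths between the extreme bracketings of five factors. The faces
    \<open>fR\<close> and \<open>fP\<close> turn \<open>?T\<close> into operators followed by
    \<open>?U\<close>, and the other four pentagons do the same for a multiple of \<open>?T\<close>.
    The three square faces are instances of \<open>ass_natural\<close>.\<close>
  let ?U = "ass A B (D \<odot> (E \<odot> F)) \<cdot> ass (A \<odot> B) D (E \<odot> F) \<cdot> ass ((A \<odot> B) \<odot> D) E F"
  let ?T = "(Id A \<star> (Id B \<star> ass D E F)) \<cdot> (Id A \<star> ass B (D \<odot> E) F) \<cdot> ass A (B \<odot> (D \<odot> E)) F
    \<cdot> (ass A B (D \<odot> E) \<star> Id F) \<cdot> (ass (A \<odot> B) D E \<star> Id F)"
  have "?T = (Id A \<star> (Id B \<star> ass D E F)) \<cdot> legL A B (D \<odot> E) F \<cdot> (ass (A \<odot> B) D E \<star> Id F)"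
    by (simp add: legL_def)
  also have "\<dots> = (Id A \<star> (Id B \<star> (ass D E F \<cdot> (R \<star> Id F)))) \<cdot> ass A B ((D \<odot> E) \<odot> F)
      \<cdot> ass (A \<odot> B) (D \<odot> E) F \<cdot> (ass (A \<odot> B) D E \<star> Id F)"
    unfolding fR using R by (simp add: legR_def whisker_comp)
  also have "\<dots> = (Id A \<star> (Id B \<star> act D E R F)) \<cdot> ((Id A \<star> (Id B \<star> ass D E F)) \<cdot> ass A B ((D \<odot> E) \<odot> F))
      \<cdot> ass (A \<odot> B) (D \<odot> E) F \<cdot> (ass (A \<odot> B) D E \<star> Id F)"
    unfolding act_ass[OF R, symmetric] using R by (simp add: whisker_comp)
  also have "(Id A \<star> (Id B \<star> ass D E F)) \<cdot> ass A B ((D \<odot> E) \<odot> F) = ass A B (D \<odot> (E \<odot> F)) \<cdot> (Id (A \<odot> B) \<star> ass D E F)"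
    using ass_natural[of "Id A" "Id B" "ass D E F"] by simp
  also have "(Id A \<star> (Id B \<star> act D E R F)) \<cdot> (ass A B (D \<odot> (E \<odot> F)) \<cdot> (Id (A \<odot> B) \<star> ass D E F))
      \<cdot> ass (A \<odot> B) (D \<odot> E) F \<cdot> (ass (A \<odot> B) D E \<star> Id F)
    = (Id A \<star> (Id B \<star> act D E R F)) \<cdot> ass A B (D \<odot> (E \<odot> F)) \<cdot> legL (A \<odot> B) D E F"
    using R by (simp add: legL_def)
  also have "\<dots> = (Id A \<star> (Id B \<star> act D E R F)) \<cdot> (ass A B (D \<odot> (E \<odot> F)) \<cdot> (P \<star> Id (D \<odot> (E \<odot> F)))) \<cdot> legR (A \<odot> B) D E F"
    unfolding fP using R P by simp
  also have "\<dots> = ((Id A \<star> (Id B \<star> act D E R F)) \<cdot> act A B P (D \<odot> (E \<odot> F))) \<cdot> ?U"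
    unfolding act_ass[OF P, symmetric] using R P by (simp add: legR_def)
  finally have 1: "?T = ((Id A \<star> (Id B \<star> act D E R F)) \<cdot> act A B P (D \<odot> (E \<odot> F))) \<cdot> ?U" .

  \<comment> \<open>The factor \<open>d\<close> allows \<open>fd\<close> to replace the two-edge
    side inside \<open>?T\<close> by the three-edge side; then \<open>fd'\<close>, \<open>fQ\<close>
    and \<open>fS\<close> apply in turn.\<close>
  have "scal d ?T = (Id A \<star> (Id B \<star> ass D E F)) \<cdot> (Id A \<star> ass B (D \<odot> E) F) \<cdot> ass A (B \<odot> (D \<odot> E)) F
    \<cdot> (scal d (legR A B D E) \<star> Id F)"
    by (simp add: legR_def whisker_comp)
  also have "\<dots> = (Id A \<star> (Id B \<star> ass D E F)) \<cdot> (Id A \<star> ass B (D \<odot> E) F)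
    \<cdot> (ass A (B \<odot> (D \<odot> E)) F \<cdot> ((Id A \<star> ass B D E) \<star> Id F)) \<cdot> (ass A (B \<odot> D) E \<star> Id F) \<cdot> ((ass A B D \<star> Id E) \<star> Id F)"
    unfolding fd[symmetric] by (simp add: legL_def whisker_comp)
  also have "ass A (B \<odot> (D \<odot> E)) F \<cdot> ((Id A \<star> ass B D E) \<star> Id F) = (Id A \<star> (ass B D E \<star> Id F)) \<cdot> ass A ((B \<odot> D) \<odot> E) F"
    by (intro ass_natural) simp_all
  also have "(Id A \<star> (Id B \<star> ass D E F)) \<cdot> (Id A \<star> ass B (D \<odot> E) F)
    \<cdot> ((Id A \<star> (ass B D E \<star> Id F)) \<cdot> ass A ((B \<odot> D) \<odot> E) F) \<cdot> (ass A (B \<odot> D) E \<star> Id F) \<cdot> ((ass A B D \<star> Id E) \<star> Id F)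
    = (Id A \<star> legL B D E F) \<cdot> ass A ((B \<odot> D) \<odot> E) F \<cdot> (ass A (B \<odot> D) E \<star> Id F) \<cdot> ((ass A B D \<star> Id E) \<star> Id F)"
    by (simp add: legL_def whisker_comp)
  also have "\<dots> = scal d' ((Id A \<star> ass B D (E \<odot> F)) \<cdot> legL A (B \<odot> D) E F \<cdot> ((ass A B D \<star> Id E) \<star> Id F))"
    unfolding fd' by (simp add: legL_def legR_def whisker_comp)
  also have "\<dots> = scal d' ((Id A \<star> (ass B D (E \<odot> F) \<cdot> (Q \<star> Id (E \<odot> F)))) \<cdot> ass A (B \<odot> D) (E \<odot> F)
      \<cdot> (ass (A \<odot> (B \<odot> D)) E F \<cdot> ((ass A B D \<star> Id E) \<star> Id F)))"
    unfolding fQ using Q by (simp add: legR_def whisker_comp)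
  also have "ass (A \<odot> (B \<odot> D)) E F \<cdot> ((ass A B D \<star> Id E) \<star> Id F) = (ass A B D \<star> Id (E \<odot> F)) \<cdot> ass ((A \<odot> B) \<odot> D) E F"
    using ass_natural[of "ass A B D" "Id E" "Id F"] by simp
  also have "(Id A \<star> (ass B D (E \<odot> F) \<cdot> (Q \<star> Id (E \<odot> F)))) \<cdot> ass A (B \<odot> D) (E \<odot> F)
      \<cdot> ((ass A B D \<star> Id (E \<odot> F)) \<cdot> ass ((A \<odot> B) \<odot> D) E F)
    = (Id A \<star> act B D Q (E \<odot> F)) \<cdot> legL A B D (E \<odot> F) \<cdot> ass ((A \<odot> B) \<odot> D) E F"
    unfolding act_ass[OF Q, symmetric] using Q by (simp add: legL_def whisker_comp)
  also have "\<dots> = ((Id A \<star> act B D Q (E \<odot> F)) \<cdot> (Id A \<star> (Id B \<star> (Id D \<star> S)))) \<cdot> ?U"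
    unfolding fS using Q S by (simp add: legR_def)
  finally have "scal d' ((Id A \<star> (act B D Q (E \<odot> F) \<cdot> (Id B \<star> (Id D \<star> S)))) \<cdot> ?U)
     = scal d (((Id A \<star> (Id B \<star> act D E R F)) \<cdot> act A B P (D \<odot> (E \<odot> F))) \<cdot> ?U)"
    unfolding 1 using Q S by (simp add: whisker_comp)
  then have "scal d' (Id A \<star> (act B D Q (E \<odot> F) \<cdot> (Id B \<star> (Id D \<star> S)))) \<cdot> ?U
    = scal d ((Id A \<star> (Id B \<star> act D E R F)) \<cdot> act A B P (D \<odot> (E \<odot> F))) \<cdot> ?U"
    using P Q R S by simp
  moreover have "iso ?U"
    by (intro iso_comp iso_ass) simp_all
  ultimately show ?thesis
    by (rule iso_epi[of ?U, rotated -1]) (use P Q R S in simp_all)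
qed

end

section \<open>Cocycle identities for all choices of summands\<close>

context projective_fusion
begin

lemma diag_const:
  assumes ij: "i \<in> I" "j \<in> I" and eq: "diag i j p = scal c (Id (X i \<odot> X j))" and p: "\<And>z. z \<in> I \<Longrightarrow> p z \<noteq> 0"
  shows "c \<noteq> 0"
  using ex_le[OF ij] diag_scalar[OF ij eq] p by blast

text \<open>Rigidity makes \<open>P\<close> a scalar, and cancelling \<open>X i\<close> then makes
  \<open>Q\<close> one. Neither eigenvalue depends on its summand any more, so \<open>z\<close> and
  \<open>w\<close> are independent.\<close>

lemma scalars_2:
  assumes I: "i \<in> I" "j \<in> I" "k \<in> I" and c: "c \<noteq> 0"
    and eq: "act (X i) (X j) (diag i j p) (X k) = scal c (Id (X i) \<star> diag j k q)"
    and z: "z \<in> I" "based_le I z (i * j)" and w: "w \<in> I" "based_le I w (j * k)"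
  shows "p z = c * q w"
proof -
  have q: "endo (diag j k q) (X j \<odot> X k)" using endo_diag I by simp
  have "act (X i) (X j) (diag i j p) (X k) = Id (X i) \<star> scal c (diag j k q)"
    using eq q by simp
  then obtain a where a: "diag i j p = scal a (Id (X i \<odot> X j))"
    using diag_rigid[OF I(1,2), of "X k" "scal c (diag j k q)" p] q I by auto
  have "Id (X i) \<star> scal a (Id (X j \<odot> X k)) = Id (X i) \<star> scal c (diag j k q)"
    using eq q by (simp add: a act_scal)
  then have "scal a (Id (X j \<odot> X k)) = scal c (diag j k q)"
    by (rule tens_faithful[OF I(1), rotated -1]) (use q in simp_all)
  then have "diag j k q = scal (a / c) (Id (X j \<odot> X k))"
    using c by (metis scal_eq_iff)
  from diag_scalar[OF I(2,3) this w] diag_scalar[OF I(1,2) a z] c show ?thesis by simp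
qed

lemma scalars_3:
  assumes I: "i \<in> I" "j \<in> I" "k \<in> I" "l \<in> I" and c: "c \<noteq> 0" and r: "\<And>z. z \<in> I \<Longrightarrow> r z \<noteq> 0"
    and p: "\<And>z. z \<in> I \<Longrightarrow> p z \<noteq> 0"
    and eq: "scal c (Id (X i) \<star> act (X j) (X k) (diag j k q) (X l))
      = (Id (X i) \<star> (Id (X j) \<star> diag k l r)) \<cdot> act (X i) (X j) (diag i j p) (X k \<odot> X l)"
    and z: "z \<in> I" "based_le I z (i * j)" and w: "w \<in> I" "based_le I w (j * k)" and v: "v \<in> I" "based_le I v (k * l)"
  shows "c * q w = r v * p z"
proof -
  let ?i = "X i" and ?j = "X j" and ?k = "X k" and ?l = "X l"
  let ?P = "diag i j p" and ?Q = "diag j k q" and ?R = "diag k l r"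
  let ?R' = "diag k l (\<lambda>v. 1 / r v)"
  have e [simp]: "endo ?P (?i \<odot> ?j)" "endo ?Q (?j \<odot> ?k)" "endo ?R (?k \<odot> ?l)" "endo ?R' (?k \<odot> ?l)"
    using endo_diag I by simp_all
  \<comment> \<open>Since \<open>r\<close> has no zeros, \<open>?R\<close> can be inverted. Moving
    it to the other side shows that \<open>?P\<close> acts as the identity on \<open>X i\<close>
    tensored with something.\<close>
  have "act ?i ?j ?P (?k \<odot> ?l) = (Id ?i \<star> (Id ?j \<star> (?R' \<cdot> ?R))) \<cdot> act ?i ?j ?P (?k \<odot> ?l)"
    using diag_inverse'[of k l r] r I by simp
  also have "\<dots> = (Id ?i \<star> (Id ?j \<star> ?R')) \<cdot> scal c (Id ?i \<star> act ?j ?k ?Q ?l)"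
    unfolding eq by (simp add: whisker_comp)
  also have "\<dots> = Id ?i \<star> scal c ((Id ?j \<star> ?R') \<cdot> act ?j ?k ?Q ?l)"
    by (simp add: whisker_comp)
  finally obtain a where a: "?P = scal a (Id (?i \<odot> ?j))"
    using diag_rigid[OF I(1,2), of "?k \<odot> ?l" "scal c ((Id ?j \<star> ?R') \<cdot> act ?j ?k ?Q ?l)" p] I by auto
  have a0: "a \<noteq> 0" using diag_const[OF I(1,2) a p] .
  have "Id ?i \<star> scal c (act ?j ?k ?Q ?l) = Id ?i \<star> scal a (Id ?j \<star> ?R)"
    using eq by (simp add: a act_scal)
  then have "scal c (act ?j ?k ?Q ?l) = scal a (Id ?j \<star> ?R)"
    by (rule tens_faithful[OF I(1), rotated -1]) simp_all
  then have "act ?j ?k ?Q ?l = scal (a / c) (Id ?j \<star> ?R)" using c by (simp add: scal_eq_iff)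
  from scalars_2[OF I(2,3,4) _ this w v] diag_scalar[OF I(1,2) a z] a0 c
  show ?thesis by simp
qed

lemma scalars_4:
  assumes I: "i \<in> I" "j \<in> I" "k \<in> I" "l \<in> I" "m \<in> I" and c: "c \<noteq> 0" "d \<noteq> 0"
    and p: "\<And>z. z \<in> I \<Longrightarrow> p z \<noteq> 0" and r: "\<And>z. z \<in> I \<Longrightarrow> r z \<noteq> 0" and s: "\<And>z. z \<in> I \<Longrightarrow> s z \<noteq> 0"
    and q: "\<And>z. z \<in> I \<Longrightarrow> q z \<noteq> 0"
    and eq: "scal c (Id (X i) \<star> (act (X j) (X k) (diag j k q) (X l \<odot> X m) \<cdot> (Id (X j) \<star> (Id (X k) \<star> diag l m s))))
      = scal d ((Id (X i) \<star> (Id (X j) \<star> act (X k) (X l) (diag k l r) (X m))) \<cdot> act (X i) (X j) (diag i j p) (X k \<odot> (X l \<odot> X m)))"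
    and z: "z \<in> I" "based_le I z (i * j)" and w: "w \<in> I" "based_le I w (j * k)"
    and v: "v \<in> I" "based_le I v (k * l)" and u: "u \<in> I" "based_le I u (l * m)"
  shows "c * q w * s u = d * r v * p z"
proof -
  let ?i = "X i" and ?j = "X j" and ?k = "X k" and ?l = "X l" and ?m = "X m"
  let ?P = "diag i j p" and ?Q = "diag j k q" and ?R = "diag k l r" and ?S = "diag l m s"
  let ?R' = "diag k l (\<lambda>v. 1 / r v)" and ?S' = "diag l m (\<lambda>v. 1 / s v)"
  have e [simp]: "endo ?P (?i \<odot> ?j)" "endo ?Q (?j \<odot> ?k)" "endo ?R (?k \<odot> ?l)" "endo ?R' (?k \<odot> ?l)"
    "endo ?S (?l \<odot> ?m)" "endo ?S' (?l \<odot> ?m)"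
    using endo_diag I by simp_all
  let ?q = "act ?j ?k ?Q (?l \<odot> ?m)" and ?r = "act ?k ?l ?R ?m" and ?r' = "act ?k ?l ?R' ?m"
  let ?W = "?q \<cdot> (Id ?j \<star> (Id ?k \<star> ?S))"
  have "?r' \<cdot> ?r = Id (?k \<odot> (?l \<odot> ?m))"
    using act_comp[of ?R ?k ?l ?R' ?m] diag_inverse'[of k l r] r I by simp
  \<comment> \<open>Of the four operators, only \<open>?P\<close> involves \<open>X i\<close>, so it
    is isolated first, by inverting the action of \<open>?R\<close>.\<close>
  then have "act ?i ?j ?P (?k \<odot> (?l \<odot> ?m)) = (Id ?i \<star> (Id ?j \<star> (?r' \<cdot> ?r))) \<cdot> act ?i ?j ?P (?k \<odot> (?l \<odot> ?m))"
    by simp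
  also have "\<dots> = (Id ?i \<star> (Id ?j \<star> ?r')) \<cdot> scal (1 / d) (scal d ((Id ?i \<star> (Id ?j \<star> ?r)) \<cdot> act ?i ?j ?P (?k \<odot> (?l \<odot> ?m))))"
    using c by (simp add: whisker_comp)
  also have "\<dots> = Id ?i \<star> scal (c / d) ((Id ?j \<star> ?r') \<cdot> ?W)"
    unfolding eq[symmetric] by (simp add: whisker_comp)
  finally obtain a where a: "?P = scal a (Id (?i \<odot> ?j))"
    using diag_rigid[OF I(1,2), of "?k \<odot> (?l \<odot> ?m)" "scal (c / d) ((Id ?j \<star> ?r') \<cdot> ?W)" p] I by auto
  have a0: "a \<noteq> 0" using diag_const[OF I(1,2) a p] .
  have "Id ?i \<star> scal c ?W = Id ?i \<star> scal (d * a) (Id ?j \<star> ?r)"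
    using eq by (simp add: a act_scal)
  then have "scal c ?W = scal (d * a) (Id ?j \<star> ?r)"
    by (rule tens_faithful[OF I(1), rotated -1]) simp_all
  then have W: "?W = scal (d * a / c) (Id ?j \<star> ?r)" using c by (simp add: scal_eq_iff)
  \<comment> \<open>With \<open>X i\<close> cancelled, \<open>?Q\<close> is the only operator
    involving the leftmost factor \<open>X j\<close>; inverting \<open>?S\<close> isolates it, and
    the remaining identity has the form treated by \<open>scalars_2\<close>.\<close>
  have "?q = ?q \<cdot> (Id ?j \<star> (Id ?k \<star> (?S \<cdot> ?S')))"
    using diag_inverse[of l m s] s I by simp
  also have "\<dots> = ?W \<cdot> (Id ?j \<star> (Id ?k \<star> ?S'))"
    by (simp add: whisker_comp)
  also have "\<dots> = Id ?j \<star> scal (d * a / c) (?r \<cdot> (Id ?k \<star> ?S'))"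
    unfolding W by (simp add: whisker_comp)
  finally obtain b where b: "?Q = scal b (Id (?j \<odot> ?k))"
    using diag_rigid[OF I(2,3), of "?l \<odot> ?m" "scal (d * a / c) (?r \<cdot> (Id ?k \<star> ?S'))" q] I by auto
  have b0: "b \<noteq> 0" using diag_const[OF I(2,3) b q] .
  have "Id ?j \<star> scal b (Id ?k \<star> ?S) = Id ?j \<star> scal (d * a / c) ?r"
    using W by (simp add: b act_scal)
  then have "scal b (Id ?k \<star> ?S) = scal (d * a / c) ?r"
    by (rule tens_faithful[OF I(2), rotated -1]) simp_all
  then have "?r = scal (b / (d * a / c)) (Id ?k \<star> ?S)"
    using c a0 by (metis scal_eq_iff divide_eq_0_iff mult_eq_0_iff)
  from scalars_2[OF I(3,4,5) _ this v u] diag_scalar[OF I(1,2) a z] diag_scalar[OF I(2,3) b w] a0 b0 c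
  show ?thesis by (simp add: field_simps)
qed

text \<open>The product of two labels is not a label, so any summands \<open>z\<close> and
  \<open>w\<close> take the places of \<open>i * j\<close> and \<open>j * k\<close>. By naturality,
  \<open>J\<close> with a product as one argument is a diagonal operator, and coherence of
  \<open>J\<close> says that two such operators agree up to the constant
  \<open>f j k / f i j\<close>.\<close>

lemma multivalued_2_cocycle:
  assumes f: "\<And>i j. i \<in> I \<Longrightarrow> j \<in> I \<Longrightarrow> f i j \<noteq> 0"
    and J: "\<And>i j. i \<in> I \<Longrightarrow> j \<in> I \<Longrightarrow> J (X i) (X j) = smult C (f i j) (idm C (X i \<odot> X j))"
    and J_Mor: "\<And>A B. J A B \<in> Mor C (A \<odot> B) (A \<odot> B)"
    and J_natural: "\<And>A A' B B' g h. g \<in> Mor C A A' \<Longrightarrow> h \<in> Mor C B B' \<Longrightarrow> J A' B' \<bullet> (g \<boxtimes> h) = (g \<boxtimes> h) \<bullet> J A B"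
    and J_coherent: "\<And>A B D. assoc C A B D \<bullet> J (A \<odot> B) D \<bullet> (J A B \<boxtimes> idm C D)
           = J A (B \<odot> D) \<bullet> (idm C A \<boxtimes> J B D) \<bullet> assoc C A B D"
    and I: "i \<in> I" "j \<in> I" "k \<in> I"
    and z: "z \<in> I" "based_le I z (i * j)" and w: "w \<in> I" "based_le I w (j * k)"
  shows "f j k * f i w = f z k * f i j"
proof -
  define K where "K A B = Arrow (A \<odot> B) (J A B) (A \<odot> B)" for A B
  have K [simp]: "endo (K A B) (A \<odot> B)" "mor (K A B) = J A B" for A B
    using J_Mor by (simp_all add: K_def arr_def)
  have K_simple: "K (X a) (X b) = scal (f a b) (Id (X a \<odot> X b))" if "a \<in> I" "b \<in> I" for a b
    using J[OF that] by (simp add: arrow_eq_iff)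
  have K_natural: "K A' B' \<cdot> (g \<star> h) = (g \<star> h) \<cdot> K A B"
    if "arr g" "arr h" "src g = A" "tgt g = A'" "src h = B" "tgt h = B'" for A A' B B' g h
    using that J_natural by (auto simp: arrow_eq_iff arr_def)
  have K_coherent: "ass A B D \<cdot> K (A \<odot> B) D \<cdot> (K A B \<star> Id D) = K A (B \<odot> D) \<cdot> (Id A \<star> K B D) \<cdot> ass A B D" for A B D
    using J_coherent by (simp add: arrow_eq_iff)
  let ?P = "diag i j (\<lambda>z. f z k)" and ?Q = "diag j k (\<lambda>w. f i w)"
  note ij = I(1,2) and jk = I(2,3)
  note [simp] = endo_diag[OF ij] endo_diag[OF jk]
  \<comment> \<open>\<open>J\<close> is an endomorphism, so the reference arrow in
    \<open>covers_twist\<close> is an identity.\<close>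
  have P: "K (X i \<odot> X j) (X k) = (?P \<star> Id (X k)) \<cdot> Id ((X i \<odot> X j) \<odot> X k)"
  proof (rule covers_twist[OF covers_tens(1)[OF incl(1)[OF ij]]])
    fix q assume q: "q < length (summands i j)"
    note q' [simp] = incl(2-4)[OF ij q] summands(2)[OF ij q] I diag_incl[OF ij q]
    show "arr (incl i j q \<star> Id (X k)) \<and> tgt (incl i j q \<star> Id (X k)) = tgt (K (X i \<odot> X j) (X k))" by simp
    show "K (X i \<odot> X j) (X k) \<cdot> (incl i j q \<star> Id (X k)) = (incl i j q \<star> Id (X k)) \<cdot> scal (f (summands i j ! q) k) (Id (X (summands i j ! q) \<odot> X k))"
      by (simp add: K_natural[of "incl i j q" "Id (X k)"] K_simple)
    show "arr (Id (X (summands i j ! q) \<odot> X k)) \<and> tgt (Id (X (summands i j ! q) \<odot> X k)) = src (incl i j q \<star> Id (X k))" by simp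
    show "Id ((X i \<odot> X j) \<odot> X k) \<cdot> (incl i j q \<star> Id (X k)) = (incl i j q \<star> Id (X k)) \<cdot> Id (X (summands i j ! q) \<odot> X k)"
      by simp
    show "(?P \<star> Id (X k)) \<cdot> (incl i j q \<star> Id (X k)) = scal (f (summands i j ! q) k) (incl i j q \<star> Id (X k))"
      by (simp flip: whisker_comp)
  qed simp_all
  have Q: "K (X i) (X j \<odot> X k) = (Id (X i) \<star> ?Q) \<cdot> Id (X i \<odot> (X j \<odot> X k))"
  proof (rule covers_twist[OF covers_tens(2)[OF incl(1)[OF jk]]])
    fix q assume q: "q < length (summands j k)"
    let ?g = "Id (X i) \<star> incl j k q"
    note q' [simp] = incl(2-4)[OF jk q] summands(2)[OF jk q] I diag_incl[OF jk q]
    show "arr ?g \<and> tgt ?g = tgt (K (X i) (X j \<odot> X k))" by simp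
    show "K (X i) (X j \<odot> X k) \<cdot> ?g = ?g \<cdot> scal (f i (summands j k ! q)) (Id (X i \<odot> X (summands j k ! q)))"
      by (simp add: K_natural[of "Id (X i)" "incl j k q"] K_simple)
    show "arr (Id (X i \<odot> X (summands j k ! q))) \<and> tgt (Id (X i \<odot> X (summands j k ! q))) = src ?g" by simp
    show "Id (X i \<odot> (X j \<odot> X k)) \<cdot> ?g = ?g \<cdot> Id (X i \<odot> X (summands j k ! q))"
      by simp
    show "(Id (X i) \<star> ?Q) \<cdot> ?g = scal (f i (summands j k ! q)) ?g"
      by (simp flip: whisker_comp)
  qed simp_all
  have "scal (f i j) (ass (X i) (X j) (X k) \<cdot> (?P \<star> Id (X k))) = scal (f j k) ((Id (X i) \<star> ?Q) \<cdot> ass (X i) (X j) (X k))"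
    using K_coherent[of "X i" "X j" "X k"] by (simp add: P Q K_simple I)
  then have "ass (X i) (X j) (X k) \<cdot> (?P \<star> Id (X k)) = scal (f j k / f i j) ((Id (X i) \<star> ?Q) \<cdot> ass (X i) (X j) (X k))"
    using f[OF ij] by (simp add: scal_eq_iff)
  then have "act (X i) (X j) ?P (X k) = scal (f j k / f i j) (Id (X i) \<star> ?Q)"
    by (intro act_eqI) simp_all
  from scalars_2[OF I _ this z w] f[OF ij] f[OF jk] show ?thesis by (simp add: field_simps)
qed

text \<open>Now the reference arrow is the original associator: with one composite argument, the new
  associator is the old one followed by a diagonal operator. Comparing the two pentagons gives the
  equation for \<open>scalars_3\<close>.\<close>

lemma multivalued_3_cocycle:
  assumes f: "\<And>i j k. i \<in> I \<Longrightarrow> j \<in> I \<Longrightarrow> k \<in> I \<Longrightarrow> f i j k \<noteq> 0"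
    and a: "\<And>i j k. i \<in> I \<Longrightarrow> j \<in> I \<Longrightarrow> k \<in> I \<Longrightarrow> a (X i) (X j) (X k) = smult C (f i j k) (assoc C (X i) (X j) (X k))"
    and a_Mor: "\<And>A B D. a A B D \<in> Mor C ((A \<odot> B) \<odot> D) (A \<odot> (B \<odot> D))"
    and a_natural: "\<And>A A' B B' D D' g h e. g \<in> Mor C A A' \<Longrightarrow> h \<in> Mor C B B' \<Longrightarrow> e \<in> Mor C D D'
           \<Longrightarrow> a A' B' D' \<bullet> ((g \<boxtimes> h) \<boxtimes> e) = (g \<boxtimes> (h \<boxtimes> e)) \<bullet> a A B D"
    and a_pentagon: "\<And>A B D E. pentagon_at C a 1 A B D E"
    and pentagon: "\<And>A B D E. pentagon_at C (assoc C) 1 A B D E"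
    and I: "i \<in> I" "j \<in> I" "k \<in> I" "l \<in> I"
    and z: "z \<in> I" "based_le I z (i * j)" and w: "w \<in> I" "based_le I w (j * k)" and v: "v \<in> I" "based_le I v (k * l)"
  shows "f j k l * f i w l * f i j k = f z k l * f i j v"
proof -
  define K where "K A B D = Arrow ((A \<odot> B) \<odot> D) (a A B D) (A \<odot> (B \<odot> D))" for A B D
  have K [simp]: "arr (K A B D)" "src (K A B D) = (A \<odot> B) \<odot> D" "tgt (K A B D) = A \<odot> (B \<odot> D)" "mor (K A B D) = a A B D" for A B D
    using a_Mor by (simp_all add: K_def arr_def)
  have K_simple: "K (X x) (X y) (X u) = scal (f x y u) (ass (X x) (X y) (X u))" if "x \<in> I" "y \<in> I" "u \<in> I" for x y u
    using a[OF that] by (simp add: arrow_eq_iff)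
  have K_natural: "K A' B' D' \<cdot> ((g \<star> h) \<star> e) = (g \<star> (h \<star> e)) \<cdot> K A B D"
    if "arr g" "arr h" "arr e" "src g = A" "tgt g = A'" "src h = B" "tgt h = B'" "src e = D" "tgt e = D'"
    for A A' B B' D D' g h e
    using that a_natural by (auto simp: arrow_eq_iff arr_def)
  have K_pentagon: "(Id A \<star> K B D E) \<cdot> K A (B \<odot> D) E \<cdot> (K A B D \<star> Id E) = K A B (D \<odot> E) \<cdot> K (A \<odot> B) D E" for A B D E
    using a_pentagon[of A B D E] by (simp add: arrow_eq_iff pentagon_at_def)
  let ?P = "diag i j (\<lambda>z. f z k l)" and ?Q = "diag j k (\<lambda>w. f i w l)" and ?R = "diag k l (\<lambda>v. f i j v)"
  note ij = I(1,2) and jk = I(2,3) and kl = I(3,4)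
  note [simp] = endo_diag[OF ij] endo_diag[OF jk] endo_diag[OF kl]
  have P: "K (X i \<odot> X j) (X k) (X l) = (?P \<star> Id (X k \<odot> X l)) \<cdot> ass (X i \<odot> X j) (X k) (X l)"
  proof (rule covers_twist[OF covers_tens(1)[OF covers_tens(1)[OF incl(1)[OF ij]]]])
    fix q assume q: "q < length (summands i j)"
    let ?x = "summands i j ! q"
    let ?g = "(incl i j q \<star> Id (X k)) \<star> Id (X l)" and ?h = "incl i j q \<star> Id (X k \<odot> X l)"
    note [simp] = incl(2-4)[OF ij q] summands(2)[OF ij q] I diag_incl[OF ij q]
    show "arr ?h \<and> tgt ?h = tgt (K (X i \<odot> X j) (X k) (X l))" by simp
    show "K (X i \<odot> X j) (X k) (X l) \<cdot> ?g = ?h \<cdot> scal (f ?x k l) (ass (X ?x) (X k) (X l))"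
      by (simp add: K_natural[of "incl i j q" "Id (X k)" "Id (X l)"] K_simple)
    show "arr (ass (X ?x) (X k) (X l)) \<and> tgt (ass (X ?x) (X k) (X l)) = src ?h" by simp
    show "ass (X i \<odot> X j) (X k) (X l) \<cdot> ?g = ?h \<cdot> ass (X ?x) (X k) (X l)"
      by (simp add: ass_natural[of "incl i j q" "Id (X k)" "Id (X l)"])
    show "(?P \<star> Id (X k \<odot> X l)) \<cdot> ?h = scal (f ?x k l) ?h"
      by (simp flip: whisker_comp)
  qed simp_all
  have Q: "K (X i) (X j \<odot> X k) (X l) = (Id (X i) \<star> (?Q \<star> Id (X l))) \<cdot> ass (X i) (X j \<odot> X k) (X l)"
  proof (rule covers_twist[OF covers_tens(1)[OF covers_tens(2)[OF incl(1)[OF jk]]]])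
    fix q assume q: "q < length (summands j k)"
    let ?x = "summands j k ! q"
    let ?g = "(Id (X i) \<star> incl j k q) \<star> Id (X l)" and ?h = "Id (X i) \<star> (incl j k q \<star> Id (X l))"
    note [simp] = incl(2-4)[OF jk q] summands(2)[OF jk q] I diag_incl[OF jk q]
    show "arr ?h \<and> tgt ?h = tgt (K (X i) (X j \<odot> X k) (X l))" by simp
    show "K (X i) (X j \<odot> X k) (X l) \<cdot> ?g = ?h \<cdot> scal (f i ?x l) (ass (X i) (X ?x) (X l))"
      by (simp add: K_natural[of "Id (X i)" "incl j k q" "Id (X l)"] K_simple)
    show "arr (ass (X i) (X ?x) (X l)) \<and> tgt (ass (X i) (X ?x) (X l)) = src ?h" by simp
    show "ass (X i) (X j \<odot> X k) (X l) \<cdot> ?g = ?h \<cdot> ass (X i) (X ?x) (X l)"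
      by (simp add: ass_natural[of "Id (X i)" "incl j k q" "Id (X l)"])
    show "(Id (X i) \<star> (?Q \<star> Id (X l))) \<cdot> ?h = scal (f i ?x l) ?h"
      by (simp flip: whisker_comp)
  qed simp_all
  have R: "K (X i) (X j) (X k \<odot> X l) = (Id (X i) \<star> (Id (X j) \<star> ?R)) \<cdot> ass (X i) (X j) (X k \<odot> X l)"
  proof (rule covers_twist[OF covers_tens(2)[OF incl(1)[OF kl]]])
    fix q assume q: "q < length (summands k l)"
    let ?x = "summands k l ! q"
    let ?g = "Id (X i \<odot> X j) \<star> incl k l q" and ?h = "Id (X i) \<star> (Id (X j) \<star> incl k l q)"
    note [simp] = incl(2-4)[OF kl q] summands(2)[OF kl q] I diag_incl[OF kl q]
    show "arr ?h \<and> tgt ?h = tgt (K (X i) (X j) (X k \<odot> X l))" by simp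
    show "K (X i) (X j) (X k \<odot> X l) \<cdot> ?g = ?h \<cdot> scal (f i j ?x) (ass (X i) (X j) (X ?x))"
      using K_natural[of "Id (X i)" "Id (X j)" "incl k l q"] by (simp add: K_simple)
    show "arr (ass (X i) (X j) (X ?x)) \<and> tgt (ass (X i) (X j) (X ?x)) = src ?h" by simp
    show "ass (X i) (X j) (X k \<odot> X l) \<cdot> ?g = ?h \<cdot> ass (X i) (X j) (X ?x)"
      using ass_natural[of "Id (X i)" "Id (X j)" "incl k l q"] by simp
    show "(Id (X i) \<star> (Id (X j) \<star> ?R)) \<cdot> ?h = scal (f i j ?x) ?h"
      by (simp flip: whisker_comp)
  qed simp_all
  have "scal (f j k l * f i j k) (Id (X i) \<star> act (X j) (X k) ?Q (X l)) = (Id (X i) \<star> (Id (X j) \<star> ?R)) \<cdot> act (X i) (X j) ?P (X k \<odot> X l)"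
  proof (rule twisted_pentagon)
    show "legL (X i) (X j) (X k) (X l) = legR (X i) (X j) (X k) (X l)"
      using pentagon[of "X i" "X j" "X k" "X l"] by (simp add: pentagon_iff)
    show "(Id (X i) \<star> scal (f j k l) (ass (X j) (X k) (X l))) \<cdot> ((Id (X i) \<star> (?Q \<star> Id (X l))) \<cdot> ass (X i) (X j \<odot> X k) (X l)) \<cdot> (scal (f i j k) (ass (X i) (X j) (X k)) \<star> Id (X l))
      = ((Id (X i) \<star> (Id (X j) \<star> ?R)) \<cdot> ass (X i) (X j) (X k \<odot> X l)) \<cdot> ((?P \<star> Id (X k \<odot> X l)) \<cdot> ass (X i \<odot> X j) (X k) (X l))"
      using K_pentagon[of "X i" "X j" "X k" "X l"] by (simp only: P Q R K_simple I)
  qed simp_all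
  from scalars_3[OF I _ _ _ this z w v] f I show ?thesis by (simp add: field_simps)
qed

text \<open>The scalars now measure the failure of the pentagon itself, so \<open>legL\<close> is
  compared with \<open>legR\<close>. Both are natural in all four arguments, hence with one
  composite argument they differ by a diagonal operator.\<close>

lemma multivalued_4_cocycle:
  assumes f: "\<And>i j k l. i \<in> I \<Longrightarrow> j \<in> I \<Longrightarrow> k \<in> I \<Longrightarrow> l \<in> I \<Longrightarrow> f i j k l \<noteq> 0"
    and pentagon: "\<And>i j k l. i \<in> I \<Longrightarrow> j \<in> I \<Longrightarrow> k \<in> I \<Longrightarrow> l \<in> I
      \<Longrightarrow> pentagon_at C (assoc C) (f i j k l) (X i) (X j) (X k) (X l)"
    and I: "i \<in> I" "j \<in> I" "k \<in> I" "l \<in> I" "m \<in> I"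
    and z: "z \<in> I" "based_le I z (i * j)" and w: "w \<in> I" "based_le I w (j * k)"
    and v: "v \<in> I" "based_le I v (k * l)" and u: "u \<in> I" "based_le I u (l * m)"
  shows "f j k l m * f i w l m * f i j k u = f z k l m * f i j v m * f i j k l"
proof -
  have L: "legL (X x) (X y) (X x') (X y') = scal (f x y x' y') (legR (X x) (X y) (X x') (X y'))"
    if "x \<in> I" "y \<in> I" "x' \<in> I" "y' \<in> I" for x y x' y'
    using pentagon[OF that] by (simp add: pentagon_iff)
  let ?P = "diag i j (\<lambda>z. f z k l m)" and ?Q = "diag j k (\<lambda>w. f i w l m)" and ?R = "diag k l (\<lambda>v. f i j v m)"
    and ?S = "diag l m (\<lambda>u. f i j k u)"
  note ij = I(1,2) and jk = I(2,3) and kl = I(3,4) and lm = I(4,5)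
  note [simp] = endo_diag[OF ij] endo_diag[OF jk] endo_diag[OF kl] endo_diag[OF lm]
  have P: "legL (X i \<odot> X j) (X k) (X l) (X m) = (?P \<star> Id (X k \<odot> (X l \<odot> X m))) \<cdot> legR (X i \<odot> X j) (X k) (X l) (X m)"
  proof (rule covers_twist[OF covers_tens(1)[OF covers_tens(1)[OF covers_tens(1)[OF incl(1)[OF ij]]]]])
    fix q assume q: "q < length (summands i j)"
    let ?x = "summands i j ! q"
    let ?g = "((incl i j q \<star> Id (X k)) \<star> Id (X l)) \<star> Id (X m)" and ?h = "incl i j q \<star> Id (X k \<odot> (X l \<odot> X m))"
    note [simp] = incl(2-4)[OF ij q] summands(2)[OF ij q] I diag_incl[OF ij q]
    note n = leg_natural[of "incl i j q" "Id (X k)" "Id (X l)" "Id (X m)"]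
    show "arr ?h \<and> tgt ?h = tgt (legL (X i \<odot> X j) (X k) (X l) (X m))" by simp
    show "legL (X i \<odot> X j) (X k) (X l) (X m) \<cdot> ?g = ?h \<cdot> scal (f ?x k l m) (legR (X ?x) (X k) (X l) (X m))"
      using n(1) by (simp add: L)
    show "arr (legR (X ?x) (X k) (X l) (X m)) \<and> tgt (legR (X ?x) (X k) (X l) (X m)) = src ?h" by simp
    show "legR (X i \<odot> X j) (X k) (X l) (X m) \<cdot> ?g = ?h \<cdot> legR (X ?x) (X k) (X l) (X m)"
      using n(2) by simp
    show "(?P \<star> Id (X k \<odot> (X l \<odot> X m))) \<cdot> ?h = scal (f ?x k l m) ?h"
      by (simp flip: whisker_comp)
  qed simp_all
  have Q: "legL (X i) (X j \<odot> X k) (X l) (X m) = (Id (X i) \<star> (?Q \<star> Id (X l \<odot> X m))) \<cdot> legR (X i) (X j \<odot> X k) (X l) (X m)"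
  proof (rule covers_twist[OF covers_tens(1)[OF covers_tens(1)[OF covers_tens(2)[OF incl(1)[OF jk]]]]])
    fix q assume q: "q < length (summands j k)"
    let ?x = "summands j k ! q"
    let ?g = "((Id (X i) \<star> incl j k q) \<star> Id (X l)) \<star> Id (X m)" and ?h = "Id (X i) \<star> (incl j k q \<star> Id (X l \<odot> X m))"
    note [simp] = incl(2-4)[OF jk q] summands(2)[OF jk q] I diag_incl[OF jk q]
    note n = leg_natural[of "Id (X i)" "incl j k q" "Id (X l)" "Id (X m)"]
    show "arr ?h \<and> tgt ?h = tgt (legL (X i) (X j \<odot> X k) (X l) (X m))" by simp
    show "legL (X i) (X j \<odot> X k) (X l) (X m) \<cdot> ?g = ?h \<cdot> scal (f i ?x l m) (legR (X i) (X ?x) (X l) (X m))"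
      using n(1) by (simp add: L)
    show "arr (legR (X i) (X ?x) (X l) (X m)) \<and> tgt (legR (X i) (X ?x) (X l) (X m)) = src ?h" by simp
    show "legR (X i) (X j \<odot> X k) (X l) (X m) \<cdot> ?g = ?h \<cdot> legR (X i) (X ?x) (X l) (X m)"
      using n(2) by simp
    show "(Id (X i) \<star> (?Q \<star> Id (X l \<odot> X m))) \<cdot> ?h = scal (f i ?x l m) ?h"
      by (simp flip: whisker_comp)
  qed simp_all
  have R: "legL (X i) (X j) (X k \<odot> X l) (X m) = (Id (X i) \<star> (Id (X j) \<star> (?R \<star> Id (X m)))) \<cdot> legR (X i) (X j) (X k \<odot> X l) (X m)"
  proof (rule covers_twist[OF covers_tens(1)[OF covers_tens(2)[OF incl(1)[OF kl]]]])
    fix q assume q: "q < length (summands k l)"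
    let ?x = "summands k l ! q"
    let ?g = "(Id (X i \<odot> X j) \<star> incl k l q) \<star> Id (X m)" and ?h = "Id (X i) \<star> (Id (X j) \<star> (incl k l q \<star> Id (X m)))"
    note [simp] = incl(2-4)[OF kl q] summands(2)[OF kl q] I diag_incl[OF kl q]
    note n = leg_natural[of "Id (X i)" "Id (X j)" "incl k l q" "Id (X m)"]
    show "arr ?h \<and> tgt ?h = tgt (legL (X i) (X j) (X k \<odot> X l) (X m))" by simp
    show "legL (X i) (X j) (X k \<odot> X l) (X m) \<cdot> ?g = ?h \<cdot> scal (f i j ?x m) (legR (X i) (X j) (X ?x) (X m))"
      using n(1) by (simp add: L)
    show "arr (legR (X i) (X j) (X ?x) (X m)) \<and> tgt (legR (X i) (X j) (X ?x) (X m)) = src ?h" by simp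
    show "legR (X i) (X j) (X k \<odot> X l) (X m) \<cdot> ?g = ?h \<cdot> legR (X i) (X j) (X ?x) (X m)"
      using n(2) by simp
    show "(Id (X i) \<star> (Id (X j) \<star> (?R \<star> Id (X m)))) \<cdot> ?h = scal (f i j ?x m) ?h"
      by (simp flip: whisker_comp)
  qed simp_all
  have S: "legL (X i) (X j) (X k) (X l \<odot> X m) = (Id (X i) \<star> (Id (X j) \<star> (Id (X k) \<star> ?S))) \<cdot> legR (X i) (X j) (X k) (X l \<odot> X m)"
  proof (rule covers_twist[OF covers_tens(2)[OF incl(1)[OF lm]]])
    fix q assume q: "q < length (summands l m)"
    let ?x = "summands l m ! q"
    let ?g = "Id ((X i \<odot> X j) \<odot> X k) \<star> incl l m q" and ?h = "Id (X i) \<star> (Id (X j) \<star> (Id (X k) \<star> incl l m q))"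
    note [simp] = incl(2-4)[OF lm q] summands(2)[OF lm q] I diag_incl[OF lm q]
    note n = leg_natural[of "Id (X i)" "Id (X j)" "Id (X k)" "incl l m q"]
    show "arr ?h \<and> tgt ?h = tgt (legL (X i) (X j) (X k) (X l \<odot> X m))" by simp
    show "legL (X i) (X j) (X k) (X l \<odot> X m) \<cdot> ?g = ?h \<cdot> scal (f i j k ?x) (legR (X i) (X j) (X k) (X ?x))"
      using n(1) by (simp add: L)
    show "arr (legR (X i) (X j) (X k) (X ?x)) \<and> tgt (legR (X i) (X j) (X k) (X ?x)) = src ?h" by simp
    show "legR (X i) (X j) (X k) (X l \<odot> X m) \<cdot> ?g = ?h \<cdot> legR (X i) (X j) (X k) (X ?x)"
      using n(2) by simp
    show "(Id (X i) \<star> (Id (X j) \<star> (Id (X k) \<star> ?S))) \<cdot> ?h = scal (f i j k ?x) ?h"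
      by (simp flip: whisker_comp)
  qed simp_all
  \<comment> \<open>The two faces without a composite object supply the constants
    \<open>f i j k l\<close> and \<open>f j k l m\<close>; the other four supply the
    operators.\<close>
  from scalars_4[OF I _ _ _ _ _ _ twisted_associahedron[OF _ _ _ _ P Q R S L L] z w v u] f I
  show ?thesis by (simp add: field_simps)
qed

end

section \<open>Descent to the grading group\<close>

context based_ring
begin

lemma coeff_sum: "coeff_in I (\<Sum>a\<in>A. f a) k = (\<Sum>a\<in>A. coeff_in I (f a) k)"
  by (induction A rule: infinite_finite_induct) (simp_all add: coeff_add coeff_zero)

text \<open>Expanding \<open>a\<close> in the basis makes the coefficient of \<open>x\<close> in
  \<open>a * u\<close> a sum over the summands of \<open>a\<close>, and one of its terms is nonzero.
  This is how a word is shortened by its last letter.\<close>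

lemma le_mult_factor:
  assumes a: "pos a" and u: "u \<in> I" and x: "x \<in> I" "based_le I x (a * u)"
  shows "\<exists>y\<in>I. based_le I y a \<and> based_le I x (y * u)"
proof -
  have "a * u = (\<Sum>b | coeff_in I a b \<noteq> 0. zscale (coeff_in I a b) b) * u"
    using expand[of a] by simp
  also have "\<dots> = (\<Sum>b | coeff_in I a b \<noteq> 0. zscale (coeff_in I a b) (b * u))"
    by (simp add: sum_distrib_right zscale_def mult.assoc)
  finally have "coeff_in I (a * u) x = (\<Sum>b | coeff_in I a b \<noteq> 0. coeff_in I a b * coeff_in I (b * u) x)"
    by (simp add: coeff_sum coeff_zscale)
  moreover have "coeff_in I (a * u) x \<noteq> 0"
    using x a u le_iff pos_mult pos_basis by blast
  ultimately obtain b where b: "coeff_in I a b \<noteq> 0" "coeff_in I (b * u) x \<noteq> 0"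
    by (metis (mono_tags, lifting) mem_Collect_eq mult_zero_right sum.not_neutral_contains_not_neutral)
  then have "b \<in> I" using in_basis by blast
  then show ?thesis
    using b a u x le_iff pos_mult pos_basis by blast
qed

lemma le_basis: "x \<in> I \<Longrightarrow> u \<in> I \<Longrightarrow> based_le I x u \<Longrightarrow> x = u"
  using le_iff[of x u] coeff_basis[of u x] pos_basis by (auto split: if_splits)

definition rep :: "'r set \<Rightarrow> 'r" where
  "rep D = (SOME x. x \<in> I \<and> deg I x = D)"

lemma rep: "D \<in> carrier (grading_group I) \<Longrightarrow> rep D \<in> I \<and> deg I (rep D) = D"
  unfolding rep_def by (rule someI_ex) (use carrier_iff in auto)

definition summand where
  "summand x y = (SOME z. z \<in> I \<and> based_le I z (x * y))"

lemma summand: "x \<in> I \<Longrightarrow> y \<in> I \<Longrightarrow> summand x y \<in> I \<and> based_le I (summand x y) (x * y)"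
  unfolding summand_def by (rule someI_ex) (use ex_le in blast)

text \<open>Independence of the entry at position \<open>m\<close> follows from that at position \<open>m - 1\<close> by solving the
  cocycle identity for the factor with \<open>j = m\<close>.\<close>

context
  fixes f :: "'r list \<Rightarrow> 'k::field" and n :: nat
  assumes nonzero: "\<And>xs. length xs = n \<Longrightarrow> set xs \<subseteq> I \<Longrightarrow> f xs \<noteq> 0"
    and multivalued_cocycle: "\<And>xs z. length xs = Suc n \<Longrightarrow> set xs \<subseteq> I
      \<Longrightarrow> (\<And>j. j < n \<Longrightarrow> z j \<in> I \<and> based_le I (z j) (xs ! j * xs ! Suc j))
      \<Longrightarrow> f (tl xs) * (\<Prod>j<n. f (take j xs @ z j # drop (j + 2) xs) powi ((-1) ^ Suc j))
            * f (butlast xs) powi ((-1) ^ Suc n) = 1"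
begin

text \<open>For a word ending in \<open>u\<close>, split \<open>x\<close> off \<open>x' * u\<close>
  and \<open>y\<close> off \<open>y' * u\<close> with \<open>x'\<close> and \<open>y'\<close> below
  the shorter word. The identities for \<open>as, x', u, bs\<close> with summand \<open>x\<close>
  and for \<open>as, y', u, bs\<close> with summand \<open>y\<close> then agree in all other
  factors. Writing \<open>m = Suc m'\<close> in \<open>prev\<close> makes it vacuous at the first
  position, so one lemma covers both the base and the step of the induction on positions.\<close>

lemma degree_invariance_step:
  assumes prev: "\<And>m' as bs x y. m = Suc m' \<Longrightarrow> length as = m' \<Longrightarrow> length bs = n - m \<Longrightarrow> set as \<subseteq> I \<Longrightarrow> set bs \<subseteq> I
      \<Longrightarrow> x \<in> I \<Longrightarrow> y \<in> I \<Longrightarrow> deg I x = deg I y \<Longrightarrow> f (as @ x # bs) = f (as @ y # bs)"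
    and "us \<noteq> []" "set us \<subseteq> I" "m < n" "length as = m" "length bs = n - Suc m" "set as \<subseteq> I" "set bs \<subseteq> I"
    and "x \<in> I" "y \<in> I" "based_le I x (prod_list us)" "based_le I y (prod_list us)"
  shows "f (as @ x # bs) = f (as @ y # bs)"
  using assms(2-)
proof (induction us arbitrary: as bs x y rule: rev_nonempty_induct)
  case (single u)
  then have "x = u" "y = u" using le_basis by auto
  then show ?case by simp
next
  case (snoc u us)
  have u: "u \<in> I" "set us \<subseteq> I" using snoc.prems by auto
  obtain x' where x': "x' \<in> I" "based_le I x' (prod_list us)" "based_le I x (x' * u)"
    using le_mult_factor[of "prod_list us" u x] pos_prod[OF u(2)] u snoc.prems by auto
  obtain y' where y': "y' \<in> I" "based_le I y' (prod_list us)" "based_le I y (y' * u)"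
    using le_mult_factor[of "prod_list us" u y] pos_prod[OF u(2)] u snoc.prems by auto
  have deg': "deg I x' = deg I y'"
    using relI[OF x'(1) y'(1) snoc.hyps(1) u(2) x'(2) y'(2)] deg_eq x' y' by blast
  define L where "L t = as @ t # u # bs" for t
  \<comment> \<open>Away from position \<open>m\<close> the summands come from one choice function,
    so the two lists get the same summand wherever they have the same neighbours.\<close>
  define z where "z t s j = (if j = m then s else summand (L t ! j) (L t ! Suc j))" for t s j
  define T where "T t s j = take j (L t) @ z t s j # drop (j + 2) (L t)" for t s j
  have len: "length (L t) = Suc n" for t using snoc.prems by (simp add: L_def)
  have setL: "set (L t) \<subseteq> I" if "t \<in> I" for t using snoc.prems u that by (auto simp: L_def)
  have inL: "L t ! j \<in> I" if "t \<in> I" "j \<le> n" for t j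
    using setL[OF that(1)] len[of t] that(2) by (metis le_imp_less_Suc nth_mem subsetD)
  have Lm: "L t ! m = t" "L t ! Suc m = u" for t
    using snoc.prems by (simp_all add: L_def nth_append)
  have zI: "z t s j \<in> I \<and> based_le I (z t s j) (L t ! j * L t ! Suc j)"
    if "t \<in> I" "s \<in> I" "based_le I s (t * u)" "j < n" for t s j
    using that summand inL[OF that(1)] by (auto simp: z_def Lm)
  have cocycle: "f (tl (L t)) * (\<Prod>j<n. f (T t s j) powi ((-1) ^ Suc j)) * f (butlast (L t)) powi ((-1) ^ Suc n) = 1"
    if "t \<in> I" "s \<in> I" "based_le I s (t * u)" for t s
    unfolding T_def using zI[OF that] by (intro multivalued_cocycle len setL that) auto
  have inner: "f (as @ x' # cs) = f (as @ y' # cs)" if "length cs = n - Suc m" "set cs \<subseteq> I" for cs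
    using snoc.IH[OF u(2) snoc.prems(2,3) that(1) snoc.prems(5) that(2) x'(1) y'(1) x'(2) y'(2)] .
  \<comment> \<open>Removing the head shifts the changed entry to position \<open>m - 1\<close>; for
    \<open>m = 0\<close> the changed entry is what is removed.\<close>
  have tl_eq: "f (tl (L x')) = f (tl (L y'))"
  proof (cases m)
    case 0
    then show ?thesis using snoc.prems by (simp add: L_def)
  next
    case (Suc m')
    then obtain a as' where "as = a # as'" using snoc.prems by (cases as) auto
    then show ?thesis
      using prev[OF Suc, of as' "u # bs" x' y'] snoc.prems u x' y' deg' Suc by (auto simp: L_def)
  qed
  have butlast_eq: "f (butlast (L x')) = f (butlast (L y'))"
  proof -
    have "butlast (L t) = as @ t # butlast (u # bs)" for t
      by (simp add: L_def butlast_append)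
    moreover have "set (butlast (u # bs)) \<subseteq> I"
      using snoc.prems(6) u(1) by (auto dest!: in_set_butlastD split: if_splits)
    moreover have "length (butlast (u # bs)) = n - Suc m"
      unfolding length_butlast using snoc.prems(4) by simp
    ultimately show ?thesis using inner by metis
  qed
  have T_eq: "f (T x' x j) = f (T y' y j)" if j: "j < n" "j \<noteq> m" for j
  proof -
    have zI': "z x' x j \<in> I" "z y' y j \<in> I"
      using zI[of x' x j] zI[of y' y j] snoc.prems x' y' j by auto
    \<comment> \<open>If the merged pair lies to the right, the changed entry stays at position
      \<open>m\<close> and the shorter word applies. If the pair ends with the changed entry, or
      lies to its left, the change occurs at position \<open>m - 1\<close>; in the former case the
      merged entries have equal degree by \<open>mult_deg\<close>.\<close>
    consider "Suc m \<le> j" | "Suc j = m" | "Suc (Suc j) \<le> m" using j by linarith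
    then show ?thesis
    proof cases
      case 1
      then obtain r where r: "j = m + Suc r" by (metis add_Suc_right le_iff_add add_Suc)
      let ?cs = "take r (u # bs) @ z x' x j # drop (r + 2) (u # bs)"
      have z: "z y' y j = z x' x j"
        using r snoc.prems by (simp add: z_def L_def nth_append)
      have T: "T t s j = as @ t # (take r (u # bs) @ z t s j # drop (r + 2) (u # bs))" for t s
        using r snoc.prems by (simp add: T_def L_def eval_nat_numeral)
      have "set ?cs \<subseteq> I"
        using zI' snoc.prems u set_take_subset[of r "u # bs"] set_drop_subset[of "r + 2" "u # bs"] by auto
      moreover have "length ?cs = n - Suc m"
        using r j snoc.prems by simp
      ultimately show ?thesis unfolding T z by (intro inner) auto
    next
      case 2
      have T: "T t s j = take j as @ z t s j # u # bs" for t s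
        using 2 snoc.prems by (simp add: T_def L_def flip: 2)
      have asj: "L t ! j = as ! j" for t using 2 snoc.prems by (simp add: L_def nth_append)
      have asI: "as ! j \<in> I" using 2 snoc.prems by (metis lessI nth_mem subsetD)
      have degz: "deg I (z t s j) = deg I (as ! j) \<otimes>\<^bsub>grading_group I\<^esub> deg I t"
        if "t \<in> I" for t s
      proof -
        have "z t s j = summand (as ! j) t"
          unfolding z_def 2 asj Lm using j by simp
        then show ?thesis
          using summand[OF asI that] mult_deg[OF asI that, of "summand (as ! j) t"] by simp
      qed
      show ?thesis unfolding T
        by (rule prev[OF 2[symmetric]])
           (use 2 snoc.prems u zI' degz[OF x'(1)] degz[OF y'(1)] deg' set_take_subset[of j as] in auto)
    next
      case 3
      let ?as = "take j as @ z x' x j # drop (j + 2) as"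
      have z: "z y' y j = z x' x j"
        using 3 snoc.prems by (simp add: z_def L_def nth_append)
      have T: "T t s j = (take j as @ z t s j # drop (j + 2) as) @ t # u # bs" for t s
        using 3 snoc.prems by (simp add: T_def L_def)
      obtain m' where m': "m = Suc m'" using 3 by (cases m) auto
      show ?thesis unfolding T z
        by (rule prev[OF m'])
           (use 3 m' snoc.prems u x' y' deg' zI' set_take_subset[of j as] set_drop_subset[of "j + 2" as] in auto)
    qed
  qed
  have Tm: "T t s m = as @ s # bs" for t s
    using snoc.prems by (simp add: T_def z_def L_def)
  have split: "(\<Prod>j<n. f (T t s j) powi ((-1) ^ Suc j))
      = f (as @ s # bs) powi ((-1) ^ Suc m) * (\<Prod>j\<in>{..<n} - {m}. f (T t s j) powi ((-1) ^ Suc j))" for t s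
    using snoc.prems(2) by (simp add: prod.remove[of _ m] Tm del: power_Suc)
  have rest: "(\<Prod>j\<in>{..<n} - {m}. f (T x' x j) powi ((-1) ^ Suc j)) = (\<Prod>j\<in>{..<n} - {m}. f (T y' y j) powi ((-1) ^ Suc j))"
    using T_eq by (intro prod.cong) auto
  have cancel: "p = q" if "a * (p * b) * c = 1" "a * (q * b) * c = 1" for a b c p q :: 'k
  proof -
    have "(a * b * c) * p = (a * b * c) * q" "a * b * c \<noteq> 0"
      using that by (auto simp: ac_simps)
    then show ?thesis by simp
  qed
  have "f (as @ x # bs) powi ((-1) ^ Suc m) = f (as @ y # bs) powi ((-1) ^ Suc m)"
    using cocycle[OF x'(1) snoc.prems(7) x'(3)] cocycle[OF y'(1) snoc.prems(8) y'(3)]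
    unfolding split rest tl_eq butlast_eq by (rule cancel)
  \<comment> \<open>The exponent is 1 or -1, so the power determines its base.\<close>
  then show ?case
    by (cases "even m") (auto simp: power_int_minus)
qed

lemma degree_invariance:
  assumes "m < n" "length as = m" "length bs = n - Suc m" "set as \<subseteq> I" "set bs \<subseteq> I"
    and "x \<in> I" "y \<in> I" "deg I x = deg I y"
  shows "f (as @ x # bs) = f (as @ y # bs)"
  using assms
proof (induction m arbitrary: as bs x y)
  case 0
  then obtain us where us: "us \<noteq> []" "set us \<subseteq> I" "based_le I x (prod_list us)" "based_le I y (prod_list us)"
    using deg_eq by (auto simp: deg_rel_def)
  show ?case by (rule degree_invariance_step[where m = 0, OF _ us(1,2)]) (use 0 us in auto)
next
  case (Suc m)
  then obtain us where us: "us \<noteq> []" "set us \<subseteq> I" "based_le I x (prod_list us)" "based_le I y (prod_list us)"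
    using deg_eq by (auto simp: deg_rel_def)
  show ?case
  proof (rule degree_invariance_step[where m = "Suc m", OF _ us(1,2)])
    fix m' as bs x y
    assume *: "Suc m = Suc m'" "length as = m'" "length bs = n - Suc m" "set as \<subseteq> I" "set bs \<subseteq> I"
      "x \<in> I" "y \<in> I" "deg I x = deg I y"
    show "f (as @ x # bs) = f (as @ y # bs)"
      by (rule Suc.IH) (use * Suc.prems(1) in simp_all)
  qed (use Suc.prems us in simp_all)
qed

lemma degree_invariance_list:
  assumes "length xs = n" "list_all2 (\<lambda>x y. x \<in> I \<and> y \<in> I \<and> deg I x = deg I y) xs ys"
  shows "f xs = f ys"
proof -
  have len: "length ys = n" using list_all2_lengthD[OF assms(2)] assms(1) by simp
  have nth: "xs ! k \<in> I \<and> ys ! k \<in> I \<and> deg I (xs ! k) = deg I (ys ! k)" if "k < n" for k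
    using list_all2_nthD[OF assms(2), of k] assms(1) that by simp
  have sets: "set xs \<subseteq> I" "set ys \<subseteq> I"
    using nth assms(1) len by (metis in_set_conv_nth subsetI)+
  \<comment> \<open>Interpolation between the lists: the first \<open>k\<close> entries are already
    exchanged, and each increase of \<open>k\<close> changes one position.\<close>
  have "f (take k ys @ drop k xs) = f xs" if "k \<le> n" for k
    using that
  proof (induction k)
    case (Suc k)
    have "take (Suc k) ys @ drop (Suc k) xs = take k ys @ ys ! k # drop (Suc k) xs"
      using Suc.prems len by (simp add: take_Suc_conv_app_nth)
    moreover have "take k ys @ drop k xs = take k ys @ xs ! k # drop (Suc k) xs"
      using Suc.prems assms(1) by (simp add: Cons_nth_drop_Suc)
    moreover have "f (take k ys @ ys ! k # drop (Suc k) xs) = f (take k ys @ xs ! k # drop (Suc k) xs)"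
      using Suc.prems len assms(1) sets nth[of k] set_take_subset[of k ys] set_drop_subset[of "Suc k" xs]
      by (intro degree_invariance[where m = k]) simp_all
    ultimately show ?case using Suc by simp
  qed simp
  from this[of n] show ?thesis using len assms(1) by simp
qed

text \<open>\<open>F\<close> evaluates \<open>f\<close> at representatives of the degrees;
  \<open>degree_invariance_list\<close> makes the choice of representatives immaterial.\<close>

lemma descends:
  "\<exists>F. group_cocycle n (grading_group I) F \<and> (\<forall>xs. length xs = n \<and> set xs \<subseteq> I \<longrightarrow> f xs = F (map (deg I) xs))"
proof (intro exI conjI allI impI)
  let ?F = "\<lambda>gs. f (map rep gs)"
  have deg_carrier: "deg I x \<in> carrier (grading_group I)" if "x \<in> I" for x
    using that carrier_iff by blast
  show "f xs = ?F (map (deg I) xs)" if "length xs = n \<and> set xs \<subseteq> I" for xs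
    using that rep[OF deg_carrier]
    by (intro degree_invariance_list) (auto simp: list_all2_conv_all_nth subset_iff)
  have rep_set: "set (map rep gs) \<subseteq> I" if "set gs \<subseteq> carrier (grading_group I)" for gs
    using that rep by auto
  show "group_cocycle n (grading_group I) ?F"
    unfolding group_cocycle_def
  proof (intro conjI allI impI)
    show "?F gs \<noteq> 0" if "length gs = n \<and> set gs \<subseteq> carrier (grading_group I)" for gs
      using nonzero[of "map rep gs"] rep_set[of gs] that by simp
    fix gs assume gs: "length gs = Suc n \<and> set gs \<subseteq> carrier (grading_group I)"
    define z where "z j = summand (rep (gs ! j)) (rep (gs ! Suc j))" for j
    have nth: "gs ! j \<in> carrier (grading_group I)" if "j \<le> n" for j
      using gs that by (metis le_imp_less_Suc nth_mem subsetD)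
    have z: "z j \<in> I \<and> based_le I (z j) (rep (gs ! j) * rep (gs ! Suc j))" if "j < n" for j
      using that rep[OF nth[of j]] rep[OF nth[of "Suc j"]] summand by (simp add: z_def)
    have degz: "deg I (z j) = gs ! j \<otimes>\<^bsub>grading_group I\<^esub> gs ! Suc j" if "j < n" for j
      using that z[OF that] rep[OF nth[of j]] rep[OF nth[of "Suc j"]] mult_deg[of "rep (gs ! j)" "rep (gs ! Suc j)" "z j"]
      by simp
    \<comment> \<open>The representative of a product of two degrees and a summand of the product of
      their representatives have the same degree. This converts the identity for summands into the
      coboundary condition.\<close>
    have middle: "?F (take j gs @ (gs ! j \<otimes>\<^bsub>grading_group I\<^esub> gs ! Suc j) # drop (j + 2) gs)
        = f (take j (map rep gs) @ z j # drop (j + 2) (map rep gs))" if j: "j < n" for j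
    proof (rule degree_invariance_list)
      let ?R = "\<lambda>x y. x \<in> I \<and> y \<in> I \<and> deg I x = deg I y"
      have refl: "list_all2 ?R (map rep hs) (map rep hs)" if "set hs \<subseteq> set gs" for hs
        using that gs rep by (auto simp: list_all2_conv_all_nth subset_iff)
      have "gs ! j \<otimes>\<^bsub>grading_group I\<^esub> gs ! Suc j \<in> carrier (grading_group I)"
        using degz[OF j] z[OF j] deg_carrier by metis
      from rep[OF this] have "?R (rep (gs ! j \<otimes>\<^bsub>grading_group I\<^esub> gs ! Suc j)) (z j)"
        using degz[OF j] z[OF j] by simp
      then show "list_all2 ?R (map rep (take j gs @ (gs ! j \<otimes>\<^bsub>grading_group I\<^esub> gs ! Suc j) # drop (j + 2) gs))
          (take j (map rep gs) @ z j # drop (j + 2) (map rep gs))"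
        using refl[OF set_take_subset[of j gs]] refl[OF set_drop_subset[of "j + 2" gs]]
        by (simp add: take_map drop_map list_all2_appendI)
    qed (use gs j in simp)
    have "f (tl (map rep gs)) * (\<Prod>j<n. f (take j (map rep gs) @ z j # drop (j + 2) (map rep gs)) powi ((-1) ^ Suc j))
            * f (butlast (map rep gs)) powi ((-1) ^ Suc n) = 1"
      using gs z rep_set[of gs] by (intro multivalued_cocycle) auto
    moreover have "(\<Prod>j<n. ?F (take j gs @ (gs ! j \<otimes>\<^bsub>grading_group I\<^esub> gs ! Suc j) # drop (j + 2) gs) powi ((-1) ^ Suc j))
      = (\<Prod>j<n. f (take j (map rep gs) @ z j # drop (j + 2) (map rep gs)) powi ((-1) ^ Suc j))"
      using middle by (intro prod.cong refl) (simp only: lessThan_iff)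
    ultimately show "group_coboundary n (grading_group I) ?F gs = 1"
      unfolding group_coboundary_def by (simp only: map_tl map_butlast)
  qed
qed

end
end

section \<open>The three cases, transferred from functions of lists to functions of two, three and
  four arguments\<close>

lemma (in based_ring) projective_fusionI:
  assumes "semisimple_category C" "tensor_product_category C" "has_grothendieck_ring I C X"
    and "\<And>i j k l. \<lbrakk>i \<in> I; j \<in> I; k \<in> I; l \<in> I\<rbrakk>
      \<Longrightarrow> \<exists>d. d \<noteq> 0 \<and> pentagon_at C (assoc C) d (X i) (X j) (X k) (X l)"
  shows "projective_fusion I dual C X"
  using assms based_ring_axioms by (simp add: projective_fusion_def projective_fusion_axioms_def)

lemma (in based_ring) categorification_projective_fusion:
  assumes "categorification I C X"
  shows "projective_fusion I dual C X"
proof (rule projective_fusionI)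
  interpret semisimple_tensor_category C using assms by (simp add: categorification_def)
  show "semisimple_category C" by (rule semisimple_category_axioms)
  show "tensor_product_category C" by (rule tensor_product_category_axioms)
  show "\<exists>d. d \<noteq> 0 \<and> pentagon_at C (assoc C) d (X i) (X j) (X k) (X l)" for i j k l
    by (intro exI[of _ 1] conjI one_neq_zero pentagon)
  show "has_grothendieck_ring I C X" using assms by (simp add: categorification_def)
qed

lemma (in based_ring) two_cocycle_descends:
  assumes C: "categorification I C X" and f: "categorical_2_cocycle I C X f"
  shows "\<exists>F. group_cocycle 2 (grading_group I) F \<and> (\<forall>i\<in>I. \<forall>j\<in>I. f i j = F [deg I i, deg I j])"
proof -
  interpret projective_fusion I dual C X using categorification_projective_fusion[OF C] .
  obtain J where nz: "\<And>i j. i \<in> I \<Longrightarrow> j \<in> I \<Longrightarrow> f i j \<noteq> 0"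
    and J: "\<And>i j. i \<in> I \<Longrightarrow> j \<in> I \<Longrightarrow> J (X i) (X j) = smult C (f i j) (idm C (X i \<odot>\<^bsub>C\<^esub> X j))"
      "\<And>A B. is_iso C (A \<odot>\<^bsub>C\<^esub> B) (A \<odot>\<^bsub>C\<^esub> B) (J A B)"
      "\<And>A A' B B' g h. g \<in> Mor C A A' \<Longrightarrow> h \<in> Mor C B B'
         \<Longrightarrow> J A' B' \<bullet>\<^bsub>C\<^esub> (g \<boxtimes>\<^bsub>C\<^esub> h) = (g \<boxtimes>\<^bsub>C\<^esub> h) \<bullet>\<^bsub>C\<^esub> J A B"
      "\<And>A B D. assoc C A B D \<bullet>\<^bsub>C\<^esub> J (A \<odot>\<^bsub>C\<^esub> B) D \<bullet>\<^bsub>C\<^esub> (J A B \<boxtimes>\<^bsub>C\<^esub> idm C D)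
         = J A (B \<odot>\<^bsub>C\<^esub> D) \<bullet>\<^bsub>C\<^esub> (idm C A \<boxtimes>\<^bsub>C\<^esub> J B D) \<bullet>\<^bsub>C\<^esub> assoc C A B D"
    using f unfolding categorical_2_cocycle_def by (elim conjE exE) blast
  have J_Mor: "J A B \<in> Mor C (A \<odot>\<^bsub>C\<^esub> B) (A \<odot>\<^bsub>C\<^esub> B)" for A B
    using J(2) by (simp add: is_iso_def)
  have mv: "f j k * f i w = f z k * f i j"
    if "i \<in> I" "j \<in> I" "k \<in> I" "z \<in> I" "based_le I z (i * j)" "w \<in> I" "based_le I w (j * k)" for i j k z w
    by (rule multivalued_2_cocycle[of f J]) (fact nz J J_Mor that)+
  have "\<exists>F. group_cocycle 2 (grading_group I) F \<and>
      (\<forall>xs. length xs = 2 \<and> set xs \<subseteq> I \<longrightarrow> f (xs ! 0) (xs ! 1) = F (map (deg I) xs))"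
  proof (rule descends)
    fix xs :: "'r list" assume "length xs = 2" "set xs \<subseteq> I"
    then show "f (xs ! 0) (xs ! 1) \<noteq> 0"
      using nz by (auto simp: length_Suc_conv numeral_2_eq_2)
  next
    fix xs :: "'r list" and z
    assume "length xs = Suc 2" and xs: "set xs \<subseteq> I"
      and z: "\<And>j. j < 2 \<Longrightarrow> z j \<in> I \<and> based_le I (z j) (xs ! j * xs ! Suc j)"
    then obtain a b c where abc: "xs = [a, b, c]" by (auto simp: length_Suc_conv numeral_2_eq_2)
    have I: "a \<in> I" "b \<in> I" "c \<in> I" using xs abc by auto
    from z[of 0] z[of 1] have z': "z 0 \<in> I" "based_le I (z 0) (a * b)" "z 1 \<in> I" "based_le I (z 1) (b * c)"
      by (simp_all add: abc)
    \<comment> \<open>The instances of \<open>nz\<close> concern the factors with exponent -1, which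
      are cleared as denominators; the other two cases proceed likewise.\<close>
    from mv[OF I z'] nz[OF z'(1) I(3)] nz[OF I(1,2)]
    show "f (tl xs ! 0) (tl xs ! 1) * (\<Prod>j<2. f ((take j xs @ z j # drop (j + 2) xs) ! 0)
        ((take j xs @ z j # drop (j + 2) xs) ! 1) powi ((-1) ^ Suc j))
      * f (butlast xs ! 0) (butlast xs ! 1) powi ((-1) ^ Suc 2) = 1"
      by (simp add: abc eval_nat_numeral field_simps power_int_minus)
  qed
  then obtain F where F: "group_cocycle 2 (grading_group I) F"
    and f_eq: "\<And>xs. length xs = 2 \<Longrightarrow> set xs \<subseteq> I \<Longrightarrow> f (xs ! 0) (xs ! 1) = F (map (deg I) xs)"
    by blast
  have "f i j = F [deg I i, deg I j]" if "i \<in> I" "j \<in> I" for i j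
    using f_eq[of "[i, j]"] that by simp
  with F show ?thesis by blast
qed

lemma (in based_ring) three_cocycle_descends:
  assumes C: "categorification I C X" and f: "categorical_3_cocycle I C X f"
  shows "\<exists>F. group_cocycle 3 (grading_group I) F \<and>
    (\<forall>i\<in>I. \<forall>j\<in>I. \<forall>k\<in>I. f i j k = F [deg I i, deg I j, deg I k])"
proof -
  interpret projective_fusion I dual C X using categorification_projective_fusion[OF C] .
  have pent: "pentagon_at C (assoc C) 1 A B D E" for A B D E
    using C semisimple_tensor_category.pentagon by (auto simp: categorification_def)
  obtain a where nz: "\<And>i j k. i \<in> I \<Longrightarrow> j \<in> I \<Longrightarrow> k \<in> I \<Longrightarrow> f i j k \<noteq> 0"
    and a: "\<And>i j k. i \<in> I \<Longrightarrow> j \<in> I \<Longrightarrow> k \<in> I \<Longrightarrow> a (X i) (X j) (X k) = smult C (f i j k) (assoc C (X i) (X j) (X k))"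
      "\<And>A B D. is_iso C ((A \<odot>\<^bsub>C\<^esub> B) \<odot>\<^bsub>C\<^esub> D) (A \<odot>\<^bsub>C\<^esub> (B \<odot>\<^bsub>C\<^esub> D)) (a A B D)"
      "\<And>A A' B B' D D' g h e. g \<in> Mor C A A' \<Longrightarrow> h \<in> Mor C B B' \<Longrightarrow> e \<in> Mor C D D'
         \<Longrightarrow> a A' B' D' \<bullet>\<^bsub>C\<^esub> ((g \<boxtimes>\<^bsub>C\<^esub> h) \<boxtimes>\<^bsub>C\<^esub> e) = (g \<boxtimes>\<^bsub>C\<^esub> (h \<boxtimes>\<^bsub>C\<^esub> e)) \<bullet>\<^bsub>C\<^esub> a A B D"
      "\<And>A B D E. pentagon_at C a 1 A B D E"
    using f unfolding categorical_3_cocycle_def by (elim conjE exE) blast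
  have a_Mor: "a A B D \<in> Mor C ((A \<odot>\<^bsub>C\<^esub> B) \<odot>\<^bsub>C\<^esub> D) (A \<odot>\<^bsub>C\<^esub> (B \<odot>\<^bsub>C\<^esub> D))" for A B D
    using a(2) by (simp add: is_iso_def)
  have mv: "f j k l * f i w l * f i j k = f z k l * f i j v"
    if "i \<in> I" "j \<in> I" "k \<in> I" "l \<in> I" "z \<in> I" "based_le I z (i * j)" "w \<in> I" "based_le I w (j * k)"
      "v \<in> I" "based_le I v (k * l)" for i j k l z w v
    by (rule multivalued_3_cocycle[of f a]) (fact nz a a_Mor pent that)+
  have "\<exists>F. group_cocycle 3 (grading_group I) F \<and>
      (\<forall>xs. length xs = 3 \<and> set xs \<subseteq> I \<longrightarrow> f (xs ! 0) (xs ! 1) (xs ! 2) = F (map (deg I) xs))"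
  proof (rule descends)
    fix xs :: "'r list" assume "length xs = 3" "set xs \<subseteq> I"
    then show "f (xs ! 0) (xs ! 1) (xs ! 2) \<noteq> 0"
      using nz by (auto simp: length_Suc_conv eval_nat_numeral)
  next
    fix xs :: "'r list" and z
    assume "length xs = Suc 3" and xs: "set xs \<subseteq> I"
      and z: "\<And>j. j < 3 \<Longrightarrow> z j \<in> I \<and> based_le I (z j) (xs ! j * xs ! Suc j)"
    then obtain a b c d where abcd: "xs = [a, b, c, d]" by (auto simp: length_Suc_conv eval_nat_numeral)
    have I: "a \<in> I" "b \<in> I" "c \<in> I" "d \<in> I" using xs abcd by auto
    from z[of 0] z[of 1] z[of 2]
    have z': "z 0 \<in> I" "based_le I (z 0) (a * b)" "z 1 \<in> I" "based_le I (z 1) (b * c)"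
        "z 2 \<in> I" "based_le I (z 2) (c * d)"
      by (simp_all add: abcd)
    from mv[OF I z'] nz[OF z'(1) I(3,4)] nz[OF I(1,2) z'(5)]
    show "f (tl xs ! 0) (tl xs ! 1) (tl xs ! 2) * (\<Prod>j<3. f ((take j xs @ z j # drop (j + 2) xs) ! 0)
        ((take j xs @ z j # drop (j + 2) xs) ! 1) ((take j xs @ z j # drop (j + 2) xs) ! 2) powi ((-1) ^ Suc j))
      * f (butlast xs ! 0) (butlast xs ! 1) (butlast xs ! 2) powi ((-1) ^ Suc 3) = 1"
      by (simp add: abcd eval_nat_numeral field_simps power_int_minus)
  qed
  then obtain F where F: "group_cocycle 3 (grading_group I) F"
    and f_eq: "\<And>xs. length xs = 3 \<Longrightarrow> set xs \<subseteq> I \<Longrightarrow> f (xs ! 0) (xs ! 1) (xs ! 2) = F (map (deg I) xs)"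
    by blast
  have "f i j k = F [deg I i, deg I j, deg I k]" if "i \<in> I" "j \<in> I" "k \<in> I" for i j k
    using f_eq[of "[i, j, k]"] that by simp
  with F show ?thesis by blast
qed

lemma (in based_ring) four_cocycle_descends:
  assumes f: "projective_categorification I dual C X f"
  shows "\<exists>F. group_cocycle 4 (grading_group I) F \<and>
    (\<forall>i\<in>I. \<forall>j\<in>I. \<forall>k\<in>I. \<forall>l\<in>I. f i j k l = F [deg I i, deg I j, deg I k, deg I l])"
proof -
  have nz: "f i j k l \<noteq> 0" and pent: "pentagon_at C (assoc C) (f i j k l) (X i) (X j) (X k) (X l)"
    if "i \<in> I" "j \<in> I" "k \<in> I" "l \<in> I" for i j k l
    using f that unfolding projective_categorification_def by simp_all
  interpret projective_fusion I dual C X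
  proof (rule projective_fusionI)
    show "\<exists>d. d \<noteq> 0 \<and> pentagon_at C (assoc C) d (X i) (X j) (X k) (X l)"
      if "i \<in> I" "j \<in> I" "k \<in> I" "l \<in> I" for i j k l
      using nz[OF that] pent[OF that] by blast
  qed (use f in \<open>simp_all add: projective_categorification_def\<close>)
  have mv: "f j k l m * f i w l m * f i j k u = f z k l m * f i j v m * f i j k l"
    if "i \<in> I" "j \<in> I" "k \<in> I" "l \<in> I" "m \<in> I" "z \<in> I" "based_le I z (i * j)" "w \<in> I" "based_le I w (j * k)"
      "v \<in> I" "based_le I v (k * l)" "u \<in> I" "based_le I u (l * m)" for i j k l m z w v u
    by (rule multivalued_4_cocycle[of f]) (fact nz pent that)+
  have "\<exists>F. group_cocycle 4 (grading_group I) F \<and>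
      (\<forall>xs. length xs = 4 \<and> set xs \<subseteq> I \<longrightarrow> f (xs ! 0) (xs ! 1) (xs ! 2) (xs ! 3) = F (map (deg I) xs))"
  proof (rule descends)
    fix xs :: "'r list" assume "length xs = 4" "set xs \<subseteq> I"
    then show "f (xs ! 0) (xs ! 1) (xs ! 2) (xs ! 3) \<noteq> 0"
      using nz by (auto simp: length_Suc_conv eval_nat_numeral)
  next
    fix xs :: "'r list" and z
    assume "length xs = Suc 4" and xs: "set xs \<subseteq> I"
      and z: "\<And>j. j < 4 \<Longrightarrow> z j \<in> I \<and> based_le I (z j) (xs ! j * xs ! Suc j)"
    then obtain a b c d e where abcde: "xs = [a, b, c, d, e]" by (auto simp: length_Suc_conv eval_nat_numeral)
    have I: "a \<in> I" "b \<in> I" "c \<in> I" "d \<in> I" "e \<in> I" using xs abcde by auto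
    from z[of 0] z[of 1] z[of 2] z[of 3]
    have z': "z 0 \<in> I" "based_le I (z 0) (a * b)" "z 1 \<in> I" "based_le I (z 1) (b * c)"
        "z 2 \<in> I" "based_le I (z 2) (c * d)" "z 3 \<in> I" "based_le I (z 3) (d * e)"
      by (simp_all add: abcde)
    from mv[OF I z'] nz[OF z'(1) I(3,4,5)] nz[OF I(1,2) z'(5) I(5)] nz[OF I(1,2,3,4)]
    show "f (tl xs ! 0) (tl xs ! 1) (tl xs ! 2) (tl xs ! 3) * (\<Prod>j<4. f ((take j xs @ z j # drop (j + 2) xs) ! 0)
        ((take j xs @ z j # drop (j + 2) xs) ! 1) ((take j xs @ z j # drop (j + 2) xs) ! 2)
        ((take j xs @ z j # drop (j + 2) xs) ! 3) powi ((-1) ^ Suc j))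
      * f (butlast xs ! 0) (butlast xs ! 1) (butlast xs ! 2) (butlast xs ! 3) powi ((-1) ^ Suc 4) = 1"
      by (simp add: abcde eval_nat_numeral field_simps power_int_minus)
  qed
  then obtain F where F: "group_cocycle 4 (grading_group I) F"
    and f_eq: "\<And>xs. length xs = 4 \<Longrightarrow> set xs \<subseteq> I \<Longrightarrow> f (xs ! 0) (xs ! 1) (xs ! 2) (xs ! 3) = F (map (deg I) xs)"
    by blast
  have "f i j k l = F [deg I i, deg I j, deg I k, deg I l]" if "i \<in> I" "j \<in> I" "k \<in> I" "l \<in> I" for i j k l
    using f_eq[of "[i, j, k, l]"] that by simp
  with F show ?thesis by blast
qed

theorem theorem4p10:
  fixes I :: "'r::ring_1 set" and dual :: "'r \<Rightarrow> 'r"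
    and C :: "('k::alg_closed_field, 'o, 'm::ab_group_add) tensor_data" and X :: "'r \<Rightarrow> 'o"
    and f\<^sub>2 :: "'r \<Rightarrow> 'r \<Rightarrow> 'k" and f\<^sub>3 :: "'r \<Rightarrow> 'r \<Rightarrow> 'r \<Rightarrow> 'k"
    and f\<^sub>4 :: "'r \<Rightarrow> 'r \<Rightarrow> 'r \<Rightarrow> 'r \<Rightarrow> 'k"
  assumes "based_ring I dual"
  shows "(categorification I C X \<and> categorical_2_cocycle I C X f\<^sub>2 \<longrightarrow>
           (\<exists>F. group_cocycle 2 (grading_group I) F \<and>
             (\<forall>i\<in>I. \<forall>j\<in>I. f\<^sub>2 i j = F [deg I i, deg I j])))
       \<and> (categorification I C X \<and> categorical_3_cocycle I C X f\<^sub>3 \<longrightarrow>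
           (\<exists>F. group_cocycle 3 (grading_group I) F \<and>
             (\<forall>i\<in>I. \<forall>j\<in>I. \<forall>k\<in>I. f\<^sub>3 i j k = F [deg I i, deg I j, deg I k])))
       \<and> (categorical_4_cocycle TYPE('o) TYPE('m) I dual f\<^sub>4 \<longrightarrow>
           (\<exists>F. group_cocycle 4 (grading_group I) F \<and>
             (\<forall>i\<in>I. \<forall>j\<in>I. \<forall>k\<in>I. \<forall>l\<in>I. f\<^sub>4 i j k l = F [deg I i, deg I j, deg I k, deg I l])))"
  using based_ring.two_cocycle_descends[OF assms] based_ring.three_cocycle_descends[OF assms]
    based_ring.four_cocycle_descends[OF assms]
  unfolding categorical_4_cocycle_def by blast

end
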